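(* Let $k$ be a field of characteristic zero, and let $\mathrm H_{\mathbf{Mat}_\bullet}$ be the Hall algebra over $k$ of the finitary proto-exact category $\mathbf{Mat}_\bullet$ of pointed matroids and strong maps. Then $\mathrm H_{\mathbf{Mat}_\bullet}$, with the product $\bullet$, the coproduct $\Delta(f)([A],[B])=f([A\oplus B])$ and the grading described in the context, is a graded, connected, co-commutative Hopf algebra, and it is dual to Schmitt's matroid-minor Hopf algebra: it is isomorphic as a Hopf algebra to the (graded) dual of the matroid-minor Hopf algebra of the collection of all pointed matroids.
   Context: Matroids. A matroid $M$ on a finite ground set $E_M$ is given by its closure (flats) operator $\sigma$; flats are the sets $\sigma S$, and $\mathcal F(M)$ is the set of flats. $M|S$ is the matroid on $S$ with flats $\{A\cap S: A\in\mathcal F(M)\}$; $M/S$ is the matroid on $E_M\setminus S$ with flats $\{A\setminus S: S\subseteq A\in\mathcal F(M)\}$. A pointed matroid is a pair $(M,*_M)$ with $*_M\in E_M$ a distinguished loop (an element of $\sigma\emptyset$); write $\widetilde E_M=E_M\setminus\{*_M\}$. For $S\subseteq\widetilde E_M$, $M|S$ means the restriction to $S\cup\{*_M\}$, pointed by $*_M$, and $M/S$ is pointed by $*_M$. The direct sum $M_1\oplus M_2$ of pointed matroids has ground set the wedge sum $E_{M_1}\vee E_{M_2}$ (basepoints identified), and its flats are the sets $F_1\vee F_2$ with $F_i\in\mathcal F(M_i)$. A strong map $f:M\to N$ is a function $E_M\to E_N$ with $f( *_M)=*_N$ and $f^{-1}A\in\mathcal F(M)$ for all $A\in\mathcal F(N)$.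 The zero object $0$ is the pointed matroid on $\{*\}$. Proto-exact structure. Admissible monomorphisms of $\mathbf{Mat}_\bullet$ are the strong maps factoring as an isomorphism $N\to M|S$ followed by the inclusion into $M$ ($S\subseteq\widetilde E_M$); admissible epimorphisms are those factoring as the canonical map $M\to M/S$ (sending $S$ to $*_M$ and fixing the other elements) followed by an isomorphism. An admissible short exact sequence $A\hookrightarrow B\twoheadrightarrow C$ is a square that is Cartesian and co-Cartesian with top $A\to B$ and bottom $0\to C$ admissible monomorphisms, and left $A\to0$ and right $B\to C$ admissible epimorphisms; write $C=B/A$. Admissible subobjects $A\subseteq B$ are isomorphism classes of admissible monomorphisms $i:A\to B$, where $i_1:A\to B$ and $i_2:A'\to B$ are isomorphic if $i_1=i_2\circ f$ for an isomorphism $f:A\to A'$. Hall algebra. For a finitary proto-exact category $\mathcal E$, $\mathrm H_{\mathcal E}$ is the space of finitely supported functions $f:\mathrm{Iso}(\mathcal E)\to k$ with product $(f\bullet g)([B])=\sum_{A\subseteq B}f([B/A])\,g([A])$, the sum being over admissible subobjects $A$ of $B$; the unit is $\delta_{[0]}$, where $\delta_{[B]}$ is the indicator function of $[B]$. The coproduct is $\Delta(f)([A],[B])=f([A\oplus B])$. The grading is by $K_0(\mathcal E)^+$, with $\deg\delta_{[B]}=[B]$. Here $K_0(\mathcal E)$ is the free group on $\mathrm{Iso}(\mathcal E)$ modulo $[B]=[A][C]$ for every admissible short exact sequence $A\hookrightarrow B\twoheadrightarrow C$ (abelian for $\mathcal E=\mathbf{Mat}_\bullet$), and $K_0(\mathcal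 E)^+$ is the sub-semigroup generated by classes of objects. Connected means that the degree-zero part is $k\,\delta_{[0]}$. Matroid-minor Hopf algebra. Let $\mathcal M_{iso}$ be the set of isomorphism classes of pointed matroids, a commutative monoid under $[M_1]\cdot[M_2]=[M_1\oplus M_2]$. The monoid algebra $k[\mathcal M_{iso}]$, with coproduct $[M]\mapsto\sum_{S\subseteq\widetilde E_M}[M|S]\otimes[M/S]$, counit $[M]\mapsto 1$ if $\widetilde E_M=\emptyset$ and $0$ otherwise, and grading $\deg M=\#\widetilde E_M$, is a graded connected bialgebra, hence a Hopf algebra. Its dual Hopf algebra is the space of finitely supported functions $f:\mathcal M_{iso}\to k$ with product $(f\diamond g)([M])=\sum_{S\subseteq\widetilde E_M}f([M|S])\,g([M/S])$ and coproduct $\Delta(f)([M],[N])=f([M\oplus N])$. *)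

theory Defs
  imports Complex_Main "HOL-Library.FuncSet" "HOL-Library.Poly_Mapping"
begin

section \<open>Pointed matroids\<close>

definition matroid_closure :: "'a set \<Rightarrow> ('a set \<Rightarrow> 'a set) \<Rightarrow> bool" where
  "matroid_closure E \<sigma> \<longleftrightarrow>
     (\<forall>S. S \<subseteq> E \<longrightarrow> S \<subseteq> \<sigma> S \<and> \<sigma> S \<subseteq> E) \<and>
     (\<forall>S T. S \<subseteq> T \<and> T \<subseteq> E \<longrightarrow> \<sigma> S \<subseteq> \<sigma> T) \<and>
     (\<forall>S. S \<subseteq> E \<longrightarrow> \<sigma> (\<sigma> S) = \<sigma> S) \<and>
     (\<forall>S x y. S \<subseteq> E \<and> x \<in> E \<and> y \<in> \<sigma> (insert x S) - \<sigma> S \<longrightarrow> x \<in> \<sigma> (insert y S))"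

text \<open>
  The closure operator is recovered from the flats (the closure of \<open>S\<close> is the least flat
  containing \<open>S\<close>), so a pointed matroid is stored as ground set, set of flats and base point.
\<close>

record 'a pmat =
  ground :: "'a set"
  flats :: "'a set set"
  point :: 'a

definition pmatroid :: "'a pmat \<Rightarrow> bool" where
  "pmatroid M \<longleftrightarrow> finite (ground M) \<and>
     (\<exists>\<sigma>. matroid_closure (ground M) \<sigma> \<and> flats M = \<sigma> ` Pow (ground M) \<and> point M \<in> \<sigma> {})"

definition elems :: "'a pmat \<Rightarrow> 'a set" where
  "elems M = ground M - {point M}"

definition restriction :: "'a pmat \<Rightarrow> 'a set \<Rightarrow> 'a pmat" where
  "restriction M S =
     \<lparr>ground = insert (point M) S, flats = {A \<inter> insert (point M) S | A. A \<in> flats M},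
      point = point M\<rparr>"

definition contraction :: "'a pmat \<Rightarrow> 'a set \<Rightarrow> 'a pmat" where
  "contraction M S =
     \<lparr>ground = ground M - S, flats = {A - S | A. S \<subseteq> A \<and> A \<in> flats M}, point = point M\<rparr>"

text \<open>The wedge of two pointed sets: \<open>None\<close> is the common base point.\<close>

definition wedge :: "'a \<Rightarrow> 'b \<Rightarrow> 'a set \<Rightarrow> 'b set \<Rightarrow> ('a + 'b) option set" where
  "wedge p q A B = insert None (Some ` (Inl ` (A - {p}) \<union> Inr ` (B - {q})))"

definition direct_sum :: "'a pmat \<Rightarrow> 'b pmat \<Rightarrow> ('a + 'b) option pmat" where
  "direct_sum M N =
     \<lparr>ground = wedge (point M) (point N) (ground M) (ground N),
      flats = {wedge (point M) (point N) F G | F G. F \<in> flats M \<and> G \<in> flats N},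
      point = None\<rparr>"

text \<open>Maps are extensional (equal to \<open>undefined\<close> off the ground set), so that morphisms
  are equal iff they are equal as HOL functions.\<close>

definition strong_map :: "'a pmat \<Rightarrow> 'b pmat \<Rightarrow> ('a \<Rightarrow> 'b) \<Rightarrow> bool" where
  "strong_map M N f \<longleftrightarrow>
     f \<in> ground M \<rightarrow>\<^sub>E ground N \<and> f (point M) = point N \<and>
     (\<forall>A\<in>flats N. f -` A \<inter> ground M \<in> flats M)"

definition iso_map :: "'a pmat \<Rightarrow> 'b pmat \<Rightarrow> ('a \<Rightarrow> 'b) \<Rightarrow> bool" where
  "iso_map M N f \<longleftrightarrow> strong_map M N f \<and>
     (\<exists>g. strong_map N M g \<and>
          compose (ground M) g f = (\<lambda>x\<in>ground M. x) \<and>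
          compose (ground N) f g = (\<lambda>x\<in>ground N. x))"

definition pmat_iso :: "'a pmat \<Rightarrow> 'b pmat \<Rightarrow> bool" where
  "pmat_iso M N \<longleftrightarrow> (\<exists>f. iso_map M N f)"

text \<open>The object of the category on the ground set \<open>{*}\<close>, with \<open>* = 0\<close>.\<close>

definition zero_pmat :: "nat pmat" where
  "zero_pmat = \<lparr>ground = {0}, flats = {{0}}, point = 0\<rparr>"


section \<open>The proto-exact structure\<close>

definition adm_mono :: "'a pmat \<Rightarrow> 'a pmat \<Rightarrow> ('a \<Rightarrow> 'a) \<Rightarrow> bool" where
  "adm_mono N M i \<longleftrightarrow> pmatroid N \<and> pmatroid M \<and> strong_map N M i \<and>
     (\<exists>S f. S \<subseteq> elems M \<and> iso_map N (restriction M S) f \<and>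
            i = compose (ground N) (\<lambda>x\<in>ground (restriction M S). x) f)"

definition adm_epi :: "'a pmat \<Rightarrow> 'a pmat \<Rightarrow> ('a \<Rightarrow> 'a) \<Rightarrow> bool" where
  "adm_epi M N p \<longleftrightarrow> pmatroid M \<and> pmatroid N \<and> strong_map M N p \<and>
     (\<exists>S f. S \<subseteq> elems M \<and> iso_map (contraction M S) N f \<and>
            p = compose (ground M) f (\<lambda>x\<in>ground M. if x \<in> S then point M else x))"

text \<open>Squares with top \<open>i : A \<rightarrow> B\<close>, left \<open>q : A \<rightarrow> Z\<close>, right \<open>p : B \<rightarrow> C\<close>,
  bottom \<open>z : Z \<rightarrow> C\<close>. The category is taken on ground sets in a fixed type.\<close>

definition commutative_square ::
    "'a pmat \<Rightarrow> 'a pmat \<Rightarrow> 'a pmat \<Rightarrow> 'a pmat \<Rightarrow>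
     ('a \<Rightarrow> 'a) \<Rightarrow> ('a \<Rightarrow> 'a) \<Rightarrow> ('a \<Rightarrow> 'a) \<Rightarrow> ('a \<Rightarrow> 'a) \<Rightarrow> bool" where
  "commutative_square A B Z C i q p z \<longleftrightarrow>
     strong_map A B i \<and> strong_map A Z q \<and> strong_map B C p \<and> strong_map Z C z \<and>
     compose (ground A) p i = compose (ground A) z q"

definition cartesian ::
    "'a pmat \<Rightarrow> 'a pmat \<Rightarrow> 'a pmat \<Rightarrow> 'a pmat \<Rightarrow>
     ('a \<Rightarrow> 'a) \<Rightarrow> ('a \<Rightarrow> 'a) \<Rightarrow> ('a \<Rightarrow> 'a) \<Rightarrow> ('a \<Rightarrow> 'a) \<Rightarrow> bool" where
  "cartesian A B Z C i q p z \<longleftrightarrow> commutative_square A B Z C i q p z \<and>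
     (\<forall>(P :: 'a pmat) u v. pmatroid P \<and> strong_map P B u \<and> strong_map P Z v \<and>
              compose (ground P) p u = compose (ground P) z v \<longrightarrow>
        (\<exists>!w. strong_map P A w \<and> compose (ground P) i w = u \<and> compose (ground P) q w = v))"

definition cocartesian ::
    "'a pmat \<Rightarrow> 'a pmat \<Rightarrow> 'a pmat \<Rightarrow> 'a pmat \<Rightarrow>
     ('a \<Rightarrow> 'a) \<Rightarrow> ('a \<Rightarrow> 'a) \<Rightarrow> ('a \<Rightarrow> 'a) \<Rightarrow> ('a \<Rightarrow> 'a) \<Rightarrow> bool" where
  "cocartesian A B Z C i q p z \<longleftrightarrow> commutative_square A B Z C i q p z \<and>
     (\<forall>(P :: 'a pmat) u v. pmatroid P \<and> strong_map B P u \<and> strong_map Z P v \<and>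
              compose (ground A) u i = compose (ground A) v q \<longrightarrow>
        (\<exists>!w. strong_map C P w \<and> compose (ground B) w p = u \<and> compose (ground Z) w z = v))"

definition adm_ses ::
    "nat pmat \<Rightarrow> (nat \<Rightarrow> nat) \<Rightarrow> nat pmat \<Rightarrow> (nat \<Rightarrow> nat) \<Rightarrow> nat pmat \<Rightarrow> bool" where
  "adm_ses A i B p C \<longleftrightarrow>
     (\<exists>q z. adm_mono A B i \<and> adm_mono zero_pmat C z \<and>
            adm_epi A zero_pmat q \<and> adm_epi B C p \<and>
            cartesian A B zero_pmat C i q p z \<and> cocartesian A B zero_pmat C i q p z)"

definition subobject_rel ::
    "nat pmat \<Rightarrow> ((nat pmat \<times> (nat \<Rightarrow> nat)) \<times> (nat pmat \<times> (nat \<Rightarrow> nat))) set" where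
  "subobject_rel B = {((A, i), (A', j)). adm_mono A B i \<and> adm_mono A' B j \<and>
     (\<exists>f. iso_map A A' f \<and> i = compose (ground A) j f)}"

definition adm_subobjects :: "nat pmat \<Rightarrow> (nat pmat \<times> (nat \<Rightarrow> nat)) set set" where
  "adm_subobjects B = {(A, i). adm_mono A B i} // subobject_rel B"


section \<open>Isomorphism classes\<close>

lemma strong_map_compose:
  assumes "strong_map M N f" and "strong_map N P g" and "point M \<in> ground M"
  shows "strong_map M P (compose (ground M) g f)"
proof -
  have "compose (ground M) g f -` A \<inter> ground M \<in> flats M" if "A \<in> flats P" for A
  proof -
    have "compose (ground M) g f -` A \<inter> ground M = f -` (g -` A \<inter> ground N) \<inter> ground M"
      using assms(1) by (auto simp: strong_map_def compose_def)
    moreover have "g -` A \<inter> ground N \<in> flats N"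
      using assms(2) that by (simp add: strong_map_def)
    ultimately show ?thesis
      using assms(1) by (simp only: strong_map_def)
  qed
  moreover have "compose (ground M) g f \<in> ground M \<rightarrow>\<^sub>E ground P"
    using assms by (auto simp: strong_map_def compose_def)
  moreover have "compose (ground M) g f (point M) = point P"
    using assms by (simp add: strong_map_def compose_eq)
  ultimately show ?thesis
    by (simp add: strong_map_def)
qed

lemma pmatroid_flats_subset:
  assumes "pmatroid M" and "A \<in> flats M"
  shows "A \<subseteq> ground M"
proof -
  obtain \<sigma> where \<sigma>: "matroid_closure (ground M) \<sigma>" and "flats M = \<sigma> ` Pow (ground M)"
    using assms(1) unfolding pmatroid_def by blast
  then obtain S where "S \<subseteq> ground M" and "A = \<sigma> S"
    using assms(2) by blast
  moreover have "\<forall>S. S \<subseteq> ground M \<longrightarrow> \<sigma> S \<subseteq> ground M"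
    using \<sigma> by (simp add: matroid_closure_def)
  ultimately show ?thesis by blast
qed

lemma pmatroid_point:
  assumes "pmatroid M"
  shows "point M \<in> ground M"
proof -
  obtain \<sigma> where \<sigma>: "matroid_closure (ground M) \<sigma>" "point M \<in> \<sigma> {}"
    using assms unfolding pmatroid_def by blast
  have "\<sigma> {} \<subseteq> ground M"
    using \<sigma>(1) by (simp add: matroid_closure_def)
  then show ?thesis
    using \<sigma>(2) by blast
qed

lemma pmat_iso_refl:
  assumes "pmatroid M"
  shows "pmat_iso M M"
proof -
  have "(\<lambda>x\<in>ground M. x) -` A \<inter> ground M = A" if "A \<in> flats M" for A
    using pmatroid_flats_subset[OF assms that] by auto
  then have "strong_map M M (\<lambda>x\<in>ground M. x)"
    using pmatroid_point[OF assms] by (auto simp: strong_map_def)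
  moreover have "compose (ground M) (\<lambda>x\<in>ground M. x) (\<lambda>x\<in>ground M. x) = (\<lambda>x\<in>ground M. x)"
    by (auto simp: compose_def)
  ultimately show ?thesis
    unfolding pmat_iso_def iso_map_def by blast
qed

lemma pmat_iso_sym: "pmat_iso M N \<Longrightarrow> pmat_iso N M"
  unfolding pmat_iso_def iso_map_def by blast

lemma pmat_iso_trans:
  assumes "pmatroid M" and "pmatroid P" and "pmat_iso M N" and "pmat_iso N P"
  shows "pmat_iso M P"
proof -
  obtain f f' where f: "strong_map M N f" "strong_map N M f'"
      "compose (ground M) f' f = (\<lambda>x\<in>ground M. x)"
    and f2: "compose (ground N) f f' = (\<lambda>x\<in>ground N. x)"
    using assms(3) unfolding pmat_iso_def iso_map_def by blast
  obtain g g' where g: "strong_map N P g" "strong_map P N g'"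
      "compose (ground N) g' g = (\<lambda>x\<in>ground N. x)"
    and g2: "compose (ground P) g g' = (\<lambda>x\<in>ground P. x)"
    using assms(4) unfolding pmat_iso_def iso_map_def by blast
  have maps: "f x \<in> ground N" if "x \<in> ground M" for x
    using f(1) that by (auto simp: strong_map_def)
  have maps': "g' x \<in> ground N" if "x \<in> ground P" for x
    using g(2) that by (auto simp: strong_map_def)
  have inv: "f' (f x) = x" if "x \<in> ground M" for x
    using fun_cong[OF f(3), of x] that by (simp add: compose_def)
  have inv2: "f (f' x) = x" if "x \<in> ground N" for x
    using fun_cong[OF f2, of x] that by (simp add: compose_def)
  have inv3: "g' (g x) = x" if "x \<in> ground N" for x
    using fun_cong[OF g(3), of x] that by (simp add: compose_def)
  have inv4: "g (g' x) = x" if "x \<in> ground P" for x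
    using fun_cong[OF g2, of x] that by (simp add: compose_def)
  have gr: "g x \<in> ground P" if "x \<in> ground N" for x
    using g(1) that by (auto simp: strong_map_def)
  have fr: "f' x \<in> ground M" if "x \<in> ground N" for x
    using f(2) that by (auto simp: strong_map_def)
  have 1: "strong_map M P (compose (ground M) g f)"
    using strong_map_compose f(1) g(1) pmatroid_point[OF assms(1)] by blast
  have 2: "strong_map P M (compose (ground P) f' g')"
    using strong_map_compose f(2) g(2) pmatroid_point[OF assms(2)] by blast
  have 3: "compose (ground M) (compose (ground P) f' g') (compose (ground M) g f)
      = (\<lambda>x\<in>ground M. x)"
    by (rule ext) (simp add: compose_def maps gr inv3 inv)
  have 4: "compose (ground P) (compose (ground M) g f) (compose (ground P) f' g')
      = (\<lambda>x\<in>ground P. x)"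
    by (rule ext) (simp add: compose_def maps' fr inv2 inv4)
  show ?thesis
    unfolding pmat_iso_def iso_map_def using 1 2 3 4 by blast
qed

lemma pmatroid_zero_pmat: "pmatroid zero_pmat"
proof -
  have "matroid_closure {0::nat} (\<lambda>_. {0})"
    by (auto simp: matroid_closure_def)
  then show ?thesis
    unfolding pmatroid_def zero_pmat_def by (intro conjI exI[of _ "\<lambda>_. {0}"]) auto
qed

text \<open>
  Every finite pointed matroid is isomorphic to one with ground set a finite set of natural
  numbers, so these suffice as representatives of all isomorphism classes.
\<close>

quotient_type mat_iso = "nat pmat" / partial:
  "\<lambda>M N. pmatroid M \<and> pmatroid N \<and> pmat_iso M N"
proof (rule part_equivpI)
  show "\<exists>M::nat pmat. pmatroid M \<and> pmatroid M \<and> pmat_iso M M"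
    using pmatroid_zero_pmat pmat_iso_refl by blast
  show "symp (\<lambda>M N :: nat pmat. pmatroid M \<and> pmatroid N \<and> pmat_iso M N)"
    by (rule sympI) (metis pmat_iso_sym)
  show "transp (\<lambda>M N :: nat pmat. pmatroid M \<and> pmatroid N \<and> pmat_iso M N)"
    by (rule transpI) (metis pmat_iso_trans)
qed

text \<open>\<open>rep_mat_iso X\<close> is a chosen pointed matroid in the class \<open>X\<close>; \<open>iso_class M\<close> is the
  class of a pointed matroid \<open>M\<close> on any type.\<close>

definition iso_class :: "'a pmat \<Rightarrow> mat_iso" where
  "iso_class M = abs_mat_iso (SOME N. pmatroid N \<and> pmat_iso N M)"

definition class_sum :: "mat_iso \<Rightarrow> mat_iso \<Rightarrow> mat_iso" where
  "class_sum X Y = iso_class (direct_sum (rep_mat_iso X) (rep_mat_iso Y))"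

definition class_zero :: mat_iso where
  "class_zero = iso_class zero_pmat"

definition class_size :: "mat_iso \<Rightarrow> nat" where
  "class_size X = card (elems (rep_mat_iso X))"

text \<open>The classes of \<open>A\<close> and of \<open>B/A\<close> for an admissible subobject \<open>T = (A \<rightarrow> B)\<close>.\<close>

definition sub_class :: "(nat pmat \<times> (nat \<Rightarrow> nat)) set \<Rightarrow> mat_iso" where
  "sub_class T = (THE X. \<exists>A i. (A, i) \<in> T \<and> X = iso_class A)"

definition quot_class :: "nat pmat \<Rightarrow> (nat pmat \<times> (nat \<Rightarrow> nat)) set \<Rightarrow> mat_iso" where
  "quot_class B T = (THE X. \<exists>A i p C. (A, i) \<in> T \<and> adm_ses A i B p C \<and> X = iso_class C)"


section \<open>The Grothendieck group\<close>

text \<open>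
  Words in the generators \<open>(True, X)\<close> and their formal inverses \<open>(False, X)\<close>, modulo the least
  congruence containing free cancellation and the relations \<open>[B] = [A][C]\<close>. The group
  law is written additively although the presentation is non-abelian.
\<close>

inductive K0_rel :: "(bool \<times> mat_iso) list \<Rightarrow> (bool \<times> mat_iso) list \<Rightarrow> bool" where
  refl: "K0_rel u u"
| sym: "K0_rel u v \<Longrightarrow> K0_rel v u"
| trans: "K0_rel u v \<Longrightarrow> K0_rel v w \<Longrightarrow> K0_rel u w"
| append: "K0_rel u u' \<Longrightarrow> K0_rel v v' \<Longrightarrow> K0_rel (u @ v) (u' @ v')"
| cancel: "K0_rel [(b, X), (\<not> b, X)] []"
| ses: "adm_ses A i B p C \<Longrightarrow>
    K0_rel [(True, iso_class B)] [(True, iso_class A), (True, iso_class C)]"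

quotient_type K0 = "(bool \<times> mat_iso) list" / K0_rel
proof (rule equivpI)
  show "reflp K0_rel" by (rule reflpI) (rule K0_rel.refl)
  show "symp K0_rel" by (rule sympI) (rule K0_rel.sym)
  show "transp K0_rel" by (rule transpI) (rule K0_rel.trans)
qed

abbreviation word_inverse :: "(bool \<times> mat_iso) list \<Rightarrow> (bool \<times> mat_iso) list" where
  "word_inverse w \<equiv> rev (map (apfst Not) w)"

lemma K0_rel_left_inverse: "K0_rel (word_inverse w @ w) []"
proof (induction w)
  case Nil
  show ?case by (simp add: K0_rel.refl)
next
  case (Cons a w)
  obtain b X where a: "a = (b, X)" by force
  have "K0_rel [(\<not> b, X), (b, X)] []"
    using K0_rel.cancel[of "\<not> b" X] by simp
  then have "K0_rel ([(\<not> b, X), (b, X)] @ w) ([] @ w)"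
    by (rule K0_rel.append) (rule K0_rel.refl)
  from K0_rel.append[OF K0_rel.refl this]
  have "K0_rel (word_inverse w @ ([(\<not> b, X), (b, X)] @ w)) (word_inverse w @ ([] @ w))" .
  then show ?case
    using K0_rel.trans[OF _ Cons.IH] by (simp add: a)
qed

lemma K0_rel_right_inverse: "K0_rel (w @ word_inverse w) []"
proof -
  have "word_inverse (word_inverse w) = w"
    by (simp add: rev_map comp_def apfst_def map_prod_def case_prod_beta)
  then show ?thesis
    using K0_rel_left_inverse[of "word_inverse w"] by simp
qed

lemma K0_rel_inverse_cong:
  assumes "K0_rel u v"
  shows "K0_rel (word_inverse u) (word_inverse v)"
proof -
  have "K0_rel ([] @ word_inverse v) ((word_inverse u @ u) @ word_inverse v)"
    by (intro K0_rel.append K0_rel.refl K0_rel.sym[OF K0_rel_left_inverse])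
  then have 1: "K0_rel (word_inverse v) (word_inverse u @ u @ word_inverse v)"
    by simp
  have 2: "K0_rel (word_inverse u @ u @ word_inverse v) (word_inverse u @ v @ word_inverse v)"
    by (intro K0_rel.append K0_rel.refl assms)
  have "K0_rel (word_inverse u @ v @ word_inverse v) (word_inverse u @ [])"
    by (intro K0_rel.append K0_rel.refl K0_rel_right_inverse)
  then have 3: "K0_rel (word_inverse u @ v @ word_inverse v) (word_inverse u)"
    by simp
  show ?thesis
    using K0_rel.sym[OF K0_rel.trans[OF 1 K0_rel.trans[OF 2 3]]] .
qed

instantiation K0 :: group_add
begin

lift_definition zero_K0 :: K0 is "[]" .

lift_definition plus_K0 :: "K0 \<Rightarrow> K0 \<Rightarrow> K0" is "(@)"
  by (rule K0_rel.append)

lift_definition uminus_K0 :: "K0 \<Rightarrow> K0" is "\<lambda>w. word_inverse w"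
  by (rule K0_rel_inverse_cong)

definition minus_K0 :: "K0 \<Rightarrow> K0 \<Rightarrow> K0" where
  "minus_K0 a b = a + (- b)"

instance
proof
  fix a b c :: K0
  show "a + b + c = a + (b + c)" by transfer (simp add: K0_rel.refl)
  show "0 + a = a" by transfer (simp add: K0_rel.refl)
  show "a + 0 = a" by transfer (simp add: K0_rel.refl)
  show "- a + a = 0" by transfer (rule K0_rel_left_inverse)
  show "a + (- b) = a - b" by (simp add: minus_K0_def)
qed

end

definition K0_class :: "mat_iso \<Rightarrow> K0" where
  "K0_class X = abs_K0 [(True, X)]"

inductive_set K0_plus :: "K0 set" where
  K0_class: "K0_class X \<in> K0_plus"
| plus: "a \<in> K0_plus \<Longrightarrow> b \<in> K0_plus \<Longrightarrow> a + b \<in> K0_plus"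


section \<open>Hopf algebras on spaces of finitely supported functions\<close>

text \<open>
  The vector space of finitely supported functions on \<open>'x\<close> is \<open>'x \<Rightarrow>\<^sub>0 'k\<close>; its tensor product
  with \<open>'y \<Rightarrow>\<^sub>0 'k\<close> is \<open>'x \<times> 'y \<Rightarrow>\<^sub>0 'k\<close>, via \<open>(f \<otimes> g) (x, y) = f x * g y\<close>.
\<close>

abbreviation "lookup \<equiv> Poly_Mapping.lookup"
abbreviation "keys \<equiv> Poly_Mapping.keys"

definition pscale :: "'k::field \<Rightarrow> ('x \<Rightarrow>\<^sub>0 'k) \<Rightarrow> ('x \<Rightarrow>\<^sub>0 'k)" where
  "pscale c f = Poly_Mapping.map ((*) c) f"

lemma lookup_pscale [simp]: "lookup (pscale c f) x = c * lookup f x"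
  by (simp add: pscale_def Poly_Mapping.map.rep_eq when_def)

lemma vector_space_pscale: "vector_space pscale"
  by unfold_locales (auto intro!: poly_mapping_eqI simp: lookup_add algebra_simps)

abbreviation delta :: "'x \<Rightarrow> ('x \<Rightarrow>\<^sub>0 'k::field)" where
  "delta x \<equiv> Poly_Mapping.single x 1"

definition lin_ext :: "('x \<Rightarrow> ('y \<Rightarrow>\<^sub>0 'k)) \<Rightarrow> ('x \<Rightarrow>\<^sub>0 'k::field) \<Rightarrow> ('y \<Rightarrow>\<^sub>0 'k)" where
  "lin_ext \<phi> t = (\<Sum>x\<in>keys t. pscale (lookup t x) (\<phi> x))"

definition tensor :: "('x \<Rightarrow>\<^sub>0 'k::field) \<Rightarrow> ('y \<Rightarrow>\<^sub>0 'k) \<Rightarrow> ('x \<times> 'y \<Rightarrow>\<^sub>0 'k)" where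
  "tensor f g = (\<Sum>x\<in>keys f. \<Sum>y\<in>keys g. Poly_Mapping.single (x, y) (lookup f x * lookup g y))"

definition tensor_map ::
    "(('x \<Rightarrow>\<^sub>0 'k::field) \<Rightarrow> ('u \<Rightarrow>\<^sub>0 'k)) \<Rightarrow> (('y \<Rightarrow>\<^sub>0 'k) \<Rightarrow> ('v \<Rightarrow>\<^sub>0 'k)) \<Rightarrow>
     ('x \<times> 'y \<Rightarrow>\<^sub>0 'k) \<Rightarrow> ('u \<times> 'v \<Rightarrow>\<^sub>0 'k)" where
  "tensor_map \<phi> \<psi> = lin_ext (\<lambda>(x, y). tensor (\<phi> (delta x)) (\<psi> (delta y)))"

record (overloaded) ('x, 'k) hopf_data =
  mul :: "('x \<Rightarrow>\<^sub>0 'k) \<Rightarrow> ('x \<Rightarrow>\<^sub>0 'k) \<Rightarrow> ('x \<Rightarrow>\<^sub>0 'k)"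
  unity :: "'x \<Rightarrow>\<^sub>0 'k"
  comul :: "('x \<Rightarrow>\<^sub>0 'k) \<Rightarrow> ('x \<times> 'x \<Rightarrow>\<^sub>0 'k)"
  counit :: "('x \<Rightarrow>\<^sub>0 'k) \<Rightarrow> 'k"

definition algebra_axioms :: "('x, 'k::field) hopf_data \<Rightarrow> bool" where
  "algebra_axioms H \<longleftrightarrow>
     (\<forall>f. Vector_Spaces.linear pscale pscale (mul H f)) \<and>
     (\<forall>g. Vector_Spaces.linear pscale pscale (\<lambda>f. mul H f g)) \<and>
     (\<forall>f g h. mul H (mul H f g) h = mul H f (mul H g h)) \<and>
     (\<forall>f. mul H (unity H) f = f) \<and> (\<forall>f. mul H f (unity H) = f)"

definition coalgebra_axioms :: "('x, 'k::field) hopf_data \<Rightarrow> bool" where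
  "coalgebra_axioms H \<longleftrightarrow>
     Vector_Spaces.linear pscale pscale (comul H) \<and>
     Vector_Spaces.linear pscale (*) (counit H) \<and>
     (\<forall>f x y z. lookup (tensor_map (comul H) id (comul H f)) ((x, y), z)
              = lookup (tensor_map id (comul H) (comul H f)) (x, (y, z))) \<and>
     (\<forall>f. lin_ext (\<lambda>(x, y). pscale (counit H (delta x)) (delta y)) (comul H f) = f) \<and>
     (\<forall>f. lin_ext (\<lambda>(x, y). pscale (counit H (delta y)) (delta x)) (comul H f) = f)"

text \<open>The product \<open>(a \<otimes> b) (c \<otimes> d) = ac \<otimes> bd\<close> of the algebra \<open>H \<otimes> H\<close>.\<close>

definition tensor_mul ::
    "('x, 'k::field) hopf_data \<Rightarrow> ('x \<times> 'x \<Rightarrow>\<^sub>0 'k) \<Rightarrow> ('x \<times> 'x \<Rightarrow>\<^sub>0 'k) \<Rightarrow> ('x \<times> 'x \<Rightarrow>\<^sub>0 'k)" where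
  "tensor_mul H s t =
     lin_ext (\<lambda>(x, y). lin_ext (\<lambda>(u, v).
       tensor (mul H (delta x) (delta u)) (mul H (delta y) (delta v))) t) s"

definition bialgebra :: "('x, 'k::field) hopf_data \<Rightarrow> bool" where
  "bialgebra H \<longleftrightarrow> algebra_axioms H \<and> coalgebra_axioms H \<and>
     (\<forall>f g. comul H (mul H f g) = tensor_mul H (comul H f) (comul H g)) \<and>
     comul H (unity H) = tensor (unity H) (unity H) \<and>
     (\<forall>f g. counit H (mul H f g) = counit H f * counit H g) \<and>
     counit H (unity H) = 1"

definition is_antipode ::
    "('x, 'k::field) hopf_data \<Rightarrow> (('x \<Rightarrow>\<^sub>0 'k) \<Rightarrow> ('x \<Rightarrow>\<^sub>0 'k)) \<Rightarrow> bool" where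
  "is_antipode H S \<longleftrightarrow> Vector_Spaces.linear pscale pscale S \<and>
     (\<forall>f. lin_ext (\<lambda>(x, y). mul H (S (delta x)) (delta y)) (comul H f)
          = pscale (counit H f) (unity H)) \<and>
     (\<forall>f. lin_ext (\<lambda>(x, y). mul H (delta x) (S (delta y))) (comul H f)
          = pscale (counit H f) (unity H))"

definition hopf_algebra :: "('x, 'k::field) hopf_data \<Rightarrow> bool" where
  "hopf_algebra H \<longleftrightarrow> bialgebra H \<and> (\<exists>S. is_antipode H S)"

definition cocommutative :: "('x, 'k::field) hopf_data \<Rightarrow> bool" where
  "cocommutative H \<longleftrightarrow> (\<forall>f x y. lookup (comul H f) (x, y) = lookup (comul H f) (y, x))"

definition graded_space :: "'g set \<Rightarrow> ('g \<Rightarrow> ('x \<Rightarrow>\<^sub>0 'k::field) set) \<Rightarrow> bool" where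
  "graded_space G W \<longleftrightarrow>
     (\<forall>\<gamma>\<in>G. module.subspace pscale (W \<gamma>)) \<and>
     (\<forall>v. \<exists>!c. keys c \<subseteq> G \<and> (\<forall>\<gamma>\<in>G. lookup c \<gamma> \<in> W \<gamma>) \<and> v = (\<Sum>\<gamma>\<in>keys c. lookup c \<gamma>))"

text \<open>A grading by a submonoid \<open>G\<close> of a (here additively written) monoid.\<close>

definition graded_hopf_algebra ::
    "'g::monoid_add set \<Rightarrow> ('g \<Rightarrow> ('x \<Rightarrow>\<^sub>0 'k::field) set) \<Rightarrow> ('x, 'k) hopf_data \<Rightarrow> bool" where
  "graded_hopf_algebra G W H \<longleftrightarrow>
     hopf_algebra H \<and> 0 \<in> G \<and> (\<forall>\<alpha>\<in>G. \<forall>\<beta>\<in>G. \<alpha> + \<beta> \<in> G) \<and> graded_space G W \<and>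
     unity H \<in> W 0 \<and>
     (\<forall>\<alpha>\<in>G. \<forall>\<beta>\<in>G. \<forall>f\<in>W \<alpha>. \<forall>g\<in>W \<beta>. mul H f g \<in> W (\<alpha> + \<beta>)) \<and>
     (\<forall>\<gamma>\<in>G. \<forall>f\<in>W \<gamma>. comul H f \<in> module.span pscale
        {tensor u v | u v \<alpha> \<beta>. \<alpha> \<in> G \<and> \<beta> \<in> G \<and> \<alpha> + \<beta> = \<gamma> \<and> u \<in> W \<alpha> \<and> v \<in> W \<beta>}) \<and>
     (\<forall>\<gamma>\<in>G. \<gamma> \<noteq> 0 \<longrightarrow> (\<forall>f\<in>W \<gamma>. counit H f = 0)) \<and>
     (\<forall>S. is_antipode H S \<longrightarrow> (\<forall>\<gamma>\<in>G. S ` W \<gamma> \<subseteq> W \<gamma>))"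

text \<open>The degree-zero part is the line spanned by the unit.\<close>

definition connected_grading ::
    "('g::zero \<Rightarrow> ('x \<Rightarrow>\<^sub>0 'k::field) set) \<Rightarrow> ('x, 'k) hopf_data \<Rightarrow> bool" where
  "connected_grading W H \<longleftrightarrow> W 0 = {pscale c (unity H) | c. True}"

text \<open>A bialgebra isomorphism between Hopf algebras automatically respects the antipodes.\<close>

definition hopf_iso ::
    "('x, 'k::field) hopf_data \<Rightarrow> ('y, 'k) hopf_data \<Rightarrow> (('x \<Rightarrow>\<^sub>0 'k) \<Rightarrow> ('y \<Rightarrow>\<^sub>0 'k)) \<Rightarrow> bool" where
  "hopf_iso H D \<phi> \<longleftrightarrow> Vector_Spaces.linear pscale pscale \<phi> \<and> bij \<phi> \<and>
     (\<forall>f g. \<phi> (mul H f g) = mul D (\<phi> f) (\<phi> g)) \<and> \<phi> (unity H) = unity D \<and>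
     (\<forall>f. comul D (\<phi> f) = tensor_map \<phi> \<phi> (comul H f)) \<and>
     (\<forall>f. counit D (\<phi> f) = counit H f)"

definition hopf_isomorphic :: "('x, 'k::field) hopf_data \<Rightarrow> ('y, 'k) hopf_data \<Rightarrow> bool" where
  "hopf_isomorphic H D \<longleftrightarrow> (\<exists>\<phi>. hopf_iso H D \<phi>)"

text \<open>
  \<open>D\<close> is the graded dual of \<open>H = \<Oplus>\<^sub>n W n\<close> through the pairing \<open>B\<close>: \<open>B\<close> identifies \<open>D\<close> with the
  linear functionals on \<open>H\<close> vanishing on almost all \<open>W n\<close>, and the structure maps of \<open>D\<close> are
  the transposes of those of \<open>H\<close>.
\<close>

definition pairing_tensor ::
    "(('y \<Rightarrow>\<^sub>0 'k::field) \<Rightarrow> ('x \<Rightarrow>\<^sub>0 'k) \<Rightarrow> 'k) \<Rightarrow> ('y \<times> 'y \<Rightarrow>\<^sub>0 'k) \<Rightarrow> ('x \<times> 'x \<Rightarrow>\<^sub>0 'k) \<Rightarrow> 'k" where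
  "pairing_tensor B s t = (\<Sum>(y, y')\<in>keys s. \<Sum>(x, x')\<in>keys t.
     lookup s (y, y') * lookup t (x, x') * (B (delta y) (delta x) * B (delta y') (delta x')))"

definition graded_dual ::
    "(('y \<Rightarrow>\<^sub>0 'k::field) \<Rightarrow> ('x \<Rightarrow>\<^sub>0 'k) \<Rightarrow> 'k) \<Rightarrow> ('y, 'k) hopf_data \<Rightarrow>
     ('x, 'k) hopf_data \<Rightarrow> (nat \<Rightarrow> ('x \<Rightarrow>\<^sub>0 'k) set) \<Rightarrow> bool" where
  "graded_dual B D H W \<longleftrightarrow>
     (\<forall>f. Vector_Spaces.linear pscale (*) (B f)) \<and>
     (\<forall>v. Vector_Spaces.linear pscale (*) (\<lambda>f. B f v)) \<and>
     bij_betw B UNIV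
       {\<phi>. Vector_Spaces.linear pscale (*) \<phi> \<and> finite {n. \<exists>v\<in>W n. \<phi> v \<noteq> 0}} \<and>
     (\<forall>f g v. B (mul D f g) v = pairing_tensor B (tensor f g) (comul H v)) \<and>
     (\<forall>v. B (unity D) v = counit H v) \<and>
     (\<forall>f u v. pairing_tensor B (comul D f) (tensor u v) = B f (mul H u v)) \<and>
     (\<forall>f. counit D f = B f (unity H))"


section \<open>The Hall algebra of pointed matroids\<close>

text \<open>In this section and the next, \<open>Abs_poly_mapping\<close> is applied only to functions that have
  finite support, there being finitely many classes of pointed matroids of each size.\<close>

definition sum_comul :: "(mat_iso \<Rightarrow>\<^sub>0 'k::field) \<Rightarrow> (mat_iso \<times> mat_iso \<Rightarrow>\<^sub>0 'k)" where
  "sum_comul f = Abs_poly_mapping (\<lambda>(X, Y). lookup f (class_sum X Y))"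

definition hall_mul :: "(mat_iso \<Rightarrow>\<^sub>0 'k::field) \<Rightarrow> (mat_iso \<Rightarrow>\<^sub>0 'k) \<Rightarrow> (mat_iso \<Rightarrow>\<^sub>0 'k)" where
  "hall_mul f g = Abs_poly_mapping (\<lambda>X. let B = rep_mat_iso X in
     \<Sum>T\<in>adm_subobjects B. lookup f (quot_class B T) * lookup g (sub_class T))"

definition hall_algebra :: "(mat_iso, 'k::field) hopf_data" where
  "hall_algebra =
     \<lparr>mul = hall_mul, unity = delta class_zero, comul = sum_comul,
      counit = (\<lambda>f. lookup f class_zero)\<rparr>"

definition hall_grading :: "K0 \<Rightarrow> (mat_iso \<Rightarrow>\<^sub>0 'k::field) set" where
  "hall_grading \<gamma> = module.span pscale {delta X | X. K0_class X = \<gamma>}"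


section \<open>The matroid-minor Hopf algebra and its dual\<close>

definition minor_algebra :: "(mat_iso, 'k::field) hopf_data" where
  "minor_algebra =
     \<lparr>mul = (\<lambda>f g. lin_ext (\<lambda>X. lin_ext (\<lambda>Y. delta (class_sum X Y)) g) f),
      unity = delta class_zero,
      comul = lin_ext (\<lambda>X. let M = rep_mat_iso X in
        \<Sum>S\<in>Pow (elems M). delta (iso_class (restriction M S), iso_class (contraction M S))),
      counit = (\<lambda>f. \<Sum>X\<in>keys f.
        lookup f X * (if elems (rep_mat_iso X) = {} then 1 else 0))\<rparr>"

definition minor_grading :: "nat \<Rightarrow> (mat_iso \<Rightarrow>\<^sub>0 'k::field) set" where
  "minor_grading n = module.span pscale {delta X | X. class_size X = n}"

definition minor_dual_mul ::
    "(mat_iso \<Rightarrow>\<^sub>0 'k::field) \<Rightarrow> (mat_iso \<Rightarrow>\<^sub>0 'k) \<Rightarrow> (mat_iso \<Rightarrow>\<^sub>0 'k)" where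
  "minor_dual_mul f g = Abs_poly_mapping (\<lambda>X. let M = rep_mat_iso X in
     \<Sum>S\<in>Pow (elems M).
       lookup f (iso_class (restriction M S)) * lookup g (iso_class (contraction M S)))"

definition minor_dual :: "(mat_iso, 'k::field) hopf_data" where
  "minor_dual =
     \<lparr>mul = minor_dual_mul, unity = delta class_zero, comul = sum_comul,
      counit = (\<lambda>f. lookup f class_zero)\<rparr>"

text \<open>Evaluation of a function on classes at an element of the monoid algebra.\<close>

definition eval_pairing :: "(mat_iso \<Rightarrow>\<^sub>0 'k::field) \<Rightarrow> (mat_iso \<Rightarrow>\<^sub>0 'k) \<Rightarrow> 'k" where
  "eval_pairing f v = (\<Sum>X\<in>keys v. lookup f X * lookup v X)"

end

(* In the Hall product the admissible subobjects of B are, up to isomorphism, the inclusions of the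
   restrictions B|S with quotient B/S, one for every subset S of the non-base points. Hence the Hall
   product is the opposite of the product of the dual of the matroid-minor Hopf algebra. Matroid duality
   exchanges B|S with the contraction of the dual matroid by the complement of S (and B/S with a
   restriction) and commutes with direct sums, so f |-> f o dual is an isomorphism of bialgebras. The
   bialgebra axioms reduce to coassociativity of the minors and to the description of the minors of a
   direct sum; the antipode is a convolution inverse constructed by recursion on the number of
   elements. Restricting and contracting gives [B] = [B|S] + [B/S] in K_0, and counting elements is a
   homomorphism K_0 -> Z, which makes the grading connected. *)
theory Submission
  imports Defs
begin

text \<open>Direct sums, duals and minors live on other types or ground sets than the natural-number
  representatives of the classes. Two devices keep this manageable. An isomorphism is always
  replaced by an equation \<open>N = relabel f M\<close>, so that transport is rewriting. Sums over
  subsets of a representative are packaged as \<open>minor_sum X F\<close> with an arbitrary summand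
  \<open>F\<close>, so that each law of the product becomes one identity between minor sums. Two
  points are not formal. \<open>quot_class\<close> is a definite description, so the quotient must
  be shown to depend only on the image of the monomorphism; this is where the universal property of
  the square is used. And the presentation of \<open>K0\<close> is not abelian: its relation puts
  the subobject first, the Hall product the quotient, and the two agree because a direct sum is an
  extension of its summands in both orders.\<close>

section \<open>Closure operators recovered from flats\<close>

definition clos :: "'a pmat \<Rightarrow> 'a set \<Rightarrow> 'a set" where
  "clos M S = \<Inter>{F \<in> flats M. S \<subseteq> F}"

lemma matroid_closureD:
  assumes "matroid_closure E \<sigma>"
  shows "\<And>S. S \<subseteq> E \<Longrightarrow> S \<subseteq> \<sigma> S" "\<And>S. S \<subseteq> E \<Longrightarrow> \<sigma> S \<subseteq> E"
    "\<And>S T. S \<subseteq> T \<Longrightarrow> T \<subseteq> E \<Longrightarrow> \<sigma> S \<subseteq> \<sigma> T"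
    "\<And>S. S \<subseteq> E \<Longrightarrow> \<sigma> (\<sigma> S) = \<sigma> S"
    "\<And>S x y. S \<subseteq> E \<Longrightarrow> x \<in> E \<Longrightarrow> y \<in> \<sigma> (insert x S) \<Longrightarrow> y \<notin> \<sigma> S \<Longrightarrow> x \<in> \<sigma> (insert y S)"
  using assms unfolding matroid_closure_def by (simp, simp, simp, simp, blast)

lemma matroid_closure_insert:
  assumes "matroid_closure E \<sigma>" "S \<subseteq> E" "x \<in> \<sigma> S"
  shows "\<sigma> (insert x S) = \<sigma> S"
proof -
  note D = matroid_closureD[OF assms(1)]
  have "x \<in> E" using D(2) assms by blast
  have "insert x S \<subseteq> \<sigma> S" using D(1) assms by blast
  then have "\<sigma> (insert x S) \<subseteq> \<sigma> (\<sigma> S)" using D(3)[OF _ D(2)] assms(2) by blast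
  moreover have "\<sigma> S \<subseteq> \<sigma> (insert x S)" using D(3) assms(2) \<open>x \<in> E\<close> by blast
  ultimately show ?thesis using D(4) assms(2) by blast
qed

text \<open>\<open>\<sigma> S\<close> is itself a flat above \<open>S\<close>, and by monotonicity
  and idempotence it lies below every flat \<open>\<sigma> T\<close> above \<open>S\<close>. So the
  operator hidden in the existential of \<open>pmatroid\<close> is determined by the flats, on
  subsets of the ground set.\<close>

lemma clos_eq:
  assumes "matroid_closure E \<sigma>" "flats M = \<sigma> ` Pow E" "S \<subseteq> E"
  shows "clos M S = \<sigma> S"
proof
  note D = matroid_closureD[OF assms(1)]
  show "clos M S \<subseteq> \<sigma> S" unfolding clos_def using D(1)[OF assms(3)] assms(2,3) by blast
  show "\<sigma> S \<subseteq> clos M S" unfolding clos_def assms(2)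
  proof (clarify)
    fix x T assume "x \<in> \<sigma> S" "T \<subseteq> E" "S \<subseteq> \<sigma> T"
    then show "x \<in> \<sigma> T" using D(3)[OF \<open>S \<subseteq> \<sigma> T\<close> D(2)] D(4) by blast
  qed
qed

lemma matroid_closure_cong:
  assumes "matroid_closure E \<sigma>" "\<And>S. S \<subseteq> E \<Longrightarrow> \<sigma> S = \<tau> S"
  shows "matroid_closure E \<tau>"
proof -
  note D = matroid_closureD[OF assms(1)]
  note s = assms(2)[symmetric]
  show ?thesis unfolding matroid_closure_def
  proof (intro conjI allI impI; (elim conjE)?)
    fix S x y assume "S \<subseteq> E" "x \<in> E" "y \<in> \<tau> (insert x S) - \<tau> S"
    \<comment> \<open>The two operators are only known to agree inside \<open>E\<close>, so
      \<open>y\<close> must lie in \<open>E\<close> before \<open>\<tau> (insert y S)\<close> can be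
      rewritten.\<close>
    moreover from this have "y \<in> E" using D(2)[of "insert x S"] s[of "insert x S"] by auto
    ultimately show "x \<in> \<tau> (insert y S)" using D(5)[of S x y] by (simp add: s)
  next
    fix S assume "S \<subseteq> E" then show "\<tau> (\<tau> S) = \<tau> S"
      using D(4)[of S] s[OF D(2)[of S]] s[of S] by simp
  qed (use D s in auto)
qed

lemma pmatroid_clos:
  assumes "pmatroid M"
  shows "matroid_closure (ground M) (clos M)" "flats M = clos M ` Pow (ground M)"
    "point M \<in> clos M {}"
proof -
  obtain \<sigma> where \<sigma>: "matroid_closure (ground M) \<sigma>" "flats M = \<sigma> ` Pow (ground M)" "point M \<in> \<sigma> {}"
    using assms unfolding pmatroid_def by blast
  have e: "\<And>S. S \<subseteq> ground M \<Longrightarrow> \<sigma> S = clos M S" using clos_eq[OF \<sigma>(1,2)] by simp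
  show "matroid_closure (ground M) (clos M)" using matroid_closure_cong[OF \<sigma>(1) e] .
  show "flats M = clos M ` Pow (ground M)" using e unfolding \<sigma>(2) by (intro image_cong) auto
  show "point M \<in> clos M {}" using \<sigma>(3) e[of "{}"] by simp
qed

lemma pmatroid_finite: "pmatroid M \<Longrightarrow> finite (ground M)"
  by (simp add: pmatroid_def)

lemma finite_elems: "pmatroid M \<Longrightarrow> finite (elems M)"
  by (simp add: pmatroid_def elems_def)

lemma ground_eq: "pmatroid M \<Longrightarrow> ground M = insert (point M) (elems M)"
  using pmatroid_point by (auto simp: elems_def)

lemma ground_flat: "pmatroid M \<Longrightarrow> ground M \<in> flats M"
proof -
  assume M: "pmatroid M"
  have "clos M (ground M) = ground M"
    using matroid_closureD(1,2)[OF pmatroid_clos(1)[OF M], of "ground M"] by blast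
  then show ?thesis using pmatroid_clos(2)[OF M] by blast
qed

lemma clos_flat: "pmatroid M \<Longrightarrow> S \<subseteq> ground M \<Longrightarrow> clos M S \<in> flats M"
  using pmatroid_clos(2) by blast

lemma flat_clos: "pmatroid M \<Longrightarrow> F \<in> flats M \<Longrightarrow> clos M F = F"
  unfolding clos_def by blast

lemma flat_iff: "pmatroid M \<Longrightarrow> F \<in> flats M \<longleftrightarrow> F \<subseteq> ground M \<and> clos M F = F"
  by (metis clos_flat flat_clos pmatroid_flats_subset)

lemma point_in_clos:
  assumes "pmatroid M" "S \<subseteq> ground M" shows "point M \<in> clos M S"
  using pmatroid_clos(3)[OF assms(1)] matroid_closureD(3)[OF pmatroid_clos(1)[OF assms(1)], of "{}" S] assms(2) by blast

lemma point_in_flat: "pmatroid M \<Longrightarrow> F \<in> flats M \<Longrightarrow> point M \<in> F"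
  by (metis flat_iff point_in_clos)

lemma clos_insert_point:
  assumes "pmatroid M" "S \<subseteq> ground M" shows "clos M (insert (point M) S) = clos M S"
  using matroid_closure_insert[OF pmatroid_clos(1)] point_in_clos assms by metis

text \<open>Flats are the values of the closure on subsets of the ground set, so comparing closures
  is enough. Several identities for duals are proved in this form because the dual is given by its
  closure.\<close>

lemma pmat_eqI:
  assumes "pmatroid M" "pmatroid N" "ground M = ground N" "point M = point N"
    "\<And>S. S \<subseteq> ground M \<Longrightarrow> clos M S = clos N S"
  shows "M = N"
proof -
  have "flats M = flats N"
    unfolding pmatroid_clos(2)[OF assms(1)] pmatroid_clos(2)[OF assms(2)] assms(3)[symmetric]
    using assms(5) by (intro image_cong) auto
  then show ?thesis using assms by (intro pmat.equality) auto
qed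

lemma pmatroidI:
  assumes "finite (ground M)" "matroid_closure (ground M) \<sigma>" "flats M = \<sigma> ` Pow (ground M)" "point M \<in> \<sigma> {}"
  shows "pmatroid M"
  using assms unfolding pmatroid_def by blast

section \<open>Relabelling\<close>

text \<open>The form in which isomorphisms are handled; \<open>f\<close> is only ever asked to be
  injective on the ground set, and the target may be over another type.\<close>

definition relabel :: "('a \<Rightarrow> 'b) \<Rightarrow> 'a pmat \<Rightarrow> 'b pmat" where
  "relabel f M = \<lparr>ground = f ` ground M, flats = (`) f ` flats M, point = f (point M)\<rparr>"

lemma relabel_sel [simp]:
  "ground (relabel f M) = f ` ground M" "flats (relabel f M) = (`) f ` flats M"
  "point (relabel f M) = f (point M)"
  by (simp_all add: relabel_def)

lemma elems_relabel:
  assumes "pmatroid M" "inj_on f (ground M)" shows "elems (relabel f M) = f ` elems M"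
  using assms pmatroid_point[OF assms(1)] by (auto simp: elems_def inj_on_def)

lemma inj_on_subset_iff:
  assumes "inj_on f E" "A \<subseteq> E" "B \<subseteq> E"
  shows "f ` A \<subseteq> f ` B \<longleftrightarrow> A \<subseteq> B"
  using assms unfolding inj_on_def by blast

lemma relabel_clos:
  assumes M: "pmatroid M" and f: "inj_on f (ground M)" and S: "S \<subseteq> ground M"
  shows "clos (relabel f M) (f ` S) = f ` clos M S"
proof -
  have sub: "f ` S \<subseteq> f ` F \<longleftrightarrow> S \<subseteq> F" if "F \<in> flats M" for F
    using inj_on_subset_iff[OF f S] pmatroid_flats_subset[OF M that] by blast
  show ?thesis
  proof
    show "clos (relabel f M) (f ` S) \<subseteq> f ` clos M S"
    proof -
      have "clos M S \<in> flats M" "S \<subseteq> clos M S"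
        using clos_flat[OF M S] matroid_closureD(1)[OF pmatroid_clos(1)[OF M] S] by auto
      then show ?thesis unfolding clos_def[of "relabel f M"] by (intro Inter_lower) auto
    qed
    show "f ` clos M S \<subseteq> clos (relabel f M) (f ` S)"
      unfolding clos_def using sub by auto
  qed
qed

lemma pmatroid_relabel:
  assumes M: "pmatroid M" and f: "inj_on f (ground M)"
  shows "pmatroid (relabel f M)"
proof (rule pmatroidI)
  let ?N = "relabel f M"
  note C = pmatroid_clos[OF M]
  note D = matroid_closureD[OF C(1)]
  have c: "clos ?N (f ` S) = f ` clos M S" if "S \<subseteq> ground M" for S
    using relabel_clos[OF M f that] .
  show "finite (ground ?N)" using M by (simp add: pmatroid_def)
  show "flats ?N = clos ?N ` Pow (ground ?N)"
  proof -
    have "clos ?N ` Pow (ground ?N) = clos ?N ` ((`) f ` Pow (ground M))"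
      by (metis image_Pow_surj relabel_sel(1))
    also have "\<dots> = (`) f ` clos M ` Pow (ground M)"
      unfolding image_image using c by (intro image_cong) auto
    finally show ?thesis using C(2) by simp
  qed
  show "point ?N \<in> clos ?N {}" using c[of "{}"] C(3) by simp
  show "matroid_closure (ground ?N) (clos ?N)"
    unfolding matroid_closure_def
  proof (intro conjI allI impI; (elim conjE)?)
    fix S assume "S \<subseteq> ground ?N"
    then obtain T where T: "T \<subseteq> ground M" "S = f ` T" by (auto simp: subset_image_iff)
    show "S \<subseteq> clos ?N S" "clos ?N S \<subseteq> ground ?N" "clos ?N (clos ?N S) = clos ?N S"
      using D(1,2,4)[OF T(1)] by (auto simp: T c)
  next
    fix S' S assume "S' \<subseteq> S" "S \<subseteq> ground ?N"
    then obtain T where T: "T \<subseteq> ground M" "S = f ` T" by (auto simp: subset_image_iff)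
    from \<open>S' \<subseteq> S\<close> T obtain T' where T': "T' \<subseteq> T" "S' = f ` T'" by (auto simp: subset_image_iff)
    then show "clos ?N S' \<subseteq> clos ?N S" using D(3)[OF T'(1) T(1)] T T' c[of T'] c[of T] by auto
  next
    fix S x y assume *: "S \<subseteq> ground ?N" "x \<in> ground ?N" "y \<in> clos ?N (insert x S) - clos ?N S"
    then obtain T a where T: "T \<subseteq> ground M" "S = f ` T" "a \<in> ground M" "x = f a"
      by (auto simp: subset_image_iff)
    have aT: "insert a T \<subseteq> ground M" "insert x S = f ` insert a T" using T by auto
    then obtain b where b: "b \<in> clos M (insert a T)" "y = f b" using * c by (metis DiffD1 imageE)
    have bg: "b \<in> ground M" using b D(2)[OF aT(1)] by blast
    have "b \<notin> clos M T" using * b T c[OF T(1)] by auto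
    then have "a \<in> clos M (insert b T)" using D(5) T b by blast
    then show "x \<in> clos ?N (insert y S)" using c[of "insert b T"] T b bg by auto
  qed
qed

lemma relabel_id: "pmatroid M \<Longrightarrow> (\<And>x. x \<in> ground M \<Longrightarrow> f x = x) \<Longrightarrow> relabel f M = M"
proof (intro pmat.equality)
  assume M: "pmatroid M" and f: "\<And>x. x \<in> ground M \<Longrightarrow> f x = x"
  show "ground (relabel f M) = ground M" using f by simp
  have "f ` F = F" if "F \<in> flats M" for F
    using pmatroid_flats_subset[OF M that] f by force
  then show "flats (relabel f M) = flats M" by simp
  show "point (relabel f M) = point M" using f pmatroid_point[OF M] by simp
qed simp

text \<open>Strongness of \<open>f\<close> pulls flats of \<open>N\<close> back to flats of
  \<open>M\<close>, and strongness of its inverse carries flats of \<open>M\<close> forward.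
  Together the flats correspond exactly, which bijectivity of a strong map alone would not
  give.\<close>

lemma iso_map_imp_relabel:
  assumes M: "pmatroid M" and N: "pmatroid N" and f: "iso_map M N f"
  shows "inj_on f (ground M)" "N = relabel f M"
proof -
  obtain g where s: "strong_map M N f" "strong_map N M g"
    "compose (ground M) g f = (\<lambda>x\<in>ground M. x)" "compose (ground N) f g = (\<lambda>x\<in>ground N. x)"
    using f unfolding iso_map_def by blast
  have gf: "g (f x) = x" if "x \<in> ground M" for x
    using fun_cong[OF s(3), of x] that by (simp add: compose_def)
  have fg: "f (g x) = x" if "x \<in> ground N" for x
    using fun_cong[OF s(4), of x] that by (simp add: compose_def)
  have fN: "f x \<in> ground N" if "x \<in> ground M" for x using s(1) that by (auto simp: strong_map_def)
  have gM: "g x \<in> ground M" if "x \<in> ground N" for x using s(2) that by (auto simp: strong_map_def)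
  show inj: "inj_on f (ground M)" using gf by (metis inj_onI)
  have im: "f ` (f -` A \<inter> ground M) = A" if "A \<subseteq> ground N" for A
  proof
    show "A \<subseteq> f ` (f -` A \<inter> ground M)"
    proof
      fix x assume "x \<in> A"
      then show "x \<in> f ` (f -` A \<inter> ground M)"
        using fg[of x] gM[of x] that by (intro image_eqI[of _ _ "g x"]) auto
    qed
  qed auto
  have "flats N = (`) f ` flats M"
  proof
    show "flats N \<subseteq> (`) f ` flats M"
    proof
      fix A assume A: "A \<in> flats N"
      then have "f -` A \<inter> ground M \<in> flats M" using s(1) by (simp add: strong_map_def)
      then show "A \<in> (`) f ` flats M" using im[OF pmatroid_flats_subset[OF N A]] by (metis imageI)
    qed
    show "(`) f ` flats M \<subseteq> flats N"
    proof clarify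
      fix A assume A: "A \<in> flats M"
      then have "A \<subseteq> ground M" using pmatroid_flats_subset[OF M] by blast
      then have "f ` A = g -` A \<inter> ground N" using gf fg fN by (auto simp: image_iff subset_iff) metis
      then show "f ` A \<in> flats N" using s(2) A by (simp add: strong_map_def)
    qed
  qed
  moreover have "ground N = f ` ground M" using fg gM fN by (auto simp: image_iff) metis
  moreover have "point N = f (point M)" using s(1) by (simp add: strong_map_def)
  ultimately show "N = relabel f M" by (intro pmat.equality) auto
qed

lemma relabel_iso_map:
  assumes M: "pmatroid M" and f: "inj_on f (ground M)"
  shows "iso_map M (relabel f M) (restrict f (ground M))"
proof -
  let ?f = "restrict f (ground M)" and ?g = "restrict (inv_into (ground M) f) (f ` ground M)"
  have gf: "inv_into (ground M) f (f x) = x" if "x \<in> ground M" for x using f that by simp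
  have v: "?f -` f ` A \<inter> ground M = A" if "A \<subseteq> ground M" for A
  proof (intro set_eqI)
    fix x
    show "x \<in> ?f -` f ` A \<inter> ground M \<longleftrightarrow> x \<in> A"
      using inj_on_image_mem_iff[OF f, of x A] that by (cases "x \<in> ground M") auto
  qed
  have w: "?g -` A \<inter> f ` ground M = f ` A" if A: "A \<subseteq> ground M" for A
  proof (intro set_eqI iffI)
    fix y assume y: "y \<in> ?g -` A \<inter> f ` ground M"
    then obtain x where x: "x \<in> ground M" "y = f x" by blast
    then have "?g y = x" using gf by simp
    then show "y \<in> f ` A" using x y by blast
  next
    fix y assume "y \<in> f ` A"
    then obtain x where x: "x \<in> A" "x \<in> ground M" "y = f x" using A by blast
    then have "?g y = x" using gf by simp
    then show "y \<in> ?g -` A \<inter> f ` ground M" using x by blast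
  qed
  have "strong_map M (relabel f M) ?f"
    unfolding strong_map_def
  proof (intro conjI ballI)
    fix A assume "A \<in> flats (relabel f M)"
    then obtain F where F: "F \<in> flats M" "A = f ` F" by auto
    show "?f -` A \<inter> ground M \<in> flats M"
      using v[OF pmatroid_flats_subset[OF M F(1)]] F by simp
  qed (use pmatroid_point[OF M] in auto)
  moreover have "strong_map (relabel f M) M ?g"
    unfolding strong_map_def
  proof (intro conjI ballI)
    fix A assume A: "A \<in> flats M"
    show "?g -` A \<inter> ground (relabel f M) \<in> flats (relabel f M)"
      using w[OF pmatroid_flats_subset[OF M A]] A by simp
  next
    show "?g (point (relabel f M)) = point M" using pmatroid_point[OF M] gf by simp
  next
    show "?g \<in> ground (relabel f M) \<rightarrow>\<^sub>E ground M" using gf by (auto simp: inv_into_into)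
  qed
  moreover have "compose (ground M) ?g ?f = (\<lambda>x\<in>ground M. x)"
    using gf by (auto simp: compose_def)
  moreover have "compose (f ` ground M) ?f ?g = (\<lambda>x\<in>f ` ground M. x)"
    by (rule ext) (auto simp: compose_def inv_into_into f_inv_into_f)
  ultimately show ?thesis unfolding iso_map_def by auto
qed

lemma pmat_iso_relabel:
  assumes "pmatroid M" "inj_on f (ground M)"
  shows "pmat_iso M (relabel f M)"
  using relabel_iso_map[OF assms] unfolding pmat_iso_def by blast

lemma pmat_isoE:
  assumes "pmatroid M" "pmatroid N" "pmat_iso M N"
  obtains f where "inj_on f (ground M)" "N = relabel f M"
  using assms iso_map_imp_relabel unfolding pmat_iso_def by metis

section \<open>Minors\<close>

lemma restriction_sel [simp]:
  "ground (restriction M S) = insert (point M) S" "point (restriction M S) = point M"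
  "flats (restriction M S) = (\<lambda>A. A \<inter> insert (point M) S) ` flats M"
  by (auto simp: restriction_def)

lemma contraction_sel [simp]:
  "ground (contraction M S) = ground M - S" "point (contraction M S) = point M"
  "flats (contraction M S) = (\<lambda>A. A - S) ` {A \<in> flats M. S \<subseteq> A}"
  by (auto simp: contraction_def)

lemma elems_restriction: "S \<subseteq> elems M \<Longrightarrow> elems (restriction M S) = S"
  by (auto simp: elems_def)

lemma elems_contraction: "S \<subseteq> elems M \<Longrightarrow> elems (contraction M S) = elems M - S"
  by (auto simp: elems_def)

text \<open>Cutting \<open>clos M T\<close> down to \<open>R\<close> does not change its closure,
  since it still contains \<open>T\<close>; this gives idempotence. A flat \<open>A\<close> cut down
  to \<open>R\<close> reproduces itself, since \<open>clos M (A \<inter> R)\<close> stays inside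
  \<open>A\<close>.\<close>

lemma restriction_closure:
  assumes M: "pmatroid M" and S: "S \<subseteq> elems M"
  defines "R \<equiv> insert (point M) S"
  shows "matroid_closure R (\<lambda>T. clos M T \<inter> R)" "flats (restriction M S) = (\<lambda>T. clos M T \<inter> R) ` Pow R"
proof -
  note C = pmatroid_clos[OF M]
  note D = matroid_closureD[OF C(1)]
  have R: "R \<subseteq> ground M" using S ground_eq[OF M] by (auto simp: R_def)
  show "matroid_closure R (\<lambda>T. clos M T \<inter> R)" unfolding matroid_closure_def
  proof (intro conjI allI impI; (elim conjE)?)
    fix T assume "T \<subseteq> R"
    then have T: "T \<subseteq> ground M" using R by blast
    have "clos M (clos M T \<inter> R) \<subseteq> clos M (clos M T)" using D(2)[OF T] by (intro D(3)) auto
    moreover have "clos M T \<subseteq> clos M (clos M T \<inter> R)"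
      using D(1)[OF T] \<open>T \<subseteq> R\<close> R by (intro D(3)) auto
    ultimately show "clos M (clos M T \<inter> R) \<inter> R = clos M T \<inter> R" using D(4)[OF T] by auto
  next
    fix T U assume "T \<subseteq> U" "U \<subseteq> R"
    then show "clos M T \<inter> R \<subseteq> clos M U \<inter> R" using D(3)[of T U] R by blast
  next
    fix T x y assume "T \<subseteq> R" "x \<in> R" "y \<in> clos M (insert x T) \<inter> R - clos M T \<inter> R"
    then show "x \<in> clos M (insert y T) \<inter> R" using D(5)[of T x y] R by blast
  qed (use D R in auto)
  show "flats (restriction M S) = (\<lambda>T. clos M T \<inter> R) ` Pow R"
  proof
    have "A \<inter> R = clos M (A \<inter> R) \<inter> R" if A: "A \<in> flats M" for A
    proof -
      have "clos M (A \<inter> R) \<subseteq> clos M A" using pmatroid_flats_subset[OF M A] by (intro D(3)) auto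
      then show ?thesis using D(1)[of "A \<inter> R"] R flat_clos[OF M A] by blast
    qed
    then show "flats (restriction M S) \<subseteq> (\<lambda>T. clos M T \<inter> R) ` Pow R"
      unfolding restriction_sel R_def[symmetric] by blast
    show "(\<lambda>T. clos M T \<inter> R) ` Pow R \<subseteq> flats (restriction M S)"
      unfolding restriction_sel R_def[symmetric] using clos_flat[OF M] R by blast
  qed
qed

lemma pmatroid_restriction:
  assumes M: "pmatroid M" and S: "S \<subseteq> elems M"
  shows "pmatroid (restriction M S)"
proof (rule pmatroidI)
  show "finite (ground (restriction M S))"
    using finite_subset[OF S finite_elems[OF M]] by simp
  show "matroid_closure (ground (restriction M S)) (\<lambda>T. clos M T \<inter> insert (point M) S)"
    "flats (restriction M S) = (\<lambda>T. clos M T \<inter> insert (point M) S) ` Pow (ground (restriction M S))"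
    using restriction_closure[OF M S] by (simp_all only: restriction_sel)
  show "point (restriction M S) \<in> clos M {} \<inter> insert (point M) S"
    using pmatroid_clos(3)[OF M] by simp
qed

lemma clos_restriction:
  assumes "pmatroid M" "S \<subseteq> elems M" "T \<subseteq> insert (point M) S"
  shows "clos (restriction M S) T = clos M T \<inter> insert (point M) S"
  using clos_eq[OF restriction_closure[OF assms(1,2)] assms(3)] .

lemma contraction_closure:
  assumes M: "pmatroid M" and S: "S \<subseteq> elems M"
  defines "R \<equiv> ground M - S"
  shows "matroid_closure R (\<lambda>T. clos M (T \<union> S) - S)"
    "flats (contraction M S) = (\<lambda>T. clos M (T \<union> S) - S) ` Pow R"
proof -
  note C = pmatroid_clos[OF M]
  note D = matroid_closureD[OF C(1)]
  have S: "S \<subseteq> ground M" using S by (auto simp: elems_def)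
  then have R: "R \<union> S = ground M" "R \<inter> S = {}" by (auto simp: R_def)
  have TS: "T \<union> S \<subseteq> ground M" if "T \<subseteq> R" for T using that R by blast
  \<comment> \<open>\<open>S\<close> lies in the closure, so removing it and adding it back recovers
    the closure; idempotence of the contracted operator thus reduces to that of
    \<open>clos M\<close>.\<close>
  have id: "clos M (T \<union> S) - S \<union> S = clos M (T \<union> S)" if "T \<subseteq> R" for T
    using D(1)[OF TS[OF that]] by blast
  show "matroid_closure R (\<lambda>T. clos M (T \<union> S) - S)" unfolding matroid_closure_def
  proof (intro conjI allI impI; (elim conjE)?)
    fix T assume T: "T \<subseteq> R"
    show "T \<subseteq> clos M (T \<union> S) - S" using D(1)[OF TS[OF T]] T R by blast
    show "clos M (T \<union> S) - S \<subseteq> R" using D(2)[OF TS[OF T]] R by blast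
    show "clos M (clos M (T \<union> S) - S \<union> S) - S = clos M (T \<union> S) - S"
      using id[OF T] D(4)[OF TS[OF T]] by simp
  next
    fix T U assume "T \<subseteq> U" "U \<subseteq> R"
    then show "clos M (T \<union> S) - S \<subseteq> clos M (U \<union> S) - S" using D(3)[of "T \<union> S" "U \<union> S"] TS by blast
  next
    fix T x y assume "T \<subseteq> R" "x \<in> R" "y \<in> clos M (insert x T \<union> S) - S - (clos M (T \<union> S) - S)"
    then show "x \<in> clos M (insert y T \<union> S) - S" using D(5)[of "T \<union> S" x y] TS R by auto
  qed
  show "flats (contraction M S) = (\<lambda>T. clos M (T \<union> S) - S) ` Pow R"
  proof
    show "(\<lambda>T. clos M (T \<union> S) - S) ` Pow R \<subseteq> flats (contraction M S)"
    proof (clarify)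
      fix T assume "T \<subseteq> R"
      then show "clos M (T \<union> S) - S \<in> flats (contraction M S)"
        using clos_flat[OF M TS] D(1)[OF TS] by simp
    qed
    show "flats (contraction M S) \<subseteq> (\<lambda>T. clos M (T \<union> S) - S) ` Pow R"
    proof
      fix F assume "F \<in> flats (contraction M S)"
      then obtain A where A: "A \<in> flats M" "S \<subseteq> A" "F = A - S" by auto
      then have "F \<union> S = A" "F \<subseteq> R" using pmatroid_flats_subset[OF M A(1)] by (auto simp: R_def)
      then show "F \<in> (\<lambda>T. clos M (T \<union> S) - S) ` Pow R"
        using flat_clos[OF M A(1)] A by (intro image_eqI[of _ _ F]) auto
    qed
  qed
qed

lemma pmatroid_contraction:
  assumes M: "pmatroid M" and S: "S \<subseteq> elems M"
  shows "pmatroid (contraction M S)"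
proof (rule pmatroidI)
  show "finite (ground (contraction M S))" using M by (simp add: pmatroid_def)
  have "S \<subseteq> ground M" using S by (auto simp: elems_def)
  then show "point (contraction M S) \<in> clos M ({} \<union> S) - S" using point_in_clos[OF M] S by (auto simp: elems_def)
  show "matroid_closure (ground (contraction M S)) (\<lambda>T. clos M (T \<union> S) - S)"
    "flats (contraction M S) = (\<lambda>T. clos M (T \<union> S) - S) ` Pow (ground (contraction M S))"
    using contraction_closure[OF M S] by (simp_all only: contraction_sel)
qed

lemma clos_contraction:
  assumes "pmatroid M" "S \<subseteq> elems M" "T \<subseteq> ground M - S"
  shows "clos (contraction M S) T = clos M (T \<union> S) - S"
  using clos_eq[OF contraction_closure[OF assms(1,2)] assms(3)] .

lemma restriction_relabel:
  assumes M: "pmatroid M" and f: "inj_on f (ground M)" and S: "S \<subseteq> elems M"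
  shows "restriction (relabel f M) (f ` S) = relabel f (restriction M S)"
proof (intro pmat.equality)
  have R: "insert (point M) S \<subseteq> ground M" using S ground_eq[OF M] by auto
  have "f ` A \<inter> f ` insert (point M) S = f ` (A \<inter> insert (point M) S)" if "A \<in> flats M" for A
    using inj_on_image_Int[OF f] R pmatroid_flats_subset[OF M that] by metis
  then show "flats (restriction (relabel f M) (f ` S)) = flats (relabel f (restriction M S))"
    by (simp add: image_image cong: image_cong)
qed auto

lemma contraction_relabel:
  assumes M: "pmatroid M" and f: "inj_on f (ground M)" and S: "S \<subseteq> elems M"
  shows "contraction (relabel f M) (f ` S) = relabel f (contraction M S)"
proof (intro pmat.equality)
  have S: "S \<subseteq> ground M" using S by (auto simp: elems_def)
  have *: "f ` A - f ` S = f ` (A - S)" if "A \<subseteq> ground M" for A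
    using inj_on_image_set_diff[OF f _ S] that by blast
  then show "ground (contraction (relabel f M) (f ` S)) = ground (relabel f (contraction M S))" by simp
  have "{A \<in> (`) f ` flats M. f ` S \<subseteq> A} = (`) f ` {A \<in> flats M. S \<subseteq> A}"
    using inj_on_subset_iff[OF f S] pmatroid_flats_subset[OF M] by blast
  then show "flats (contraction (relabel f M) (f ` S)) = flats (relabel f (contraction M S))"
    using * pmatroid_flats_subset[OF M] by (simp add: image_image cong: image_cong_simp)
qed auto

lemma restriction_restriction:
  assumes "S \<subseteq> T"
  shows "restriction (restriction M T) S = restriction M S"
proof (rule pmat.equality)
  have "A \<inter> insert (point M) T \<inter> insert (point M) S = A \<inter> insert (point M) S" for A using assms by blast
  then show "flats (restriction (restriction M T) S) = flats (restriction M S)"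
    by (simp add: image_image)
qed auto

text \<open>For nested subsets the middle minor can be formed in either order. With the neighbouring
  identities for nested restrictions and nested contractions this yields coassociativity; all three
  hold on the nose, so no isomorphism has to be chosen.\<close>

lemma restriction_contraction:
  assumes "S \<subseteq> T" "T \<subseteq> elems M"
  shows "restriction (contraction M S) (T - S) = contraction (restriction M T) S"
proof (rule pmat.equality)
  have p: "point M \<notin> S" using assms by (auto simp: elems_def)
  then show "ground (restriction (contraction M S) (T - S)) = ground (contraction (restriction M T) S)"
    using assms by auto
  have "(A - S) \<inter> insert (point M) (T - S) = A \<inter> insert (point M) T - S" for A using p by auto
  moreover have "{A \<in> (\<lambda>A. A \<inter> insert (point M) T) ` flats M. S \<subseteq> A} =
      (\<lambda>A. A \<inter> insert (point M) T) ` {A \<in> flats M. S \<subseteq> A}"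
    using assms by auto
  ultimately show "flats (restriction (contraction M S) (T - S)) = flats (contraction (restriction M T) S)"
    by (simp add: image_image)
qed auto

lemma contraction_contraction:
  assumes "S \<subseteq> T"
  shows "contraction (contraction M S) (T - S) = contraction M T"
proof (rule pmat.equality)
  have "A - S - (T - S) = A - T" for A using assms by auto
  moreover have "{A \<in> (\<lambda>A. A - S) ` {A \<in> flats M. S \<subseteq> A}. T - S \<subseteq> A} =
      (\<lambda>A. A - S) ` {A \<in> flats M. T \<subseteq> A}"
    using assms by auto
  ultimately show "flats (contraction (contraction M S) (T - S)) = flats (contraction M T)"
    by (simp add: image_image)
qed (use assms in auto)

lemma restriction_elems: "pmatroid M \<Longrightarrow> restriction M (elems M) = M"
proof (rule pmat.equality)
  assume M: "pmatroid M"
  show "flats (restriction M (elems M)) = flats M"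
    using ground_eq[OF M] pmatroid_flats_subset[OF M] by (simp add: Int_absorb2 cong: image_cong_simp)
qed (use ground_eq in auto)

lemma contraction_empty: "contraction M {} = M"
  by (rule pmat.equality) auto


section \<open>Direct sums\<close>

lemma wedge_mem [simp]:
  "None \<in> wedge p q A B" "Some (Inl a) \<in> wedge p q A B \<longleftrightarrow> a \<in> A \<and> a \<noteq> p"
  "Some (Inr b) \<in> wedge p q A B \<longleftrightarrow> b \<in> B \<and> b \<noteq> q"
  by (auto simp: wedge_def)

lemma option_sum_cases:
  obtains "x = None" | a where "x = Some (Inl a)" | b where "x = Some (Inr b)"
  by (metis not_None_eq sumE)

lemma option_sum_set_eqI:
  assumes "None \<in> A \<longleftrightarrow> None \<in> B" "\<And>a. Some (Inl a) \<in> A \<longleftrightarrow> Some (Inl a) \<in> B"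
    "\<And>b. Some (Inr b) \<in> A \<longleftrightarrow> Some (Inr b) \<in> B"
  shows "A = B"
proof (rule set_eqI)
  fix x show "x \<in> A \<longleftrightarrow> x \<in> B" by (cases x rule: option_sum_cases) (use assms in auto)
qed

lemma option_sum_subsetI:
  assumes "None \<in> A \<Longrightarrow> None \<in> B" "\<And>a. Some (Inl a) \<in> A \<Longrightarrow> Some (Inl a) \<in> B"
    "\<And>b. Some (Inr b) \<in> A \<Longrightarrow> Some (Inr b) \<in> B"
  shows "A \<subseteq> B"
proof (rule subsetI)
  fix x show "x \<in> A \<Longrightarrow> x \<in> B" by (cases x rule: option_sum_cases) (use assms in auto)
qed

lemma image_times_image: "(\<lambda>(x, y). h x y) ` ((f ` A) \<times> (g ` B)) = (\<lambda>(x, y). h (f x) (g y)) ` (A \<times> B)"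
  by force

definition left_part :: "('a + 'b) option set \<Rightarrow> 'a set" where
  "left_part T = {a. Some (Inl a) \<in> T}"

definition right_part :: "('a + 'b) option set \<Rightarrow> 'b set" where
  "right_part T = {b. Some (Inr b) \<in> T}"

lemma part_mem [simp]: "a \<in> left_part T \<longleftrightarrow> Some (Inl a) \<in> T" "b \<in> right_part T \<longleftrightarrow> Some (Inr b) \<in> T"
  by (auto simp: left_part_def right_part_def)

lemma direct_sum_sel [simp]:
  "ground (direct_sum M N) = wedge (point M) (point N) (ground M) (ground N)"
  "point (direct_sum M N) = None"
  "flats (direct_sum M N) = (\<lambda>(F, G). wedge (point M) (point N) F G) ` (flats M \<times> flats N)"
  by (auto simp: direct_sum_def)

lemma left_part_wedge: "left_part (wedge p q A B) = A - {p}"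
  and right_part_wedge: "right_part (wedge p q A B) = B - {q}"
  by auto

lemma part_insert:
  "left_part (insert None S) = left_part S" "right_part (insert None S) = right_part S"
  "left_part (insert (Some (Inl a)) S) = insert a (left_part S)"
  "right_part (insert (Some (Inl a)) S) = right_part S"
  "left_part (insert (Some (Inr b)) S) = left_part S"
  "right_part (insert (Some (Inr b)) S) = insert b (right_part S)"
  by auto

lemma elems_direct_sum:
  "elems (direct_sum M N) = Some ` (Inl ` elems M \<union> Inr ` elems N)"
  by (auto simp: elems_def wedge_def)

text \<open>A wedge drops the base points of its summands, so \<open>left_part\<close> and
  \<open>right_part\<close> return flats without them; since the base point is a loop, the closure
  is unaffected.\<close>

lemma clos_minus_point:
  assumes "pmatroid M" "S \<subseteq> ground M" shows "clos M (S - {point M}) = clos M S"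
proof -
  have "insert (point M) (S - {point M}) = insert (point M) S" by blast
  moreover have "S - {point M} \<subseteq> ground M" using assms by blast
  ultimately show ?thesis using clos_insert_point[OF assms(1)] assms(2) by metis
qed

context
  fixes M :: "'a pmat" and N :: "'b pmat"
  assumes M: "pmatroid M" and N: "pmatroid N"
begin

lemma part_subset:
  assumes "S \<subseteq> ground (direct_sum M N)"
  shows "left_part S \<subseteq> ground M" "right_part S \<subseteq> ground N"
  using assms by (auto dest!: subsetD)

text \<open>The candidate closes each summand separately. Exchange is inherited because inserting
  \<open>x\<close> changes only the closure in the summand of \<open>x\<close>, so \<open>y\<close>
  lies in the same summand.\<close>

lemma direct_sum_closure:
  defines "\<sigma> \<equiv> \<lambda>T. wedge (point M) (point N) (clos M (left_part T)) (clos N (right_part T))"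
  shows "matroid_closure (ground (direct_sum M N)) \<sigma>"
    "flats (direct_sum M N) = \<sigma> ` Pow (ground (direct_sum M N))"
proof -
  note DM = matroid_closureD[OF pmatroid_clos(1)[OF M]]
  note DN = matroid_closureD[OF pmatroid_clos(1)[OF N]]
  let ?E = "ground (direct_sum M N)"
  note ps = part_subset
  show "matroid_closure ?E \<sigma>" unfolding matroid_closure_def
  proof (intro conjI allI impI; (elim conjE)?)
    fix S assume S: "S \<subseteq> ?E"
    show "S \<subseteq> \<sigma> S"
    proof (rule option_sum_subsetI)
      fix a assume a: "Some (Inl a) \<in> S"
      then have "a \<in> clos M (left_part S)" using DM(1)[OF ps(1)[OF S]] by auto
      then show "Some (Inl a) \<in> \<sigma> S" using a S by (auto simp: \<sigma>_def)
    next
      fix a assume a: "Some (Inr a) \<in> S"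
      then have "a \<in> clos N (right_part S)" using DN(1)[OF ps(2)[OF S]] by auto
      then show "Some (Inr a) \<in> \<sigma> S" using a S by (auto simp: \<sigma>_def)
    qed (simp add: \<sigma>_def)
    show "\<sigma> S \<subseteq> ?E"
      using DM(2)[OF ps(1)[OF S]] DN(2)[OF ps(2)[OF S]]
      by (intro option_sum_subsetI) (auto simp: \<sigma>_def)
    have "clos M (left_part (\<sigma> S)) = clos M (left_part S)"
      using clos_minus_point[OF M DM(2)] ps(1)[OF S] DM(4)[OF ps(1)[OF S]]
      by (simp add: \<sigma>_def left_part_wedge)
    moreover have "clos N (right_part (\<sigma> S)) = clos N (right_part S)"
      using clos_minus_point[OF N DN(2)] ps(2)[OF S] DN(4)[OF ps(2)[OF S]]
      by (simp add: \<sigma>_def right_part_wedge)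
    ultimately show "\<sigma> (\<sigma> S) = \<sigma> S" unfolding \<sigma>_def by simp
  next
    fix S T assume *: "S \<subseteq> T" "T \<subseteq> ?E"
    have "left_part S \<subseteq> left_part T" "right_part S \<subseteq> right_part T" using *(1) by auto
    then have "clos M (left_part S) \<subseteq> clos M (left_part T)" "clos N (right_part S) \<subseteq> clos N (right_part T)"
      using DM(3) DN(3) ps[OF *(2)] by blast+
    then show "\<sigma> S \<subseteq> \<sigma> T" unfolding \<sigma>_def by (intro option_sum_subsetI) auto
  next
    fix S x y assume S: "S \<subseteq> ?E" and x: "x \<in> ?E" and y: "y \<in> \<sigma> (insert x S) - \<sigma> S"
    show "x \<in> \<sigma> (insert y S)"
    proof (cases x rule: option_sum_cases)
      case 1
      then show ?thesis by (simp add: \<sigma>_def)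
    next
      case (2 a)
      then obtain b where "y = Some (Inl b)" "b \<in> clos M (insert a (left_part S))" "b \<notin> clos M (left_part S)"
        using y by (cases y rule: option_sum_cases) (auto simp: \<sigma>_def part_insert)
      then show ?thesis using 2 x DM(5)[of "left_part S" a b] ps(1)[OF S] by (auto simp: \<sigma>_def part_insert)
    next
      case (3 a)
      then obtain b where "y = Some (Inr b)" "b \<in> clos N (insert a (right_part S))" "b \<notin> clos N (right_part S)"
        using y by (cases y rule: option_sum_cases) (auto simp: \<sigma>_def part_insert)
      then show ?thesis using 3 x DN(5)[of "right_part S" a b] ps(2)[OF S] by (auto simp: \<sigma>_def part_insert)
    qed
  qed
  show "flats (direct_sum M N) = \<sigma> ` Pow ?E"
  proof
    show "flats (direct_sum M N) \<subseteq> \<sigma> ` Pow ?E"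
    proof
      fix A assume "A \<in> flats (direct_sum M N)"
      then obtain F G where FG: "F \<in> flats M" "G \<in> flats N" "A = wedge (point M) (point N) F G" by auto
      note s = pmatroid_flats_subset[OF M FG(1)] pmatroid_flats_subset[OF N FG(2)]
      have "A = \<sigma> A"
        using clos_minus_point[OF M s(1)] clos_minus_point[OF N s(2)] flat_clos[OF M FG(1)]
          flat_clos[OF N FG(2)] FG(3)
        by (simp add: \<sigma>_def left_part_wedge right_part_wedge)
      moreover have "A \<subseteq> ?E" unfolding FG(3) using s by (intro option_sum_subsetI) auto
      ultimately show "A \<in> \<sigma> ` Pow ?E" by blast
    qed
    show "\<sigma> ` Pow ?E \<subseteq> flats (direct_sum M N)"
    proof (clarify)
      fix T assume "T \<subseteq> ?E"
      then have "clos M (left_part T) \<in> flats M" "clos N (right_part T) \<in> flats N"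
        using clos_flat[OF M ps(1)] clos_flat[OF N ps(2)] by blast+
      then show "\<sigma> T \<in> flats (direct_sum M N)" unfolding \<sigma>_def direct_sum_sel(3) by auto
    qed
  qed
qed

lemma pmatroid_direct_sum: "pmatroid (direct_sum M N)"
proof (rule pmatroidI[OF _ direct_sum_closure])
  show "finite (ground (direct_sum M N))" using M N by (simp add: wedge_def pmatroid_def)
qed simp

lemma clos_direct_sum:
  assumes "T \<subseteq> ground (direct_sum M N)"
  shows "clos (direct_sum M N) T =
    wedge (point M) (point N) (clos M (left_part T)) (clos N (right_part T))"
  using clos_eq[OF direct_sum_closure assms] .

lemma direct_sum_relabel:
  assumes f: "inj_on f (ground M)" and g: "inj_on g (ground N)"
  shows "direct_sum (relabel f M) (relabel g N) = relabel (map_option (map_sum f g)) (direct_sum M N)"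
    "inj_on (map_option (map_sum f g)) (ground (direct_sum M N))"
proof -
  have w: "wedge (f (point M)) (g (point N)) (f ` A) (g ` B) =
      map_option (map_sum f g) ` wedge (point M) (point N) A B"
    if "A \<subseteq> ground M" "B \<subseteq> ground N" for A B
  proof -
    have "f ` A - {f (point M)} = f ` (A - {point M})" "g ` B - {g (point N)} = g ` (B - {point N})"
      using that f g pmatroid_point[OF M] pmatroid_point[OF N] by (auto simp: inj_on_def subset_iff)
    then show ?thesis unfolding wedge_def by (simp add: image_Un image_image)
  qed
  show "direct_sum (relabel f M) (relabel g N) = relabel (map_option (map_sum f g)) (direct_sum M N)"
  proof (intro pmat.equality)
    show "flats (direct_sum (relabel f M) (relabel g N)) =
        flats (relabel (map_option (map_sum f g)) (direct_sum M N))"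
      unfolding direct_sum_sel relabel_sel image_times_image image_image
      using w pmatroid_flats_subset[OF M] pmatroid_flats_subset[OF N]
      by (intro image_cong) auto
  qed (use w in auto)
  show "inj_on (map_option (map_sum f g)) (ground (direct_sum M N))"
  proof (rule inj_onI)
    fix x y assume "x \<in> ground (direct_sum M N)" "y \<in> ground (direct_sum M N)"
      "map_option (map_sum f g) x = map_option (map_sum f g) y"
    then show "x = y"
      using inj_onD[OF f] inj_onD[OF g]
      by (cases x rule: option_sum_cases; cases y rule: option_sum_cases) auto
  qed
qed

lemma direct_sum_commute:
  "direct_sum N M = relabel (map_option (case_sum Inr Inl)) (direct_sum M N)"
  "inj_on (map_option (case_sum Inr Inl)) (ground (direct_sum M N))"
proof -
  have w: "map_option (case_sum Inr Inl) ` wedge p q A B = wedge q p B A" for p q and A :: "'a set" and B :: "'b set"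
    unfolding wedge_def by (simp add: image_Un image_image Un_commute)
  show "direct_sum N M = relabel (map_option (case_sum Inr Inl)) (direct_sum M N)"
  proof (intro pmat.equality)
    have "flats (direct_sum N M) = (\<lambda>(F, G). wedge (point N) (point M) G F) ` (flats M \<times> flats N)"
      unfolding direct_sum_sel by force
    then show "flats (direct_sum N M) = flats (relabel (map_option (case_sum Inr Inl)) (direct_sum M N))"
      by (simp add: image_image case_prod_beta w)
  qed (use w in auto)
  show "inj_on (map_option (case_sum Inr Inl)) (ground (direct_sum M N))"
  proof (rule inj_onI)
    fix x y :: "('a + 'b) option"
    assume "map_option (case_sum Inr Inl) x = map_option (case_sum Inr Inl) y"
    then show "x = y"
      by (cases x rule: option_sum_cases; cases y rule: option_sum_cases) auto
  qed
qed

lemma direct_sum_zero: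
  assumes "ground N = {point N}"
  shows "direct_sum M N = relabel (\<lambda>x. if x = point M then None else Some (Inl x)) M"
    "inj_on (\<lambda>x. if x = point M then None else Some (Inl x)) (ground M)"
proof -
  have fl: "flats N = {{point N}}"
  proof -
    have "F = {point N}" if "F \<in> flats N" for F
      using pmatroid_flats_subset[OF N that] point_in_flat[OF N that] assms by blast
    moreover have "{point N} \<in> flats N" using ground_flat[OF N] assms by simp
    ultimately show ?thesis by blast
  qed
  have w: "(\<lambda>x. if x = point M then None else Some (Inl x)) ` A = wedge (point M) (point N) A {point N}"
    if "point M \<in> A" for A
    using that by (intro option_sum_set_eqI) (auto simp: image_iff split: if_splits)
  show "direct_sum M N = relabel (\<lambda>x. if x = point M then None else Some (Inl x)) M"
  proof (intro pmat.equality)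
    have "flats (direct_sum M N) = (\<lambda>F. wedge (point M) (point N) F {point N}) ` flats M"
      unfolding direct_sum_sel fl by force
    then show "flats (direct_sum M N) = flats (relabel (\<lambda>x. if x = point M then None else Some (Inl x)) M)"
      using w point_in_flat[OF M] by simp
  qed (use w pmatroid_point[OF M] assms in auto)
qed (auto simp: inj_on_def)

lemma direct_sum_restriction:
  assumes "S \<subseteq> elems M" "T \<subseteq> elems N"
  shows "restriction (direct_sum M N) (Some ` (Inl ` S \<union> Inr ` T)) =
    direct_sum (restriction M S) (restriction N T)"
proof (rule pmat.equality)
  have w: "wedge p q A B \<inter> insert None (Some ` (Inl ` S \<union> Inr ` T)) =
    wedge p q (A \<inter> insert p S) (B \<inter> insert q T)" if "p \<notin> S" "q \<notin> T" for p q A B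
    using that by (intro option_sum_set_eqI) auto
  have p: "point M \<notin> S" "point N \<notin> T" using assms by (auto simp: elems_def)
  show "flats (restriction (direct_sum M N) (Some ` (Inl ` S \<union> Inr ` T))) =
    flats (direct_sum (restriction M S) (restriction N T))"
    unfolding direct_sum_sel restriction_sel image_times_image image_image case_prod_beta w[OF p] ..
  show "ground (restriction (direct_sum M N) (Some ` (Inl ` S \<union> Inr ` T))) =
    ground (direct_sum (restriction M S) (restriction N T))"
    using assms by (intro option_sum_set_eqI) (auto simp: elems_def)
qed auto

lemma direct_sum_contraction:
  assumes "S \<subseteq> elems M" "T \<subseteq> elems N"
  shows "contraction (direct_sum M N) (Some ` (Inl ` S \<union> Inr ` T)) =
    direct_sum (contraction M S) (contraction N T)"
proof (rule pmat.equality)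
  have p: "point M \<notin> S" "point N \<notin> T" using assms by (auto simp: elems_def)
  have w: "wedge p q A B - Some ` (Inl ` S \<union> Inr ` T) = wedge p q (A - S) (B - T)" for p q A B
    by (intro option_sum_set_eqI) auto
  \<comment> \<open>Membership in a wedge excludes the base points, so the condition splits into two
    components because \<open>S\<close> and \<open>T\<close> avoid them, by fact
    \<open>p\<close>.\<close>
  have s: "Some ` (Inl ` S \<union> Inr ` T) \<subseteq> wedge (point M) (point N) A B \<longleftrightarrow> S \<subseteq> A \<and> T \<subseteq> B" for A B
  proof -
    have "Some ` (Inl ` S \<union> Inr ` T) \<subseteq> W \<longleftrightarrow> (\<forall>a\<in>S. Some (Inl a) \<in> W) \<and> (\<forall>b\<in>T. Some (Inr b) \<in> W)" for W
      by blast
    then show ?thesis using p by auto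
  qed
  show "flats (contraction (direct_sum M N) (Some ` (Inl ` S \<union> Inr ` T))) =
    flats (direct_sum (contraction M S) (contraction N T))"
  proof -
    have fl: "{A \<in> flats (direct_sum M N). Some ` (Inl ` S \<union> Inr ` T) \<subseteq> A} =
      (\<lambda>(F, G). wedge (point M) (point N) F G) ` ({F \<in> flats M. S \<subseteq> F} \<times> {G \<in> flats N. T \<subseteq> G})"
    proof -
      let ?h = "\<lambda>(F, G). wedge (point M) (point N) F G" and ?X = "flats M \<times> flats N"
      have "{A \<in> ?h ` ?X. Some ` (Inl ` S \<union> Inr ` T) \<subseteq> A} =
        ?h ` {x \<in> ?X. Some ` (Inl ` S \<union> Inr ` T) \<subseteq> ?h x}" by blast
      also have "{x \<in> ?X. Some ` (Inl ` S \<union> Inr ` T) \<subseteq> ?h x} =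
        {F \<in> flats M. S \<subseteq> F} \<times> {G \<in> flats N. T \<subseteq> G}"
        unfolding case_prod_beta s by auto
      finally show ?thesis unfolding direct_sum_sel .
    qed
    show ?thesis
      unfolding contraction_sel(3)[of "direct_sum M N"] fl
      unfolding direct_sum_sel contraction_sel image_times_image image_image case_prod_beta w ..
  qed
  show "ground (contraction (direct_sum M N) (Some ` (Inl ` S \<union> Inr ` T))) =
    ground (direct_sum (contraction M S) (contraction N T))"
    unfolding contraction_sel direct_sum_sel w ..
qed auto

end

text \<open>\<open>Some (Inl None)\<close> is the inner base point, which the outer wedge removes;
  sending it to \<open>None\<close> completes the case distinction and does not disturb injectivity
  on the ground set.\<close>

definition wedge_assoc :: "(('a + 'b) option + 'c) option \<Rightarrow> ('a + ('b + 'c) option) option" where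
  "wedge_assoc x = (case x of None \<Rightarrow> None
     | Some (Inl None) \<Rightarrow> None
     | Some (Inl (Some (Inl a))) \<Rightarrow> Some (Inl a)
     | Some (Inl (Some (Inr b))) \<Rightarrow> Some (Inr (Some (Inl b)))
     | Some (Inr c) \<Rightarrow> Some (Inr (Some (Inr c))))"

lemma direct_sum_assoc:
  "direct_sum M (direct_sum N P) = relabel wedge_assoc (direct_sum (direct_sum M N) P)"
  "inj_on wedge_assoc (ground (direct_sum (direct_sum M N) P))"
proof -
  have d: "wedge p q A B - {None} = Some ` (Inl ` (A - {p}) \<union> Inr ` (B - {q}))"
    for p :: 'x and q :: 'y and A B by (auto simp: wedge_def)
  have w: "wedge_assoc ` wedge None r (wedge p q A B) C = wedge p None A (wedge q r B C)"
    for p q r A B C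
    unfolding wedge_def[of p None] wedge_def[of None r] d
    by (simp add: image_Un image_image wedge_assoc_def Un_assoc)
  show "direct_sum M (direct_sum N P) = relabel wedge_assoc (direct_sum (direct_sum M N) P)"
  proof (intro pmat.equality)
    have "flats (relabel wedge_assoc (direct_sum (direct_sum M N) P)) =
      {wedge (point M) None F (wedge (point N) (point P) G H) |F G H. F \<in> flats M \<and> G \<in> flats N \<and> H \<in> flats P}"
      unfolding relabel_sel direct_sum_sel image_image w[symmetric] by (force simp: image_iff)
    then show "flats (direct_sum M (direct_sum N P)) = flats (relabel wedge_assoc (direct_sum (direct_sum M N) P))"
      unfolding direct_sum_sel by (force simp: image_iff)
  next
    show "point (direct_sum M (direct_sum N P)) = point (relabel wedge_assoc (direct_sum (direct_sum M N) P))"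
      by (simp add: wedge_assoc_def)
  next
    show "ground (direct_sum M (direct_sum N P)) = ground (relabel wedge_assoc (direct_sum (direct_sum M N) P))"
      by (simp only: w relabel_sel direct_sum_sel)
  qed simp
  show "inj_on wedge_assoc (ground (direct_sum (direct_sum M N) P))"
  proof (rule inj_on_inverseI)
    fix x assume "x \<in> ground (direct_sum (direct_sum M N) P)"
    then have "x \<noteq> Some (Inl None)" by auto
    then show "(case wedge_assoc x of None \<Rightarrow> None
      | Some (Inl a) \<Rightarrow> Some (Inl (Some (Inl a)))
      | Some (Inr None) \<Rightarrow> None
      | Some (Inr (Some (Inl b))) \<Rightarrow> Some (Inl (Some (Inr b)))
      | Some (Inr (Some (Inr c))) \<Rightarrow> Some (Inr c)) = x"
      by (auto simp: wedge_assoc_def split: option.splits sum.splits)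
  qed
qed

section \<open>Duality\<close>

text \<open>The base point is a loop of \<open>M\<close>, hence would be a coloop of the usual dual; it is made a loop
  again by adding it to every closed set, so that the dual is taken on the non-base points only.\<close>

definition dual_clos :: "'a pmat \<Rightarrow> 'a set \<Rightarrow> 'a set" where
  "dual_clos M T = insert (point M) T \<union> {x \<in> elems M. x \<notin> clos M (elems M - T - {x})}"

definition dual :: "'a pmat \<Rightarrow> 'a pmat" where
  "dual M = \<lparr>ground = ground M, flats = dual_clos M ` Pow (ground M), point = point M\<rparr>"

lemma dual_sel [simp]:
  "ground (dual M) = ground M" "point (dual M) = point M"
  "flats (dual M) = dual_clos M ` Pow (ground M)"
  by (simp_all add: dual_def)

lemma elems_dual [simp]: "elems (dual M) = elems M"
  by (simp add: elems_def)

text \<open>A non-base element outside \<open>T\<close> is dependent on \<open>T\<close> in the dual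
  exactly when it is not in the closure of the remaining elements of \<open>M\<close>. Passing to
  complements swaps two axioms: idempotence of the dual comes from exchange in \<open>M\<close>, and
  exchange in the dual from idempotence in \<open>M\<close>.\<close>

lemma dual_clos_closure:
  assumes M: "pmatroid M"
  shows "matroid_closure (ground M) (dual_clos M)"
  unfolding matroid_closure_def
proof (intro conjI allI impI; (elim conjE)?)
  note D = matroid_closureD[OF pmatroid_clos(1)[OF M]]
  let ?E = "elems M" and ?D = "dual_clos M"
  have sub: "?E - T - X \<subseteq> ground M" "?E - T \<subseteq> ground M" for T X using ground_eq[OF M] by auto
  have mono: "?D S \<subseteq> ?D T" if "S \<subseteq> T" for S T
  proof -
    have "clos M (?E - T - {x}) \<subseteq> clos M (?E - S - {x})" for x
      using that sub by (intro D(3)) auto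
    then show ?thesis using that unfolding dual_clos_def by blast
  qed
  {
    fix S assume S: "S \<subseteq> ground M"
    show "S \<subseteq> ?D S" "?D S \<subseteq> ground M" using S ground_eq[OF M] by (auto simp: dual_clos_def)
    \<comment> \<open>One element of \<open>?D T\<close> can be added without changing the closure;
      since \<open>?D S\<close> is finite, adding its elements one at a time gives
      idempotence.\<close>
    have step: "?D (insert x T) = ?D T" if x: "x \<in> ?D T" for x T
    proof (cases "x \<in> T \<or> x = point M")
      case True
      then have "?E - insert x T = ?E - T" by (auto simp: elems_def)
      then show ?thesis using True by (auto simp: dual_clos_def)
    next
      case False
      then have xE: "x \<in> ?E" "x \<notin> clos M (?E - T - {x})" "x \<notin> T"
        using x by (auto simp: dual_clos_def)
      show ?thesis
      proof
        show "?D T \<subseteq> ?D (insert x T)" by (rule mono) auto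
        show "?D (insert x T) \<subseteq> ?D T"
        proof
          fix y assume y: "y \<in> ?D (insert x T)"
          show "y \<in> ?D T"
          proof (rule ccontr)
            assume n: "y \<notin> ?D T"
            \<comment> \<open>\<open>?Q\<close> is what remains besides \<open>x\<close> and
              \<open>y\<close>: \<open>y\<close> is in the closure of \<open>?Q\<close> with
              \<open>x\<close> added but not in that of \<open>?Q\<close>, so exchange puts
              \<open>x\<close> in the closure of \<open>?Q\<close> with \<open>y\<close> added,
              which \<open>x \<in> ?D T\<close> excludes.\<close>
            let ?Q = "?E - T - {x} - {y}"
            have ne: "y \<noteq> x" using n x by auto
            from n have yT: "y \<notin> T" "y \<noteq> point M" by (auto simp: dual_clos_def)
            with y ne have yE: "y \<in> ?E" "y \<notin> clos M (?E - insert x T - {y})" by (auto simp: dual_clos_def)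
            have "y \<in> clos M (?E - T - {y})" using n yE by (auto simp: dual_clos_def)
            moreover have "?E - T - {y} = insert x ?Q" "?E - insert x T - {y} = ?Q" "?E - T - {x} = insert y ?Q"
              using xE yE yT ne by auto
            moreover have "x \<in> ground M" "?Q \<subseteq> ground M" using xE ground_eq[OF M] by auto
            ultimately show False using D(5)[of ?Q x y] xE(2) yE(2) by simp
          qed
        qed
      qed
    qed
    have "?D (S \<union> U) = ?D S" if "finite U" "U \<subseteq> ?D S" for U
      using that by (induction U) (use step in auto)
    moreover have "finite (?D S)"
      using S finite_subset[OF _ pmatroid_finite[OF M]] finite_elems[OF M]
      by (auto simp: dual_clos_def)
    ultimately have "?D (S \<union> ?D S) = ?D S" by blast
    moreover have "S \<union> ?D S = ?D S" by (auto simp: dual_clos_def)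
    ultimately show "?D (?D S) = ?D S" by simp
  }
  show "?D S \<subseteq> ?D T" if "S \<subseteq> T" for S T by (rule mono[OF that])
  fix S x y assume S: "S \<subseteq> ground M" and x: "x \<in> ground M" and y: "y \<in> ?D (insert x S) - ?D S"
  show "x \<in> ?D (insert y S)"
  proof (rule ccontr)
    assume n: "x \<notin> ?D (insert y S)"
    from n have x': "x \<noteq> y" "x \<noteq> point M" "x \<notin> S" by (auto simp: dual_clos_def)
    then have xE: "x \<in> ?E" using x by (auto simp: elems_def)
    with n have xc: "x \<in> clos M (?E - insert y S - {x})" by (auto simp: dual_clos_def)
    from y x' have yE: "y \<in> ?E" "y \<notin> S" "y \<notin> clos M (?E - insert x S - {y})" "y \<in> clos M (?E - S - {y})"
      by (auto simp: dual_clos_def)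
    \<comment> \<open>By \<open>xc\<close>, adding \<open>x\<close> to the common complement does
      not enlarge its closure, so the two statements about the closure in \<open>yE\<close>
      contradict each other.\<close>
    have "?E - insert x S - {y} = ?E - insert y S - {x}" "?E - S - {y} = insert x (?E - insert y S - {x})"
      using x' xE by auto
    then show False
      using matroid_closure_insert[OF pmatroid_clos(1)[OF M] sub(1) xc] yE by simp
  qed
qed

lemma pmatroid_dual: "pmatroid M \<Longrightarrow> pmatroid (dual M)"
  using dual_clos_closure pmatroid_finite
  by (intro pmatroidI[of _ "dual_clos M"]) (auto simp: dual_clos_def)

lemma clos_dual: "pmatroid M \<Longrightarrow> T \<subseteq> ground M \<Longrightarrow> clos (dual M) T = dual_clos M T"
  by (rule clos_eq[OF dual_clos_closure]) auto

lemma dual_dual: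
  assumes M: "pmatroid M"
  shows "dual (dual M) = M"
proof (rule pmat_eqI)
  show "pmatroid (dual (dual M))" using pmatroid_dual[OF pmatroid_dual[OF M]] .
  fix S assume "S \<subseteq> ground (dual (dual M))"
  then have S: "S \<subseteq> ground M" by simp
  note D = matroid_closureD[OF pmatroid_clos(1)[OF M]]
  have "x \<notin> clos (dual M) (elems M - S - {x}) \<longleftrightarrow> x \<in> clos M S" if x: "x \<in> elems M" "x \<notin> S" for x
  proof -
    have sub: "elems M - S - {x} \<subseteq> ground M" using ground_eq[OF M] by blast
    \<comment> \<open>Complementing twice returns \<open>S\<close> up to the base point, which the
      closure does not see; the negations in the two dual closures then cancel.\<close>
    have "elems M - (elems M - S - {x}) - {x} = S - {point M}" using x S by (auto simp: elems_def)
    then have "x \<in> dual_clos M (elems M - S - {x}) \<longleftrightarrow> x \<notin> clos M (S - {point M})"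
      using x by (auto simp: dual_clos_def elems_def)
    then show ?thesis using clos_dual[OF M sub] clos_minus_point[OF M S] by simp
  qed
  then have "clos (dual (dual M)) S = insert (point M) S \<union> {x \<in> elems M. x \<in> S \<or> x \<in> clos M S}"
    using S by (auto simp: clos_dual[OF pmatroid_dual[OF M]] dual_clos_def)
  also have "\<dots> = clos M S"
    using D(1)[OF S] D(2)[OF S] point_in_clos[OF M S] by (auto simp: elems_def)
  finally show "clos (dual (dual M)) S = clos M S" .
qed (use M in auto)

lemma dual_restriction:
  assumes M: "pmatroid M" and S: "S \<subseteq> elems M"
  shows "dual (restriction M S) = contraction (dual M) (elems M - S)"
proof (rule pmat_eqI)
  show "pmatroid (dual (restriction M S))" using pmatroid_dual[OF pmatroid_restriction[OF M S]] .
  show "pmatroid (contraction (dual M) (elems M - S))"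
    using pmatroid_contraction[OF pmatroid_dual[OF M]] by auto
  show "ground (dual (restriction M S)) = ground (contraction (dual M) (elems M - S))"
    using pmatroid_point[OF M] S by (auto simp: elems_def)
  fix T assume "T \<subseteq> ground (dual (restriction M S))"
  then have T: "T \<subseteq> insert (point M) S" by simp
  have p: "point M \<notin> S" using S by (auto simp: elems_def)
  have sub: "T \<subseteq> ground (dual M) - (elems M - S)" "T \<union> (elems M - S) \<subseteq> ground M" 
    using T S pmatroid_point[OF M] by (auto simp: elems_def)
  have "clos (restriction M S) (S - T - {x}) = clos M (S - T - {x}) \<inter> insert (point M) S" for x
    by (rule clos_restriction[OF M S]) auto
  then have 1: "clos (dual (restriction M S)) T = insert (point M) T \<union> {x \<in> S. x \<notin> clos M (S - T - {x})}"
    using T by (auto simp: clos_dual[OF pmatroid_restriction[OF M S]] dual_clos_def elems_restriction[OF S])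
  \<comment> \<open>The complement of \<open>T\<close> in \<open>S\<close> equals the complement in
    \<open>elems M\<close> of \<open>T\<close> enlarged by the contracted set, so both closures test
    \<open>x\<close> against the same set \<open>S - T - {x}\<close>.\<close>
  have "elems M - (T \<union> (elems M - S)) = S - T" using S by auto
  then have 2: "clos (contraction (dual M) (elems M - S)) T =
      insert (point M) (T \<union> (elems M - S)) \<union> {x \<in> elems M. x \<notin> clos M (S - T - {x})} - (elems M - S)"
    using clos_contraction[OF pmatroid_dual[OF M] _ sub(1)] clos_dual[OF M sub(2)]
    by (simp add: dual_clos_def)
  show "clos (dual (restriction M S)) T = clos (contraction (dual M) (elems M - S)) T"
    unfolding 1 2 using T S p by (auto simp: elems_def)
qed auto

text \<open>Since \<open>dual\<close> is an involution, this is \<open>dual_restriction\<close> for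
  \<open>dual M\<close> and the complement of \<open>S\<close>, dualised once.\<close>

lemma dual_contraction:
  assumes M: "pmatroid M" and S: "S \<subseteq> elems M"
  shows "dual (contraction M S) = restriction (dual M) (elems M - S)"
proof -
  have "dual (restriction (dual M) (elems M - S)) = contraction M S"
    using dual_restriction[OF pmatroid_dual[OF M], of "elems M - S"] S dual_dual[OF M]
    by (simp add: double_diff)
  then show ?thesis
    using dual_dual[OF pmatroid_restriction[OF pmatroid_dual[OF M], of "elems M - S"]] by simp
qed

lemma dual_relabel:
  assumes M: "pmatroid M" and f: "inj_on f (ground M)"
  shows "dual (relabel f M) = relabel f (dual M)"
proof (intro pmat.equality)
  note E = elems_relabel[OF M f]
  have "dual_clos (relabel f M) (f ` T) = f ` dual_clos M T" if T: "T \<subseteq> ground M" for T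
  proof -
    have g: "elems M \<subseteq> ground M" using ground_eq[OF M] by blast
    have "f x \<in> clos (relabel f M) (f ` elems M - f ` T - {f x}) \<longleftrightarrow> x \<in> clos M (elems M - T - {x})"
      if x: "x \<in> elems M" for x
    proof -
      have s: "elems M - T - {x} \<subseteq> ground M" "x \<in> ground M" using g x by auto
      have "f ` elems M - f ` T - {f x} = f ` (elems M - T - {x})"
        using f T g s by (auto simp: inj_on_def subset_iff)
      then show ?thesis
        using relabel_clos[OF M f s(1)] inj_on_image_mem_iff[OF f s(2)]
          matroid_closureD(2)[OF pmatroid_clos(1)[OF M] s(1)] by simp
    qed
    then show ?thesis unfolding dual_clos_def E by (auto simp: image_iff)
  qed
  then have "dual_clos (relabel f M) ` (`) f ` Pow (ground M) = (`) f ` dual_clos M ` Pow (ground M)"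
    unfolding image_image by (intro image_cong) auto
  then show "flats (dual (relabel f M)) = flats (relabel f (dual M))"
    using image_Pow_surj[of f "ground M" "f ` ground M"] by simp
qed auto

text \<open>The complement of \<open>T\<close> in a direct sum consists of the complements of its
  two parts, and the closure of a sum works componentwise; so the test defining the dual closure is
  decided in a single summand.\<close>

lemma dual_direct_sum:
  assumes M: "pmatroid M" and N: "pmatroid N"
  shows "dual (direct_sum M N) = direct_sum (dual M) (dual N)"
proof (rule pmat_eqI)
  note MN = pmatroid_direct_sum[OF M N]
  show "pmatroid (dual (direct_sum M N))" using pmatroid_dual[OF MN] .
  show "pmatroid (direct_sum (dual M) (dual N))" by (intro pmatroid_direct_sum pmatroid_dual M N)
  fix T assume "T \<subseteq> ground (dual (direct_sum M N))"
  then have T: "T \<subseteq> ground (direct_sum M N)" by simp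
  have T': "T \<subseteq> ground (direct_sum (dual M) (dual N))" using T by simp
  let ?E = "elems (direct_sum M N)"
  have s: "?E - T - {x} \<subseteq> ground (direct_sum M N)" for x using ground_eq[OF MN] by auto
  have pe: "a \<in> elems M \<Longrightarrow> a \<noteq> point M" "b \<in> elems N \<Longrightarrow> b \<noteq> point N" for a b
    by (auto simp: elems_def)
  have l: "Some (Inl a) \<in> clos (direct_sum M N) (?E - T - {Some (Inl a)}) \<longleftrightarrow>
      a \<in> clos M (elems M - left_part T - {a})" if "a \<in> elems M" for a
  proof -
    have "left_part (?E - T - {Some (Inl a)}) = elems M - left_part T - {a}"
      unfolding elems_direct_sum by (rule set_eqI) auto
    then show ?thesis unfolding clos_direct_sum[OF M N s] wedge_mem using that pe(1) by simp
  qed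
  have r: "Some (Inr a) \<in> clos (direct_sum M N) (?E - T - {Some (Inr a)}) \<longleftrightarrow>
      a \<in> clos N (elems N - right_part T - {a})" if "a \<in> elems N" for a
  proof -
    have "right_part (?E - T - {Some (Inr a)}) = elems N - right_part T - {a}"
      unfolding elems_direct_sum by (rule set_eqI) auto
    then show ?thesis unfolding clos_direct_sum[OF M N s] wedge_mem using that pe(2) by simp
  qed
  have pt: "Some (Inl a) \<in> T \<Longrightarrow> a \<noteq> point M" "Some (Inr b) \<in> T \<Longrightarrow> b \<noteq> point N" for a b
    using T by auto
  have e: "Some (Inl a) \<in> ?E \<longleftrightarrow> a \<in> elems M" "Some (Inr b) \<in> ?E \<longleftrightarrow> b \<in> elems N" for a b
    by (auto simp: elems_direct_sum)
  show "clos (dual (direct_sum M N)) T = clos (direct_sum (dual M) (dual N)) T"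
    unfolding clos_direct_sum[OF pmatroid_dual[OF M] pmatroid_dual[OF N] T'] clos_dual[OF MN T]
      clos_dual[OF M part_subset(1)[OF M N T]] clos_dual[OF N part_subset(2)[OF M N T]]
  proof (rule option_sum_set_eqI)
    fix a show "Some (Inl a) \<in> dual_clos (direct_sum M N) T \<longleftrightarrow>
      Some (Inl a) \<in> wedge (point (dual M)) (point (dual N)) (dual_clos M (left_part T)) (dual_clos N (right_part T))"
      unfolding dual_clos_def wedge_mem dual_sel Un_iff mem_Collect_eq insert_iff part_mem e
        direct_sum_sel(2) option.distinct(2)
      using l[of a] pt(1)[of a] pe(1)[of a] by blast
  next
    fix a show "Some (Inr a) \<in> dual_clos (direct_sum M N) T \<longleftrightarrow>
      Some (Inr a) \<in> wedge (point (dual M)) (point (dual N)) (dual_clos M (left_part T)) (dual_clos N (right_part T))"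
      unfolding dual_clos_def wedge_mem dual_sel Un_iff mem_Collect_eq insert_iff part_mem e
        direct_sum_sel(2) option.distinct(2)
      using r[of a] pt(2)[of a] pe(2)[of a] by blast
  qed (simp add: dual_clos_def)
qed auto


section \<open>Isomorphism classes\<close>

lemma pmatroid_rep: "pmatroid (rep_mat_iso X)"
  using Quotient3_rep_reflp[OF Quotient3_mat_iso] by blast

lemma abs_mat_iso_eq_iff:
  assumes "pmatroid M" "pmatroid N"
  shows "abs_mat_iso M = abs_mat_iso N \<longleftrightarrow> pmat_iso M N"
  using Quotient3_rel[OF Quotient3_mat_iso, of M N] assms pmat_iso_refl by blast

lemma iso_class_abs:
  fixes M :: "'a pmat"
  assumes M: "pmatroid M"
  obtains N :: "nat pmat" where "pmatroid N" "pmat_iso N M" "iso_class M = abs_mat_iso N"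
proof -
  obtain f :: "'a \<Rightarrow> nat" where f: "inj_on f (ground M)"
    using finite_imp_inj_to_nat_seg[OF pmatroid_finite[OF M]] by blast
  have "\<exists>N :: nat pmat. pmatroid N \<and> pmat_iso N M"
    using pmatroid_relabel[OF M f] pmat_iso_sym[OF pmat_iso_relabel[OF M f]] by blast
  from someI_ex[OF this] show ?thesis using that unfolding iso_class_def by blast
qed

text \<open>\<open>M\<close> and \<open>N\<close> may have different element types, which a quotient
  of \<open>nat pmat\<close> cannot relate directly; they are compared through copies on the natural
  numbers.\<close>

lemma iso_class_eq_iff:
  assumes M: "pmatroid M" and N: "pmatroid N"
  shows "iso_class M = iso_class N \<longleftrightarrow> pmat_iso M N"
proof -
  obtain M' where M': "pmatroid M'" "pmat_iso M' M" "iso_class M = abs_mat_iso M'"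
    using iso_class_abs[OF M] .
  obtain N' where N': "pmatroid N'" "pmat_iso N' N" "iso_class N = abs_mat_iso N'"
    using iso_class_abs[OF N] .
  have "pmat_iso M' N' \<longleftrightarrow> pmat_iso M N"
  proof
    assume "pmat_iso M' N'"
    then have "pmat_iso M N'" using pmat_iso_trans[OF M N'(1) pmat_iso_sym[OF M'(2)]] by blast
    then show "pmat_iso M N" using pmat_iso_trans[OF M N _ N'(2)] by blast
  next
    assume "pmat_iso M N"
    then have "pmat_iso M' N" using pmat_iso_trans[OF M'(1) N M'(2)] by blast
    then show "pmat_iso M' N'" using pmat_iso_trans[OF M'(1) N'(1) _ pmat_iso_sym[OF N'(2)]] by blast
  qed
  then show ?thesis using abs_mat_iso_eq_iff M'(1,3) N'(1,3) by simp
qed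

lemma iso_class_rep [simp]: "iso_class (rep_mat_iso X) = X"
proof -
  obtain N where N: "pmatroid N" "pmat_iso N (rep_mat_iso X)" "iso_class (rep_mat_iso X) = abs_mat_iso N"
    using iso_class_abs[OF pmatroid_rep] .
  then have "abs_mat_iso N = abs_mat_iso (rep_mat_iso X)" using abs_mat_iso_eq_iff pmatroid_rep by blast
  then show ?thesis using N(3) Quotient3_abs_rep[OF Quotient3_mat_iso] by simp
qed

lemma iso_class_relabel:
  "pmatroid M \<Longrightarrow> inj_on f (ground M) \<Longrightarrow> iso_class (relabel f M) = iso_class M"
  using iso_class_eq_iff pmat_iso_relabel pmat_iso_sym pmatroid_relabel by metis

lemma iso_classE:
  assumes M: "pmatroid M" and N: "pmatroid N" and "iso_class M = iso_class N"
  obtains f where "inj_on f (ground M)" "N = relabel f M"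
  using assms pmat_isoE iso_class_eq_iff by metis

text \<open>Operations on classes are defined on the chosen representative; this replaces it by a
  relabelled copy of whichever matroid is at hand.\<close>

lemma rep_iso_class:
  assumes "pmatroid M"
  obtains f where "inj_on f (ground M)" "rep_mat_iso (iso_class M) = relabel f M"
  using iso_classE[OF assms pmatroid_rep] by (metis iso_class_rep)

lemma class_sum_iso_class:
  assumes M: "pmatroid M" and N: "pmatroid N"
  shows "class_sum (iso_class M) (iso_class N) = iso_class (direct_sum M N)"
proof -
  obtain f where f: "inj_on f (ground M)" "rep_mat_iso (iso_class M) = relabel f M"
    using rep_iso_class[OF M] .
  obtain g where g: "inj_on g (ground N)" "rep_mat_iso (iso_class N) = relabel g N"
    using rep_iso_class[OF N] .
  show ?thesis
    unfolding class_sum_def f(2) g(2) direct_sum_relabel[OF M N f(1) g(1)]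
    using iso_class_relabel[OF pmatroid_direct_sum[OF M N] direct_sum_relabel(2)[OF M N f(1) g(1)]] .
qed

lemma class_sum_commute: "class_sum X Y = class_sum Y X"
  unfolding class_sum_def direct_sum_commute(1)[OF pmatroid_rep[of X] pmatroid_rep[of Y]]
  using iso_class_relabel[OF pmatroid_direct_sum[OF pmatroid_rep pmatroid_rep]
      direct_sum_commute(2)[OF pmatroid_rep pmatroid_rep], of X Y] ..

lemma class_sum_assoc: "class_sum (class_sum X Y) Z = class_sum X (class_sum Y Z)"
proof -
  let ?M = "rep_mat_iso X" and ?N = "rep_mat_iso Y" and ?P = "rep_mat_iso Z"
  note R = pmatroid_rep
  have "class_sum (class_sum X Y) Z = iso_class (direct_sum (direct_sum ?M ?N) ?P)"
    using class_sum_iso_class[OF pmatroid_direct_sum[OF R R] R, of X Y Z] by (simp add: class_sum_def)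
  also have "\<dots> = iso_class (direct_sum ?M (direct_sum ?N ?P))"
    unfolding direct_sum_assoc(1)
    by (rule iso_class_relabel[OF pmatroid_direct_sum[OF pmatroid_direct_sum[OF R R] R] direct_sum_assoc(2), symmetric])
  also have "\<dots> = class_sum X (class_sum Y Z)"
    using class_sum_iso_class[OF R pmatroid_direct_sum[OF R R], of X Y Z] by (simp add: class_sum_def)
  finally show ?thesis .
qed

lemma class_sum_zero_right [simp]: "class_sum X class_zero = X"
proof -
  have "class_sum X class_zero = iso_class (direct_sum (rep_mat_iso X) zero_pmat)"
    using class_sum_iso_class[OF pmatroid_rep[of X] pmatroid_zero_pmat] by (simp add: class_zero_def)
  also have "\<dots> = iso_class (rep_mat_iso X)"
  proof -
    have z: "ground zero_pmat = {point zero_pmat}" by (simp add: zero_pmat_def)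
    show ?thesis
      unfolding direct_sum_zero(1)[OF pmatroid_rep pmatroid_zero_pmat z]
      by (rule iso_class_relabel[OF pmatroid_rep direct_sum_zero(2)[OF pmatroid_rep pmatroid_zero_pmat z]])
  qed
  finally show ?thesis by simp
qed

lemma class_sum_zero_left [simp]: "class_sum class_zero X = X"
  using class_sum_commute[of class_zero X] by simp

lemma class_size_iso_class:
  assumes M: "pmatroid M" shows "class_size (iso_class M) = card (elems M)"
proof -
  obtain f where f: "inj_on f (ground M)" "rep_mat_iso (iso_class M) = relabel f M"
    using rep_iso_class[OF M] .
  then show ?thesis
    unfolding class_size_def f(2) elems_relabel[OF M f(1)]
    by (intro card_image) (auto intro: inj_on_subset simp: elems_def)
qed

lemma class_size_sum: "class_size (class_sum X Y) = class_size X + class_size Y"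
proof -
  let ?M = "rep_mat_iso X" and ?N = "rep_mat_iso Y"
  have "class_size (class_sum X Y) = card (elems (direct_sum ?M ?N))"
    unfolding class_sum_def using class_size_iso_class[OF pmatroid_direct_sum[OF pmatroid_rep pmatroid_rep]] .
  also have "\<dots> = card (Inl ` elems ?M \<union> Inr ` elems ?N)"
    unfolding elems_direct_sum by (intro card_image) auto
  also have "\<dots> = card (elems ?M) + card (elems ?N)"
    by (subst card_Un_disjoint) (auto simp: card_image finite_elems[OF pmatroid_rep])
  finally show ?thesis by (simp add: class_size_def)
qed

lemma pmatroid_elems_empty_relabel:
  assumes M: "pmatroid M" and e: "elems M = {}"
  shows "relabel (\<lambda>_. 0) M = zero_pmat" "inj_on (\<lambda>_. 0 :: nat) (ground M)"
proof -
  have g: "ground M = {point M}" using ground_eq[OF M] e by simp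
  have "F = {point M}" if "F \<in> flats M" for F
    using pmatroid_flats_subset[OF M that] point_in_flat[OF M that] g by blast
  moreover have "{point M} \<in> flats M" using ground_flat[OF M] g by simp
  ultimately have "flats M = {{point M}}" by blast
  then show "relabel (\<lambda>_. 0) M = zero_pmat" using g by (simp add: relabel_def zero_pmat_def)
  show "inj_on (\<lambda>_. 0 :: nat) (ground M)" using g by simp
qed

lemma iso_class_zero_iff:
  assumes M: "pmatroid M" shows "iso_class M = class_zero \<longleftrightarrow> elems M = {}"
proof
  assume "elems M = {}"
  then show "iso_class M = class_zero"
    using pmatroid_elems_empty_relabel[OF M] iso_class_relabel[OF M] unfolding class_zero_def by metis
next
  assume "iso_class M = class_zero"
  then have "card (elems M) = card (elems zero_pmat)"
    using class_size_iso_class M pmatroid_zero_pmat unfolding class_zero_def by metis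
  then show "elems M = {}" using finite_elems[OF M] by (simp add: elems_def zero_pmat_def)
qed

lemma class_size_0_iff: "class_size X = 0 \<longleftrightarrow> X = class_zero"
  using iso_class_zero_iff[OF pmatroid_rep[of X]] finite_elems[OF pmatroid_rep[of X]]
  by (simp add: class_size_def)

lemma class_sum_zero_iff: "class_sum X Y = class_zero \<longleftrightarrow> X = class_zero \<and> Y = class_zero"
  using class_size_sum[of X Y] class_size_0_iff by (metis add_is_0)

section \<open>Finiteness of the classes of a given size\<close>

text \<open>A class of size \<open>n\<close> has a representative on \<open>{..n}\<close>, which has
  \<open>n + 1\<close> points because of the base point, and there are finitely many choices of
  ground set, flats and base point there. The finite supports of products and coproducts rest on
  this.\<close>

lemma finite_class_size: "finite {X. class_size X = n}"
proof -
  let ?R = "{M :: nat pmat. ground M \<subseteq> {..n} \<and> flats M \<subseteq> Pow {..n} \<and> point M \<in> {..n}}"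
  have "?R \<subseteq> (\<lambda>(E, F, p). \<lparr>ground = E, flats = F, point = p\<rparr>) ` (Pow {..n} \<times> Pow (Pow {..n}) \<times> {..n})"
  proof
    fix M assume "M \<in> ?R"
    then show "M \<in> (\<lambda>(E, F, p). \<lparr>ground = E, flats = F, point = p\<rparr>) ` (Pow {..n} \<times> Pow (Pow {..n}) \<times> {..n})"
      by (intro image_eqI[of _ _ "(ground M, flats M, point M)"]) auto
  qed
  then have fin: "finite ?R" by (rule finite_subset) auto
  have "{X. class_size X = n} \<subseteq> iso_class ` ?R"
  proof
    fix X assume "X \<in> {X. class_size X = n}"
    let ?M = "rep_mat_iso X"
    have M: "pmatroid ?M" by (rule pmatroid_rep)
    have "point ?M \<notin> elems ?M" by (simp add: elems_def)
    then have c: "card (ground ?M) = Suc n"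
      unfolding ground_eq[OF M] using \<open>X \<in> _\<close> finite_elems[OF M] by (simp add: class_size_def)
    obtain f :: "nat \<Rightarrow> nat" where f: "bij_betw f (ground ?M) {0..<Suc n}"
      using ex_bij_betw_finite_nat[OF pmatroid_finite[OF M]] c by metis
    have inj: "inj_on f (ground ?M)" using f by (simp add: bij_betw_def)
    have im: "f ` ground ?M \<subseteq> {..n}" using f by (auto simp: bij_betw_def)
    then have "relabel f ?M \<in> ?R"
      using pmatroid_point[OF M] pmatroid_flats_subset[OF M] by (auto simp: image_subset_iff subset_iff)
    moreover have "X = iso_class (relabel f ?M)" using iso_class_relabel[OF M inj] by simp
    ultimately show "X \<in> iso_class ` ?R" by blast
  qed
  then show ?thesis using fin finite_surj by blast
qed

lemma finite_class_size_le: "finite {X. class_size X \<le> n}"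
proof -
  have "{X. class_size X \<le> n} = (\<Union>m\<in>{..n}. {X. class_size X = m})" by auto
  then show ?thesis using finite_class_size by simp
qed

text \<open>The index set of the coproduct of \<open>delta X\<close>: ordered pairs of classes, each
  counted once, however many decompositions of a representative realise it.\<close>

definition splits :: "mat_iso \<Rightarrow> (mat_iso \<times> mat_iso) set" where
  "splits X = {(A, B). class_sum A B = X}"

lemma finite_splits: "finite (splits X)"
proof (rule finite_subset)
  show "splits X \<subseteq> {A. class_size A \<le> class_size X} \<times> {A. class_size A \<le> class_size X}"
    using class_size_sum by (auto simp: splits_def)
qed (simp add: finite_class_size_le)

section \<open>Sums over minors\<close>

text \<open>The summand is arbitrary and may take values in any commutative monoid, so one set of
  identities serves associativity, the unit laws and the compatibility with the coproduct.\<close>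

definition minor_sum :: "mat_iso \<Rightarrow> (mat_iso \<Rightarrow> mat_iso \<Rightarrow> 'c::comm_monoid_add) \<Rightarrow> 'c" where
  "minor_sum X F = (\<Sum>S\<in>Pow (elems (rep_mat_iso X)).
     F (iso_class (restriction (rep_mat_iso X) S)) (iso_class (contraction (rep_mat_iso X) S)))"

definition minors :: "mat_iso \<Rightarrow> (mat_iso \<times> mat_iso) set" where
  "minors X = (\<lambda>S. (iso_class (restriction (rep_mat_iso X) S), iso_class (contraction (rep_mat_iso X) S)))
     ` Pow (elems (rep_mat_iso X))"

lemma minor_sum_cong:
  "(\<And>A B. (A, B) \<in> minors X \<Longrightarrow> F A B = G A B) \<Longrightarrow> minor_sum X F = minor_sum X G"
  unfolding minor_sum_def minors_def by (intro sum.cong) auto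

lemma minors_size: "(A, B) \<in> minors X \<Longrightarrow> class_size A + class_size B = class_size X"
proof -
  assume "(A, B) \<in> minors X"
  then obtain S where S: "S \<subseteq> elems (rep_mat_iso X)"
    "A = iso_class (restriction (rep_mat_iso X) S)" "B = iso_class (contraction (rep_mat_iso X) S)"
    unfolding minors_def by auto
  note R = pmatroid_rep[of X]
  have "class_size A = card S" "class_size B = card (elems (rep_mat_iso X) - S)"
    using S class_size_iso_class[OF pmatroid_restriction[OF R S(1)]]
      class_size_iso_class[OF pmatroid_contraction[OF R S(1)]]
    by (simp_all add: elems_restriction elems_contraction)
  then show ?thesis
    using S(1) finite_elems[OF R] by (metis class_size_def card_Diff_subset finite_subset card_mono le_add_diff_inverse)
qed

text \<open>The bijection onto the representative induces one on subsets and preserves the classes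
  of both minors. Hence the sum may be taken over any matroid in the class, such as a direct sum, a
  dual or a minor.\<close>

lemma minor_sum_iso_class:
  assumes M: "pmatroid M"
  shows "minor_sum (iso_class M) F =
    (\<Sum>S\<in>Pow (elems M). F (iso_class (restriction M S)) (iso_class (contraction M S)))"
proof -
  obtain f where f: "inj_on f (ground M)" and R: "rep_mat_iso (iso_class M) = relabel f M"
    using rep_iso_class[OF M] .
  have fe: "inj_on f (elems M)" using f by (auto intro: inj_on_subset simp: elems_def)
  have "bij_betw ((`) f) (Pow (elems M)) (Pow (f ` elems M))"
    using fe by (simp add: bij_betw_def inj_on_image_Pow image_Pow_surj)
  then have "minor_sum (iso_class M) F = (\<Sum>S\<in>Pow (elems M).
      F (iso_class (restriction (relabel f M) (f ` S))) (iso_class (contraction (relabel f M) (f ` S))))"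
    unfolding minor_sum_def R elems_relabel[OF M f]
    by (rule sum.reindex_bij_betw[symmetric])
  also have "\<dots> = (\<Sum>S\<in>Pow (elems M). F (iso_class (restriction M S)) (iso_class (contraction M S)))"
  proof (rule sum.cong[OF HOL.refl])
    fix S assume "S \<in> Pow (elems M)"
    then have S: "S \<subseteq> elems M" by simp
    have "inj_on f (ground (restriction M S))" "inj_on f (ground (contraction M S))"
      using S ground_eq[OF M] f by (auto intro: inj_on_subset)
    then show "F (iso_class (restriction (relabel f M) (f ` S))) (iso_class (contraction (relabel f M) (f ` S)))
      = F (iso_class (restriction M S)) (iso_class (contraction M S))"
      unfolding restriction_relabel[OF M f S] contraction_relabel[OF M f S]
      by (simp only: iso_class_relabel[OF pmatroid_restriction[OF M S]] iso_class_relabel[OF pmatroid_contraction[OF M S]])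
  qed
  finally show ?thesis .
qed

lemma minors_iso_class:
  assumes M: "pmatroid M" and S: "S \<subseteq> elems M"
  shows "(iso_class (restriction M S), iso_class (contraction M S)) \<in> minors (iso_class M)"
proof -
  obtain f where f: "inj_on f (ground M)" and R: "rep_mat_iso (iso_class M) = relabel f M"
    using rep_iso_class[OF M] .
  have "inj_on f (ground (restriction M S))" "inj_on f (ground (contraction M S))"
    using S ground_eq[OF M] f by (auto intro: inj_on_subset)
  then have "iso_class (restriction (relabel f M) (f ` S)) = iso_class (restriction M S)"
    "iso_class (contraction (relabel f M) (f ` S)) = iso_class (contraction M S)"
    unfolding restriction_relabel[OF M f S] contraction_relabel[OF M f S]
    by (simp_all only: iso_class_relabel[OF pmatroid_restriction[OF M S]] iso_class_relabel[OF pmatroid_contraction[OF M S]])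
  then show ?thesis
    unfolding minors_def R elems_relabel[OF M f] using S by (intro image_eqI[of _ _ "f ` S"]) auto
qed

lemma minors_class_sum: "(X, Y) \<in> minors (class_sum X Y)"
proof -
  define M N where "M = rep_mat_iso X" and "N = rep_mat_iso Y"
  have M: "pmatroid M" and N: "pmatroid N" by (simp_all add: M_def N_def pmatroid_rep)
  \<comment> \<open>All of the left summand: restricting leaves \<open>M\<close> plus a zero
    summand, contracting leaves a zero summand plus \<open>N\<close>.\<close>
  let ?S = "Some ` (Inl ` elems M \<union> Inr ` {})"
  have S: "?S \<subseteq> elems (direct_sum M N)" by (auto simp: elems_direct_sum)
  have "iso_class (restriction N {}) = class_zero" "iso_class (contraction M (elems M)) = class_zero"
    using iso_class_zero_iff[OF pmatroid_restriction[OF N, of "{}"]] elems_restriction[of "{}" N]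
      iso_class_zero_iff[OF pmatroid_contraction[OF M, of "elems M"]] elems_contraction[of "elems M" M] by simp_all
  then have "iso_class (restriction (direct_sum M N) ?S) = X" "iso_class (contraction (direct_sum M N) ?S) = Y"
    unfolding direct_sum_restriction[OF M N Orderings.order_refl empty_subsetI] direct_sum_contraction[OF M N Orderings.order_refl empty_subsetI]
    unfolding class_sum_iso_class[OF pmatroid_restriction[OF M Orderings.order_refl] pmatroid_restriction[OF N empty_subsetI], symmetric]
      class_sum_iso_class[OF pmatroid_contraction[OF M Orderings.order_refl] pmatroid_contraction[OF N empty_subsetI], symmetric]
    unfolding restriction_elems[OF M] contraction_empty
    by (simp_all add: M_def N_def)
  then show ?thesis
    using minors_iso_class[OF pmatroid_direct_sum[OF M N] S]
    by (simp only: class_sum_def M_def[symmetric] N_def[symmetric])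
qed

text \<open>Both sides run over nested sets of elements \<open>S \<subseteq> T\<close> and evaluate
  \<open>F\<close> at the classes of \<open>M|S\<close>, \<open>(M|T)/S\<close> and
  \<open>M/T\<close>. The left side chooses \<open>T\<close> first, the right side chooses
  \<open>S\<close> and then \<open>U = T - S\<close>.\<close>

lemma minor_sum_coassoc:
  "minor_sum X (\<lambda>A B. minor_sum A (\<lambda>C D. F C D B)) = minor_sum X (\<lambda>A B. minor_sum B (\<lambda>C D. F A C D))"
proof -
  define M where "M = rep_mat_iso X"
  have M: "pmatroid M" by (simp add: M_def pmatroid_rep)
  let ?E = "elems M"
  have fin: "finite ?E" using finite_elems[OF M] .
  have finP: "finite (Pow S)" if "S \<subseteq> ?E" for S using that fin by (simp add: finite_subset)
  let ?G = "\<lambda>S T. F (iso_class (restriction M S)) (iso_class (contraction (restriction M T) S)) (iso_class (contraction M T))"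
  have "minor_sum X (\<lambda>A B. minor_sum A (\<lambda>C D. F C D B)) = (\<Sum>T\<in>Pow ?E. \<Sum>S\<in>Pow T. ?G S T)"
    unfolding minor_sum_def[of X] M_def[symmetric]
  proof (rule sum.cong[OF HOL.refl])
    fix T assume "T \<in> Pow ?E"
    then have T: "T \<subseteq> ?E" by simp
    show "minor_sum (iso_class (restriction M T)) (\<lambda>C D. F C D (iso_class (contraction M T))) = (\<Sum>S\<in>Pow T. ?G S T)"
      unfolding minor_sum_iso_class[OF pmatroid_restriction[OF M T]] elems_restriction[OF T]
      by (rule sum.cong[OF HOL.refl]) (simp add: restriction_restriction[OF PowD])
  qed
  also have "\<dots> = (\<Sum>(T, S)\<in>Sigma (Pow ?E) Pow. ?G S T)"
    using fin finP by (subst sum.Sigma) auto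
  also have "\<dots> = (\<Sum>(S, U)\<in>(SIGMA S:Pow ?E. Pow (?E - S)). ?G S (S \<union> U))"
    by (rule sum.reindex_bij_witness[where i = "\<lambda>(S, U). (S \<union> U, S)" and j = "\<lambda>(T, S). (S, T - S)"])
      (auto simp: Un_absorb1)
  also have "\<dots> = (\<Sum>S\<in>Pow ?E. \<Sum>U\<in>Pow (?E - S). ?G S (S \<union> U))"
    using fin finP by (subst sum.Sigma) auto
  also have "\<dots> = minor_sum X (\<lambda>A B. minor_sum B (\<lambda>C D. F A C D))"
    unfolding minor_sum_def[of X] M_def[symmetric]
  proof (rule sum.cong[OF HOL.refl])
    fix S assume "S \<in> Pow ?E"
    then have S: "S \<subseteq> ?E" by simp
    show "(\<Sum>U\<in>Pow (?E - S). ?G S (S \<union> U)) =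
      minor_sum (iso_class (contraction M S)) (\<lambda>C D. F (iso_class (restriction M S)) C D)"
      unfolding minor_sum_iso_class[OF pmatroid_contraction[OF M S]] elems_contraction[OF S]
    proof (rule sum.cong[OF HOL.refl])
      fix U assume U: "U \<in> Pow (?E - S)"
      then have e: "S \<union> U - S = U" "S \<subseteq> S \<union> U" "S \<union> U \<subseteq> ?E" using S by auto
      show "?G S (S \<union> U) = F (iso_class (restriction M S)) (iso_class (restriction (contraction M S) U))
          (iso_class (contraction (contraction M S) U))"
        using restriction_contraction[OF e(2,3), unfolded e(1)] contraction_contraction[OF e(2), of M, unfolded e(1)]
        by (simp only:)
    qed
  qed
  finally show ?thesis .
qed

text \<open>A subset of the elements of a direct sum is a pair of subsets of the summands, and both
  minors split accordingly. This becomes the compatibility of product and coproduct.\<close>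

lemma minor_sum_class_sum:
  "minor_sum (class_sum X Y) F =
    minor_sum X (\<lambda>A B. minor_sum Y (\<lambda>C D. F (class_sum A C) (class_sum B D)))"
proof -
  define M N where "M = rep_mat_iso X" and "N = rep_mat_iso Y"
  have M: "pmatroid M" and N: "pmatroid N" by (simp_all add: M_def N_def pmatroid_rep)
  note MN = pmatroid_direct_sum[OF M N]
  let ?u = "\<lambda>(S, T). Some ` (Inl ` S \<union> Inr ` T)"
  have b: "bij_betw ?u (Pow (elems M) \<times> Pow (elems N)) (Pow (elems (direct_sum M N)))"
  proof (rule bij_betwI[where g = "\<lambda>U. (left_part U, right_part U)"])
    show "?u (left_part U, right_part U) = U" if "U \<in> Pow (elems (direct_sum M N))" for U
    proof -
      have "None \<notin> U" using that by (auto simp: elems_direct_sum)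
      then show ?thesis by (intro option_sum_set_eqI) auto
    qed
  qed (auto simp: elems_direct_sum)
  have "minor_sum (class_sum X Y) F = (\<Sum>U\<in>Pow (elems (direct_sum M N)).
      F (iso_class (restriction (direct_sum M N) U)) (iso_class (contraction (direct_sum M N) U)))"
    unfolding class_sum_def[of X Y] M_def[symmetric] N_def[symmetric] by (rule minor_sum_iso_class[OF MN])
  also have "\<dots> = (\<Sum>(S, T)\<in>Pow (elems M) \<times> Pow (elems N).
      F (class_sum (iso_class (restriction M S)) (iso_class (restriction N T)))
        (class_sum (iso_class (contraction M S)) (iso_class (contraction N T))))"
    unfolding sum.reindex_bij_betw[OF b, symmetric]
  proof (rule sum.cong[OF HOL.refl])
    fix x assume "x \<in> Pow (elems M) \<times> Pow (elems N)"
    then obtain S T where x: "x = (S, T)" and S: "S \<subseteq> elems M" and T: "T \<subseteq> elems N" by auto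
    show "F (iso_class (restriction (direct_sum M N) (?u x))) (iso_class (contraction (direct_sum M N) (?u x))) =
      (case x of (S, T) \<Rightarrow> F (class_sum (iso_class (restriction M S)) (iso_class (restriction N T)))
        (class_sum (iso_class (contraction M S)) (iso_class (contraction N T))))"
      unfolding x prod.case direct_sum_restriction[OF M N S T] direct_sum_contraction[OF M N S T]
        class_sum_iso_class[OF pmatroid_restriction[OF M S] pmatroid_restriction[OF N T]]
        class_sum_iso_class[OF pmatroid_contraction[OF M S] pmatroid_contraction[OF N T]] ..
  qed
  also have "\<dots> = minor_sum X (\<lambda>A B. minor_sum Y (\<lambda>C D. F (class_sum A C) (class_sum B D)))"
    unfolding minor_sum_def M_def[symmetric] N_def[symmetric] by (rule sum.cartesian_product[symmetric])
  finally show ?thesis .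
qed

text \<open>Only the empty subset has a zero restriction, and contracting it changes nothing. This
  and its mirror image are the unit laws of the product.\<close>

lemma minor_sum_zero_left:
  "minor_sum X (\<lambda>A B. if A = class_zero then g B else 0) = g X"
proof -
  define M where "M = rep_mat_iso X"
  have M: "pmatroid M" by (simp add: M_def pmatroid_rep)
  have "minor_sum X (\<lambda>A B. if A = class_zero then g B else 0) =
      (\<Sum>S\<in>Pow (elems M). if S = {} then g (iso_class (contraction M {})) else 0)"
    unfolding minor_sum_def M_def[symmetric]
    using iso_class_zero_iff[OF pmatroid_restriction[OF M]] elems_restriction[of _ M]
    by (intro sum.cong) auto
  also have "\<dots> = g X" using finite_elems[OF M] by (simp add: contraction_empty M_def)
  finally show ?thesis .
qed

lemma minor_sum_zero_right:
  "minor_sum X (\<lambda>A B. if B = class_zero then g A else 0) = g X"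
proof -
  define M where "M = rep_mat_iso X"
  have M: "pmatroid M" by (simp add: M_def pmatroid_rep)
  have "minor_sum X (\<lambda>A B. if B = class_zero then g A else 0) =
      (\<Sum>S\<in>Pow (elems M). if S = elems M then g (iso_class (restriction M (elems M))) else 0)"
    unfolding minor_sum_def M_def[symmetric]
    using iso_class_zero_iff[OF pmatroid_contraction[OF M]] elems_contraction[of _ M]
    by (intro sum.cong) auto
  also have "\<dots> = g X" using finite_elems[OF M] restriction_elems[OF M] by (simp add: M_def)
  finally show ?thesis .
qed

lemma minor_sum_class_zero: "minor_sum class_zero F = F class_zero class_zero"
proof -
  have "elems zero_pmat = {}" by (simp add: elems_def zero_pmat_def)
  moreover have "restriction zero_pmat {} = zero_pmat"
    using restriction_elems[OF pmatroid_zero_pmat] calculation by simp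
  ultimately show ?thesis
    unfolding class_zero_def minor_sum_iso_class[OF pmatroid_zero_pmat] by (simp add: contraction_empty)
qed

section \<open>Duality of classes\<close>

definition class_dual :: "mat_iso \<Rightarrow> mat_iso" where
  "class_dual X = iso_class (dual (rep_mat_iso X))"

lemma class_dual_iso_class:
  assumes M: "pmatroid M" shows "class_dual (iso_class M) = iso_class (dual M)"
proof -
  obtain f where f: "inj_on f (ground M)" "rep_mat_iso (iso_class M) = relabel f M"
    using rep_iso_class[OF M] .
  show ?thesis
    unfolding class_dual_def f(2) dual_relabel[OF M f(1)]
    using f(1) by (intro iso_class_relabel pmatroid_dual[OF M]) simp
qed

lemma class_dual_dual [simp]: "class_dual (class_dual X) = X"
  using class_dual_iso_class[OF pmatroid_dual[OF pmatroid_rep[of X]]] dual_dual[OF pmatroid_rep]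
  by (simp add: class_dual_def)

lemma class_dual_sum: "class_dual (class_sum X Y) = class_sum (class_dual X) (class_dual Y)"
proof -
  note R = pmatroid_rep
  have "class_dual (class_sum X Y) = iso_class (dual (direct_sum (rep_mat_iso X) (rep_mat_iso Y)))"
    unfolding class_sum_def using class_dual_iso_class[OF pmatroid_direct_sum[OF R R]] .
  also have "\<dots> = class_sum (class_dual X) (class_dual Y)"
    unfolding dual_direct_sum[OF R R] class_dual_def class_sum_iso_class[OF pmatroid_dual[OF R] pmatroid_dual[OF R]] ..
  finally show ?thesis .
qed

lemma class_dual_size [simp]: "class_size (class_dual X) = class_size X"
  unfolding class_dual_def class_size_iso_class[OF pmatroid_dual[OF pmatroid_rep]] by (simp add: class_size_def)

lemma class_dual_zero_iff [simp]: "class_dual X = class_zero \<longleftrightarrow> X = class_zero"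
  using class_size_0_iff[of X] class_size_0_iff[of "class_dual X"] by simp

text \<open>Replacing \<open>S\<close> by its complement turns minors of the dual into duals of
  minors, with restriction and contraction exchanged. The reversed arguments of \<open>F\<close>
  undo the reversed order of the factors in the Hall product.\<close>

lemma minor_sum_dual: "minor_sum (class_dual X) F = minor_sum X (\<lambda>A B. F (class_dual B) (class_dual A))"
proof -
  define M where "M = rep_mat_iso X"
  have M: "pmatroid M" by (simp add: M_def pmatroid_rep)
  have "minor_sum (class_dual X) F = (\<Sum>S\<in>Pow (elems M).
      F (iso_class (restriction (dual M) S)) (iso_class (contraction (dual M) S)))"
    unfolding class_dual_def M_def[symmetric] minor_sum_iso_class[OF pmatroid_dual[OF M]] elems_dual ..
  also have "\<dots> = (\<Sum>S\<in>Pow (elems M). F (class_dual (iso_class (contraction M S))) (class_dual (iso_class (restriction M S))))"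
  proof (rule sum.reindex_bij_witness[where i = "\<lambda>S. elems M - S" and j = "\<lambda>S. elems M - S"])
    fix S assume "S \<in> Pow (elems M)"
    then have S: "S \<subseteq> elems M" by simp
    have S': "elems M - S \<subseteq> elems M" "elems M - (elems M - S) = S" using S by auto
    show "F (class_dual (iso_class (contraction M (elems M - S)))) (class_dual (iso_class (restriction M (elems M - S)))) =
      F (iso_class (restriction (dual M) S)) (iso_class (contraction (dual M) S))"
      using class_dual_iso_class[OF pmatroid_contraction[OF M S'(1)]] class_dual_iso_class[OF pmatroid_restriction[OF M S'(1)]]
        dual_contraction[OF M S'(1)] dual_restriction[OF M S'(1)] S'(2) by simp
  qed auto
  finally show ?thesis by (simp add: minor_sum_def M_def)
qed


section \<open>Admissible short exact sequences\<close>

lemma relabel_relabel: "relabel g (relabel f M) = relabel (g \<circ> f) M"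
  by (simp add: relabel_def image_image image_comp)

lemma iso_map_id:
  assumes M: "pmatroid M" shows "iso_map M M (\<lambda>x\<in>ground M. x)"
  using relabel_iso_map[OF M, of "\<lambda>x. x"] relabel_id[OF M, of "\<lambda>x. x"] by simp

lemma strong_map_restriction:
  assumes M: "pmatroid M" and S: "S \<subseteq> elems M"
  shows "strong_map (restriction M S) M (\<lambda>x\<in>insert (point M) S. x)"
proof -
  have "(\<lambda>x\<in>insert (point M) S. x) -` A \<inter> insert (point M) S = A \<inter> insert (point M) S" for A
    by auto
  then show ?thesis
    using S pmatroid_point[OF M] by (auto simp: strong_map_def elems_def)
qed

lemma adm_mono_restriction:
  assumes M: "pmatroid M" and S: "S \<subseteq> elems M"
  shows "adm_mono (restriction M S) M (\<lambda>x\<in>insert (point M) S. x)"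
  unfolding adm_mono_def
proof (intro conjI exI)
  show "iso_map (restriction M S) (restriction M S) (\<lambda>x\<in>ground (restriction M S). x)"
    by (rule iso_map_id[OF pmatroid_restriction[OF M S]])
  show "(\<lambda>x\<in>insert (point M) S. x) =
    compose (ground (restriction M S)) (\<lambda>x\<in>ground (restriction M S). x) (\<lambda>x\<in>ground (restriction M S). x)"
    by (rule ext) (auto simp: compose_def)
qed (use assms pmatroid_restriction[OF M S] strong_map_restriction[OF M S] in auto)

text \<open>Maps are extensional, so following the isomorphism onto the restriction by the inclusion
  returns the same function. Hence \<open>i\<close> itself is that isomorphism, and its image
  determines \<open>S\<close>.\<close>

lemma adm_monoD:
  assumes "adm_mono A B i"
  obtains S where "S \<subseteq> elems B" "iso_map A (restriction B S) i" "i ` ground A = insert (point B) S"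
proof -
  from assms obtain S f where S: "S \<subseteq> elems B" and f: "iso_map A (restriction B S) f"
    and i: "i = compose (ground A) (\<lambda>x\<in>ground (restriction B S). x) f" and A: "pmatroid A" and B: "pmatroid B"
    unfolding adm_mono_def by blast
  have "f \<in> ground A \<rightarrow>\<^sub>E ground (restriction B S)"
    using f by (simp add: iso_map_def strong_map_def)
  then have "i = f" unfolding i by (intro ext) (auto simp: compose_def PiE_def extensional_def)
  then show ?thesis
    using that[OF S] f iso_map_imp_relabel(2)[OF A pmatroid_restriction[OF B S] f]
    by (metis relabel_sel(1) restriction_sel(1))
qed

lemma strong_map_contraction:
  assumes M: "pmatroid M" and S: "S \<subseteq> elems M"
  shows "strong_map M (contraction M S) (\<lambda>x\<in>ground M. if x \<in> S then point M else x)"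
proof -
  have p: "point M \<notin> S" using S by (auto simp: elems_def)
  have "(\<lambda>x\<in>ground M. if x \<in> S then point M else x) -` (A - S) \<inter> ground M = A"
    if "A \<in> flats M" "S \<subseteq> A" for A
    using p that pmatroid_flats_subset[OF M that(1)] point_in_flat[OF M that(1)]
    by (auto split: if_splits)
  then show ?thesis
    using p pmatroid_point[OF M] by (auto simp: strong_map_def)
qed

lemma adm_epi_contraction:
  assumes M: "pmatroid M" and S: "S \<subseteq> elems M"
  shows "adm_epi M (contraction M S) (\<lambda>x\<in>ground M. if x \<in> S then point M else x)"
  unfolding adm_epi_def
proof (intro conjI exI)
  have p: "point M \<notin> S" using S by (auto simp: elems_def)
  show "iso_map (contraction M S) (contraction M S) (\<lambda>x\<in>ground (contraction M S). x)"
    by (rule iso_map_id[OF pmatroid_contraction[OF M S]])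
  show "(\<lambda>x\<in>ground M. if x \<in> S then point M else x) =
    compose (ground M) (\<lambda>x\<in>ground (contraction M S). x) (\<lambda>x\<in>ground M. if x \<in> S then point M else x)"
    using p pmatroid_point[OF M] by (intro ext) (auto simp: compose_def)
qed (use assms pmatroid_contraction[OF M S] strong_map_contraction[OF M S] in auto)

text \<open>The isomorphism after the canonical map is injective, so the fibre of \<open>p\<close>
  over the base point is exactly the contracted set with the base point. Thus \<open>p\<close>
  remembers which set was contracted.\<close>

lemma adm_epiD:
  assumes "adm_epi B C p"
  obtains S where "S \<subseteq> elems B" "pmat_iso (contraction B S) C"
    "\<And>x. x \<in> ground B \<Longrightarrow> p x = point C \<longleftrightarrow> x \<in> insert (point B) S"
proof -
  from assms obtain S f where S: "S \<subseteq> elems B" and f: "iso_map (contraction B S) C f"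
    and p: "p = compose (ground B) f (\<lambda>x\<in>ground B. if x \<in> S then point B else x)"
    and B: "pmatroid B" and C: "pmatroid C"
    unfolding adm_epi_def by blast
  note R = iso_map_imp_relabel[OF pmatroid_contraction[OF B S] C f]
  have pt: "point B \<in> ground B - S" using pmatroid_point[OF B] S by (auto simp: elems_def)
  have "p x = point C \<longleftrightarrow> x \<in> insert (point B) S" if "x \<in> ground B" for x
  proof -
    have "f y = f (point B) \<longleftrightarrow> y = point B" if "y \<in> ground B - S" for y
      using R(1) that pt by (auto simp: inj_on_def)
    moreover have "point C = f (point B)" using R(2) by simp
    ultimately show ?thesis using \<open>x \<in> ground B\<close> unfolding p by (auto simp: compose_def)
  qed
  moreover have "pmat_iso (contraction B S) C" using f unfolding pmat_iso_def by blast
  ultimately show ?thesis using that S by blast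
qed

lemma strong_map_to_zero:
  assumes M: "pmatroid M" shows "strong_map M zero_pmat (\<lambda>x\<in>ground M. 0)"
proof -
  have "(\<lambda>x\<in>ground M. 0 :: nat) -` {0} \<inter> ground M = ground M" by auto
  then show ?thesis
    using ground_flat[OF M] pmatroid_point[OF M] by (auto simp: strong_map_def zero_pmat_def)
qed

lemma strong_map_from_zero:
  assumes M: "pmatroid M" shows "strong_map zero_pmat M (\<lambda>x\<in>{0}. point M)"
proof -
  have "(\<lambda>x\<in>{0 :: nat}. point M) -` A \<inter> {0} = {0}" if "A \<in> flats M" for A
    using point_in_flat[OF M that] by auto
  then show ?thesis
    using pmatroid_point[OF M] by (auto simp: strong_map_def zero_pmat_def)
qed

lemma adm_epi_zero:
  assumes A: "pmatroid A" shows "adm_epi A zero_pmat (\<lambda>x\<in>ground A. 0)"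
  unfolding adm_epi_def
proof (intro conjI exI)
  let ?C = "contraction A (elems A)"
  have C: "pmatroid ?C" using pmatroid_contraction[OF A] by blast
  have "elems ?C = {}" using elems_contraction[of "elems A" A] by blast
  from pmatroid_elems_empty_relabel[OF C this]
  show "iso_map ?C zero_pmat (\<lambda>x\<in>ground ?C. 0)" using relabel_iso_map[OF C] by metis
  show "(\<lambda>x\<in>ground A. 0) = compose (ground A) (\<lambda>x\<in>ground ?C. 0) (\<lambda>x\<in>ground A. if x \<in> elems A then point A else x)"
    using pmatroid_point[OF A] by (intro ext) (auto simp: compose_def elems_def)
qed (use A pmatroid_zero_pmat strong_map_to_zero[OF A] in auto)

lemma adm_mono_zero:
  assumes C: "pmatroid C" shows "adm_mono zero_pmat C (\<lambda>x\<in>{0}. point C)"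
  unfolding adm_mono_def
proof (intro conjI exI)
  have "(\<lambda>A. A \<inter> {point C}) ` flats C = {{point C}}"
    using point_in_flat[OF C] ground_flat[OF C] by (auto simp: image_iff)
  then have "restriction C {} = relabel (\<lambda>_. point C) zero_pmat"
    by (intro pmat.equality) (auto simp: zero_pmat_def)
  then show "iso_map zero_pmat (restriction C {}) (\<lambda>x\<in>{0}. point C)"
    using relabel_iso_map[OF pmatroid_zero_pmat, of "\<lambda>_. point C"] by (simp add: zero_pmat_def)
  show "(\<lambda>x\<in>{0}. point C) = compose (ground zero_pmat) (\<lambda>x\<in>ground (restriction C {}). x) (\<lambda>x\<in>{0}. point C)"
    by (intro ext) (auto simp: compose_def zero_pmat_def)
qed (use C pmatroid_zero_pmat strong_map_from_zero[OF C] in auto)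

lemma commutative_square_minor:
  fixes B :: "nat pmat"
  assumes B: "pmatroid B" and S: "S \<subseteq> elems B"
  shows "commutative_square (restriction B S) B zero_pmat (contraction B S)
    (\<lambda>x\<in>insert (point B) S. x) (\<lambda>x\<in>insert (point B) S. 0)
    (\<lambda>x\<in>ground B. if x \<in> S then point B else x) (\<lambda>x\<in>{0}. point B)"
  unfolding commutative_square_def
proof (intro conjI)
  show "strong_map (restriction B S) zero_pmat (\<lambda>x\<in>insert (point B) S. 0)"
    using strong_map_to_zero[OF pmatroid_restriction[OF B S]] by simp
  show "strong_map zero_pmat (contraction B S) (\<lambda>x\<in>{0}. point B)"
    using strong_map_from_zero[OF pmatroid_contraction[OF B S]] by simp
  show "compose (ground (restriction B S)) (\<lambda>x\<in>ground B. if x \<in> S then point B else x) (\<lambda>x\<in>insert (point B) S. x)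
    = compose (ground (restriction B S)) (\<lambda>x\<in>{0}. point B) (\<lambda>x\<in>insert (point B) S. 0)"
    using S pmatroid_point[OF B] by (intro ext) (auto simp: compose_def elems_def)
qed (fact strong_map_restriction[OF B S] strong_map_contraction[OF B S])+

lemma cartesian_minor:
  fixes B :: "nat pmat"
  assumes B: "pmatroid B" and S: "S \<subseteq> elems B"
  shows "cartesian (restriction B S) B zero_pmat (contraction B S)
    (\<lambda>x\<in>insert (point B) S. x) (\<lambda>x\<in>insert (point B) S. 0)
    (\<lambda>x\<in>ground B. if x \<in> S then point B else x) (\<lambda>x\<in>{0}. point B)"
  unfolding cartesian_def
proof (intro conjI commutative_square_minor[OF B S] allI impI; elim conjE)
  fix P :: "nat pmat" and u v
  let ?R = "insert (point B) S"
  let ?p = "\<lambda>x\<in>ground B. if x \<in> S then point B else x" and ?z = "\<lambda>x\<in>{0}. point B"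
  assume P: "pmatroid P" and u: "strong_map P B u" and v: "strong_map P zero_pmat v"
    and eq: "compose (ground P) ?p u = compose (ground P) ?z v"
  have uB: "u x \<in> ground B" if "x \<in> ground P" for x using u that by (auto simp: strong_map_def)
  have v0: "v x = 0" if "x \<in> ground P" for x using v that by (auto simp: strong_map_def zero_pmat_def)
  \<comment> \<open>Elements outside \<open>S\<close> are fixed by \<open>?p\<close>, while the
    other composite is constant at the base point; so \<open>u\<close> lands in \<open>?R\<close>
    and is itself the only candidate for the factorisation.\<close>
  have uR: "u x \<in> ?R" if "x \<in> ground P" for x
    using fun_cong[OF eq, of x] that uB[OF that] v0[OF that] by (auto simp: compose_def split: if_splits)
  have ext: "u x = undefined" "v x = undefined" if "x \<notin> ground P" for x
    using u v that by (auto simp: strong_map_def PiE_def extensional_def)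
  show "\<exists>!w. strong_map P (restriction B S) w \<and> compose (ground P) (\<lambda>x\<in>?R. x) w = u
    \<and> compose (ground P) (\<lambda>x\<in>?R. 0) w = v"
  proof (intro ex1I conjI)
    have "u -` (F \<inter> ?R) \<inter> ground P = u -` F \<inter> ground P" for F using uR by auto
    then show "strong_map P (restriction B S) u"
      using u uR ext unfolding strong_map_def by (auto simp: PiE_def extensional_def)
    show "compose (ground P) (\<lambda>x\<in>?R. x) u = u"
      using uR ext by (intro HOL.ext) (auto simp: compose_def)
    show "compose (ground P) (\<lambda>x\<in>?R. 0) u = v"
      using uR ext v0 by (intro HOL.ext) (auto simp: compose_def)
    fix w assume "strong_map P (restriction B S) w \<and> compose (ground P) (\<lambda>x\<in>?R. x) w = u
      \<and> compose (ground P) (\<lambda>x\<in>?R. 0) w = v"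
    then have w: "w \<in> ground P \<rightarrow>\<^sub>E ?R" "compose (ground P) (\<lambda>x\<in>?R. x) w = u"
      by (auto simp: strong_map_def)
    show "w = u"
    proof
      fix x show "w x = u x"
        using fun_cong[OF w(2), of x] w(1) ext(1)[of x]
        by (cases "x \<in> ground P") (auto simp: compose_def PiE_def extensional_def Pi_def split: if_splits)
    qed
  qed
qed

lemma cocartesian_minor:
  fixes B :: "nat pmat"
  assumes B: "pmatroid B" and S: "S \<subseteq> elems B"
  shows "cocartesian (restriction B S) B zero_pmat (contraction B S)
    (\<lambda>x\<in>insert (point B) S. x) (\<lambda>x\<in>insert (point B) S. 0)
    (\<lambda>x\<in>ground B. if x \<in> S then point B else x) (\<lambda>x\<in>{0}. point B)"
  unfolding cocartesian_def
proof (intro conjI commutative_square_minor[OF B S] allI impI; elim conjE)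
  fix P :: "nat pmat" and u v
  let ?R = "insert (point B) S"
  let ?p = "\<lambda>x\<in>ground B. if x \<in> S then point B else x" and ?z = "\<lambda>x\<in>{0}. point B"
  assume P: "pmatroid P" and u: "strong_map B P u" and v: "strong_map zero_pmat P v"
    and eq: "compose (ground (restriction B S)) u (\<lambda>x\<in>?R. x) = compose (ground (restriction B S)) v (\<lambda>x\<in>?R. 0)"
  have pt: "point B \<in> ground B" "point B \<notin> S" "S \<subseteq> ground B"
    using pmatroid_point[OF B] S by (auto simp: elems_def)
  have v0: "v 0 = point P" "\<And>x. x \<noteq> 0 \<Longrightarrow> v x = undefined"
    using v by (auto simp: strong_map_def zero_pmat_def PiE_def extensional_def)
  have up: "u (point B) = point P" using u by (simp add: strong_map_def)
  have uS: "u x = point P" if "x \<in> S" for x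
    using fun_cong[OF eq, of x] that v0 by (auto simp: compose_def)
  have uP: "u x \<in> ground P" if "x \<in> ground B" for x using u that by (auto simp: strong_map_def)
  have ext: "u x = undefined" if "x \<notin> ground B" for x
    using u that by (auto simp: strong_map_def PiE_def extensional_def)
  show "\<exists>!w. strong_map (contraction B S) P w \<and> compose (ground B) w ?p = u \<and> compose (ground zero_pmat) w ?z = v"
  proof (intro ex1I conjI)
    let ?w = "restrict u (ground B - S)"
    have "?w -` F \<inter> (ground B - S) \<in> flats (contraction B S)" if F: "F \<in> flats P" for F
    proof -
      have "u -` F \<inter> ground B \<in> flats B" using u F by (simp add: strong_map_def)
      \<comment> \<open>\<open>u\<close> collapses \<open>S\<close> to the base point, which lies in
        every flat; so the preimage contains \<open>S\<close> and survives as a flat of the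
        contraction.\<close>
      moreover have "S \<subseteq> u -` F \<inter> ground B" using uS point_in_flat[OF P F] pt by auto
      moreover have "?w -` F \<inter> (ground B - S) = u -` F \<inter> ground B - S" by auto
      ultimately show ?thesis by auto
    qed
    then show "strong_map (contraction B S) P ?w"
      unfolding strong_map_def using uP up pt by auto
    show "compose (ground B) ?w ?p = u"
      using uS ext up pt by (intro HOL.ext) (auto simp: compose_def)
    show "compose (ground zero_pmat) ?w ?z = v"
      using v0 up pt by (intro HOL.ext) (auto simp: compose_def zero_pmat_def)
    fix w assume "strong_map (contraction B S) P w \<and> compose (ground B) w ?p = u \<and> compose (ground zero_pmat) w ?z = v"
    then have w: "w \<in> (ground B - S) \<rightarrow>\<^sub>E ground P" "compose (ground B) w ?p = u"
      by (auto simp: strong_map_def)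
    show "w = ?w"
    proof
      fix x show "w x = ?w x"
        using fun_cong[OF w(2), of x] w(1)
        by (cases "x \<in> ground B - S") (auto simp: compose_def PiE_def extensional_def)
    qed
  qed
qed

lemma adm_ses_minor:
  assumes B: "pmatroid B" and S: "S \<subseteq> elems B"
  shows "adm_ses (restriction B S) (\<lambda>x\<in>insert (point B) S. x) B
    (\<lambda>x\<in>ground B. if x \<in> S then point B else x) (contraction B S)"
  unfolding adm_ses_def
  using adm_mono_restriction[OF B S] adm_epi_contraction[OF B S] cartesian_minor[OF B S] cocartesian_minor[OF B S]
    adm_mono_zero[OF pmatroid_contraction[OF B S]] adm_epi_zero[OF pmatroid_restriction[OF B S]]
  by (intro exI[of _ "\<lambda>x\<in>insert (point B) S. 0"] exI[of _ "\<lambda>x\<in>{0}. point B"]) simp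

text \<open>The kernel of \<open>p\<close> contains the image of \<open>i\<close> by commutativity of the square, and is contained
  in it because the inclusion of the kernel factors through \<open>i\<close>, the square being Cartesian.\<close>

lemma adm_ses_quotient:
  assumes ses: "adm_ses A i B p C" and S: "S \<subseteq> elems B" and im: "i ` ground A = insert (point B) S"
  shows "pmat_iso (contraction B S) C"
proof -
  from ses obtain q z where i: "adm_mono A B i" and p: "adm_epi B C p"
    and cart: "cartesian A B zero_pmat C i q p z"
    unfolding adm_ses_def by blast
  have B: "pmatroid B" using p by (simp add: adm_epi_def)
  from p obtain T where T: "T \<subseteq> elems B" and iso: "pmat_iso (contraction B T) C"
    and ker: "\<And>x. x \<in> ground B \<Longrightarrow> p x = point C \<longleftrightarrow> x \<in> insert (point B) T"
    using adm_epiD by metis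
  have sq: "strong_map A zero_pmat q" "strong_map zero_pmat C z" "compose (ground A) p i = compose (ground A) z q"
    using cart by (auto simp: cartesian_def commutative_square_def)
  have z0: "z 0 = point C" using sq(2) by (simp add: strong_map_def zero_pmat_def)
  have nS: "point B \<notin> S" "point B \<notin> T" using S T by (auto simp: elems_def)
  have gB: "S \<subseteq> ground B" "T \<subseteq> ground B" using S T by (auto simp: elems_def)
  have "S \<subseteq> T"
  proof
    fix y assume y: "y \<in> S"
    then obtain x where x: "x \<in> ground A" "y = i x" using im by blast
    have "q x = 0" using sq(1) x by (auto simp: strong_map_def zero_pmat_def)
    then have "p y = point C" using fun_cong[OF sq(3), of x] x z0 by (simp add: compose_def)
    then show "y \<in> T" using ker[of y] y nS gB by auto
  qed
  moreover have "T \<subseteq> S"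
  proof
    fix y assume y: "y \<in> T"
    let ?P = "restriction B T" and ?u = "\<lambda>x\<in>insert (point B) T. x"
    have P: "pmatroid ?P" using pmatroid_restriction[OF B T] .
    have "compose (ground ?P) p ?u = compose (ground ?P) z (\<lambda>x\<in>ground ?P. 0)"
      using ker gB pmatroid_point[OF B] z0 by (intro ext) (auto simp: compose_def)
    then obtain w where w: "strong_map ?P A w" "compose (ground ?P) i w = ?u"
      using cart P strong_map_restriction[OF B T] strong_map_to_zero[OF P]
      unfolding cartesian_def by blast
    have "i (w y) = y" using fun_cong[OF w(2), of y] y by (simp add: compose_def)
    moreover have "w y \<in> ground A" using w(1) y by (auto simp: strong_map_def)
    ultimately have "y \<in> insert (point B) S" unfolding im[symmetric] by (metis imageI)
    then show "y \<in> S" using y nS by auto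
  qed
  ultimately show ?thesis using iso by simp
qed

text \<open>Every generating relation of \<open>K0\<close> is thereby one between minors, along
  which the number of elements is additive.\<close>

lemma adm_ses_minors:
  assumes ses: "adm_ses A i B p C"
  obtains S where "S \<subseteq> elems B" "iso_class A = iso_class (restriction B S)"
    "iso_class C = iso_class (contraction B S)" "pmatroid B"
proof -
  from ses have i: "adm_mono A B i" and p: "adm_epi B C p" unfolding adm_ses_def by blast+
  then have P: "pmatroid A" "pmatroid B" "pmatroid C" by (simp_all add: adm_mono_def adm_epi_def)
  obtain S where S: "S \<subseteq> elems B" "iso_map A (restriction B S) i" "i ` ground A = insert (point B) S"
    using adm_monoD[OF i] .
  have "pmat_iso A (restriction B S)" using S(2) unfolding pmat_iso_def by blast
  then have "iso_class A = iso_class (restriction B S)"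
    using iso_class_eq_iff P pmatroid_restriction[OF P(2) S(1)] by blast
  moreover have "iso_class C = iso_class (contraction B S)"
    using adm_ses_quotient[OF ses S(1,3)] iso_class_eq_iff[OF pmatroid_contraction[OF P(2) S(1)] P(3)] by simp
  ultimately show ?thesis using that S(1) P(2) by blast
qed

section \<open>Admissible subobjects\<close>

text \<open>Admissible monomorphisms into \<open>B\<close> are isomorphic exactly when their images
  agree, so a subobject can be named by its image without the base point.\<close>

definition subset_subobject :: "nat pmat \<Rightarrow> nat set \<Rightarrow> (nat pmat \<times> (nat \<Rightarrow> nat)) set" where
  "subset_subobject B S = {(A, i). adm_mono A B i \<and> i ` ground A = insert (point B) S}"

lemma subobject_rel_iff:
  "((A, i), (A', j)) \<in> subobject_rel B \<longleftrightarrow>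
    adm_mono A B i \<and> adm_mono A' B j \<and> i ` ground A = j ` ground A'"
proof
  assume "((A, i), (A', j)) \<in> subobject_rel B"
  then obtain f where f: "adm_mono A B i" "adm_mono A' B j" "iso_map A A' f" "i = compose (ground A) j f"
    by (auto simp: subobject_rel_def)
  have "pmatroid A" "pmatroid A'" using f by (simp_all add: adm_mono_def)
  then have "ground A' = f ` ground A" using iso_map_imp_relabel(2)[OF _ _ f(3)] by simp
  then show "adm_mono A B i \<and> adm_mono A' B j \<and> i ` ground A = j ` ground A'"
    using f by (auto simp: compose_def image_image)
next
  assume *: "adm_mono A B i \<and> adm_mono A' B j \<and> i ` ground A = j ` ground A'"
  then have P: "pmatroid A" "pmatroid A'" "pmatroid B" by (simp_all add: adm_mono_def)
  obtain S where S: "S \<subseteq> elems B" "iso_map A (restriction B S) i" "i ` ground A = insert (point B) S"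
    using * adm_monoD by metis
  obtain T where T: "T \<subseteq> elems B" "iso_map A' (restriction B T) j" "j ` ground A' = insert (point B) T"
    using * adm_monoD by metis
  have "S = T" using S T * by (auto simp: elems_def)
  note R = iso_map_imp_relabel[OF P(1) pmatroid_restriction[OF P(3) S(1)] S(2)]
  note R' = iso_map_imp_relabel[OF P(2) pmatroid_restriction[OF P(3) T(1)] T(2)]
  \<comment> \<open>Both maps are isomorphisms onto the same restriction of \<open>B\<close>, so
    \<open>i\<close> followed by the inverse of \<open>j\<close> identifies \<open>A\<close> with
    \<open>A'\<close>.\<close>
  let ?g = "inv_into (ground A') j" and ?f = "inv_into (ground A') j \<circ> i"
  have im: "i ` ground A = j ` ground A'" using * by blast
  have "inj_on ?g (i ` ground A)" unfolding im by (rule inj_on_inv_into) auto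
  then have inj: "inj_on ?f (ground A)" using R(1) by (rule comp_inj_on[rotated])
  have "relabel ?f A = relabel ?g (relabel j A')"
    unfolding relabel_relabel[symmetric] using R(2) R'(2) \<open>S = T\<close> by simp
  also have "\<dots> = A'"
    unfolding relabel_relabel using R'(1) by (intro relabel_id[OF P(2)]) simp
  finally have "iso_map A A' (restrict ?f (ground A))" using relabel_iso_map[OF P(1) inj] by simp
  moreover have "i = compose (ground A) j (restrict ?f (ground A))"
  proof
    fix x
    have "i \<in> extensional (ground A)" using * by (auto simp: adm_mono_def strong_map_def)
    moreover have "j (inv_into (ground A') j (i x)) = i x" if "x \<in> ground A"
      using that im by (intro f_inv_into_f) blast
    ultimately show "i x = compose (ground A) j (restrict ?f (ground A)) x"
      by (auto simp: compose_def extensional_def)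
  qed
  ultimately show "((A, i), (A', j)) \<in> subobject_rel B"
    using * unfolding subobject_rel_def by blast
qed

lemma restriction_in_subset_subobject:
  "pmatroid B \<Longrightarrow> S \<subseteq> elems B \<Longrightarrow> (restriction B S, \<lambda>x\<in>insert (point B) S. x) \<in> subset_subobject B S"
  using adm_mono_restriction[of B S] by (auto simp: subset_subobject_def)

lemma bij_subset_subobject:
  assumes B: "pmatroid B"
  shows "bij_betw (subset_subobject B) (Pow (elems B)) (adm_subobjects B)"
proof -
  have cls: "subobject_rel B `` {(A, i)} = subset_subobject B S"
    if "adm_mono A B i" "i ` ground A = insert (point B) S" for A i S
  proof (rule set_eqI)
    fix x show "x \<in> subobject_rel B `` {(A, i)} \<longleftrightarrow> x \<in> subset_subobject B S"
      using that by (cases x) (simp add: subobject_rel_iff subset_subobject_def, blast)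
  qed
  have "inj_on (subset_subobject B) (Pow (elems B))"
  proof (rule inj_onI)
    fix S T assume S: "S \<in> Pow (elems B)" and T: "T \<in> Pow (elems B)"
      and eq: "subset_subobject B S = subset_subobject B T"
    have "(restriction B S, \<lambda>x\<in>insert (point B) S. x) \<in> subset_subobject B T"
      using restriction_in_subset_subobject[OF B] S unfolding eq[symmetric] by simp
    then have "insert (point B) S = insert (point B) T" by (auto simp: subset_subobject_def)
    then show "S = T" using S T by (auto simp: elems_def)
  qed
  moreover have "subset_subobject B ` Pow (elems B) = adm_subobjects B"
  proof
    show "subset_subobject B ` Pow (elems B) \<subseteq> adm_subobjects B"
    proof clarify
      fix S assume S: "S \<subseteq> elems B"
      have "subset_subobject B S = subobject_rel B `` {(restriction B S, \<lambda>x\<in>insert (point B) S. x)}"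
        using cls[OF adm_mono_restriction[OF B S], of S] by auto
      then show "subset_subobject B S \<in> adm_subobjects B"
        unfolding adm_subobjects_def quotient_def using adm_mono_restriction[OF B S] by auto
    qed
    show "adm_subobjects B \<subseteq> subset_subobject B ` Pow (elems B)"
    proof
      fix T assume "T \<in> adm_subobjects B"
      then obtain A i where i: "adm_mono A B i" "T = subobject_rel B `` {(A, i)}"
        unfolding adm_subobjects_def quotient_def by auto
      obtain S where S: "S \<subseteq> elems B" "i ` ground A = insert (point B) S" using adm_monoD[OF i(1)] by metis
      then show "T \<in> subset_subobject B ` Pow (elems B)" using cls[OF i(1) S(2)] i(2) by blast
    qed
  qed
  ultimately show ?thesis by (simp add: bij_betw_def)
qed

lemma sub_class_subset_subobject:
  assumes B: "pmatroid B" and S: "S \<subseteq> elems B"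
  shows "sub_class (subset_subobject B S) = iso_class (restriction B S)"
  unfolding sub_class_def
proof (rule the_equality)
  show "\<exists>A i. (A, i) \<in> subset_subobject B S \<and> iso_class (restriction B S) = iso_class A"
    using restriction_in_subset_subobject[OF B S] by blast
  fix X assume "\<exists>A i. (A, i) \<in> subset_subobject B S \<and> X = iso_class A"
  then obtain A i where i: "adm_mono A B i" "i ` ground A = insert (point B) S" "X = iso_class A"
    by (auto simp: subset_subobject_def)
  obtain T where T: "T \<subseteq> elems B" "iso_map A (restriction B T) i" "i ` ground A = insert (point B) T"
    using adm_monoD[OF i(1)] .
  have "T = S" using T S i by (auto simp: elems_def)
  then have "pmat_iso A (restriction B S)" using T(2) unfolding pmat_iso_def by blast
  moreover have "pmatroid A" using i(1) by (simp add: adm_mono_def)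
  ultimately show "X = iso_class (restriction B S)"
    unfolding i(3) using iso_class_eq_iff pmatroid_restriction[OF B S] by blast
qed

text \<open>The description in \<open>quot_class\<close> is proper because the image of
  \<open>i\<close> alone fixes the contracted set, by \<open>adm_ses_quotient\<close>; existence is
  the sequence of \<open>adm_ses_minor\<close>.\<close>

lemma quot_class_subset_subobject:
  assumes B: "pmatroid B" and S: "S \<subseteq> elems B"
  shows "quot_class B (subset_subobject B S) = iso_class (contraction B S)"
  unfolding quot_class_def
proof (rule the_equality)
  show "\<exists>A i p C. (A, i) \<in> subset_subobject B S \<and> adm_ses A i B p C \<and> iso_class (contraction B S) = iso_class C"
    using restriction_in_subset_subobject[OF B S] adm_ses_minor[OF B S] by blast
  fix X assume "\<exists>A i p C. (A, i) \<in> subset_subobject B S \<and> adm_ses A i B p C \<and> X = iso_class C"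
  then obtain A i p C where i: "i ` ground A = insert (point B) S" "adm_ses A i B p C" "X = iso_class C"
    by (auto simp: subset_subobject_def)
  have "pmatroid C" using i(2) by (auto simp: adm_ses_def adm_epi_def)
  then show "X = iso_class (contraction B S)"
    using adm_ses_quotient[OF i(2) S i(1)] iso_class_eq_iff[OF pmatroid_contraction[OF B S]] i(3) by metis
qed

lemma sum_adm_subobjects:
  "(\<Sum>T\<in>adm_subobjects (rep_mat_iso X). F (quot_class (rep_mat_iso X) T) (sub_class T)) =
    minor_sum X (\<lambda>A B. F B A)"
  unfolding minor_sum_def sum.reindex_bij_betw[OF bij_subset_subobject[OF pmatroid_rep], symmetric]
  by (intro sum.cong HOL.refl)
    (simp add: sub_class_subset_subobject[OF pmatroid_rep] quot_class_subset_subobject[OF pmatroid_rep])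

section \<open>The Grothendieck group\<close>

lemma K0_class_minors: "(A, B) \<in> minors X \<Longrightarrow> K0_class X = K0_class A + K0_class B"
proof -
  assume "(A, B) \<in> minors X"
  then obtain S where S: "S \<subseteq> elems (rep_mat_iso X)" "A = iso_class (restriction (rep_mat_iso X) S)"
    "B = iso_class (contraction (rep_mat_iso X) S)"
    unfolding minors_def by auto
  have "K0_rel [(True, X)] ([(True, A)] @ [(True, B)])"
    using K0_rel.ses[OF adm_ses_minor[OF pmatroid_rep S(1)]] S by simp
  then show ?thesis
    unfolding K0_class_def plus_K0.abs_eq by (simp add: K0.abs_eq_iff)
qed

lemma K0_class_sum: "K0_class (class_sum X Y) = K0_class X + K0_class Y"
  using K0_class_minors[OF minors_class_sum] .

text \<open>The presentation imposes no commutativity; it comes from reading one direct sum as an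
  extension in both orders. The Hall product, whose first factor sees the quotient, needs it to
  respect degrees.\<close>

lemma K0_class_commute: "K0_class X + K0_class Y = K0_class Y + K0_class X"
  using K0_class_sum class_sum_commute by metis

text \<open>The zero class is its own double, and a group has only one idempotent.\<close>

lemma K0_class_zero: "K0_class class_zero = 0"
  using K0_class_sum[of class_zero class_zero] add_left_cancel[of "K0_class class_zero" "K0_class class_zero" 0] by simp

text \<open>The element count as a homomorphism on words, with formal inverses counted negatively so
  that cancellation is respected. It keeps nonzero objects out of degree zero.\<close>

definition word_size :: "(bool \<times> mat_iso) list \<Rightarrow> int" where
  "word_size w = (\<Sum>(b, X)\<leftarrow>w. if b then int (class_size X) else - int (class_size X))"

lemma K0_rel_word_size: "K0_rel u v \<Longrightarrow> word_size u = word_size v"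
proof (induction rule: K0_rel.induct)
  case (ses A i B p C)
  obtain S where S: "S \<subseteq> elems B" "iso_class A = iso_class (restriction B S)"
    "iso_class C = iso_class (contraction B S)" "pmatroid B"
    using adm_ses_minors[OF ses] .
  then have "(iso_class A, iso_class C) \<in> minors (iso_class B)" using minors_iso_class by metis
  then show ?case using minors_size by (fastforce simp: word_size_def)
qed (auto simp: word_size_def)

lemma K0_class_eq_0_iff: "K0_class X = 0 \<longleftrightarrow> X = class_zero"
proof
  assume "K0_class X = 0"
  then have "K0_rel [(True, X)] []" unfolding K0_class_def zero_K0_def by (simp add: K0.abs_eq_iff)
  from K0_rel_word_size[OF this] show "X = class_zero" by (simp add: word_size_def class_size_0_iff)
qed (simp add: K0_class_zero)


section \<open>Linear algebra of finitely supported functions\<close>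

interpretation pm: vector_space "pscale :: 'k::field \<Rightarrow> ('x \<Rightarrow>\<^sub>0 'k) \<Rightarrow> ('x \<Rightarrow>\<^sub>0 'k)"
  by (rule vector_space_pscale)

lemma vector_space_times: "vector_space ((*) :: 'k::field \<Rightarrow> 'k \<Rightarrow> 'k)"
  by unfold_locales (simp_all add: algebra_simps)

lemma lookup_delta: "lookup (delta x) y = (if x = y then 1 else 0)"
  by (simp add: lookup_single when_def)

lemma linear_pscaleI:
  fixes L :: "('x \<Rightarrow>\<^sub>0 'k::field) \<Rightarrow> ('y \<Rightarrow>\<^sub>0 'k)"
  assumes "\<And>f g. L (f + g) = L f + L g" "\<And>c f. L (pscale c f) = pscale c (L f)"
  shows "Vector_Spaces.linear pscale pscale L"
  unfolding Vector_Spaces.linear_iff by (intro conjI allI vector_space_pscale assms)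

lemma linear_functionalI:
  assumes "\<And>f g. L (f + g) = L f + L g" "\<And>c f. L (pscale c f) = c * L f"
  shows "Vector_Spaces.linear pscale (*) L"
  using assms vector_space_pscale vector_space_times unfolding Vector_Spaces.linear_iff by blast

lemma linearD:
  assumes "Vector_Spaces.linear s t L"
  shows "L (f + g) = L f + L g" "L (s c f) = t c (L f)"
  using assms unfolding Vector_Spaces.linear_iff by auto

lemma sum_pscale_delta: "(\<Sum>x\<in>keys f. pscale (lookup f x) (delta x)) = f"
proof (rule poly_mapping_eqI)
  fix y
  have "(\<Sum>x\<in>keys f. lookup f x * (if x = y then 1 else 0)) = lookup f y"
    by (simp add: if_distrib in_keys_iff cong: if_cong)
  then show "lookup (\<Sum>x\<in>keys f. pscale (lookup f x) (delta x)) y = lookup f y"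
    by (simp add: lookup_sum lookup_delta)
qed

lemma linear_sum:
  assumes L: "Vector_Spaces.linear pscale t L"
  shows "L (\<Sum>x\<in>A. pscale (c x) (g x)) = (\<Sum>x\<in>A. t (c x) (L (g x)))"
proof -
  have "L 0 = 0" using linearD(1)[OF L, of 0 0] by (metis L Vector_Spaces.linear.axioms(3) module_hom.zero)
  then show ?thesis
    by (induction A rule: infinite_finite_induct) (simp_all add: linearD[OF L])
qed

lemma linear_expand:
  assumes L: "Vector_Spaces.linear pscale t L"
  shows "L f = (\<Sum>x\<in>keys f. t (lookup f x) (L (delta x)))"
  using linear_sum[OF L, of "lookup f" delta "keys f"] by (simp add: sum_pscale_delta)

lemma linear_eqI:
  assumes L: "Vector_Spaces.linear pscale t L" and K: "Vector_Spaces.linear pscale t K"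
    and eq: "\<And>x. L (delta x) = K (delta x)"
  shows "L f = K f"
  unfolding linear_expand[OF L, of f] linear_expand[OF K, of f] eq ..

lemma lookup_lin_ext: "lookup (lin_ext \<phi> t) y = (\<Sum>x\<in>keys t. lookup t x * lookup (\<phi> x) y)"
  by (simp add: lin_ext_def lookup_sum)

lemma lin_ext_superset:
  assumes "finite A" "keys t \<subseteq> A"
  shows "lin_ext \<phi> t = (\<Sum>x\<in>A. pscale (lookup t x) (\<phi> x))"
  unfolding lin_ext_def using assms
  by (intro sum.mono_neutral_left) (auto simp: in_keys_iff)

lemma linear_lin_ext:
  fixes \<phi> :: "'x \<Rightarrow> ('y \<Rightarrow>\<^sub>0 'k::field)"
  shows "Vector_Spaces.linear pscale pscale (lin_ext \<phi>)"
proof (rule linear_pscaleI)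
  fix f g :: "'x \<Rightarrow>\<^sub>0 'k"
  let ?A = "keys f \<union> keys g"
  have "keys (f + g) \<subseteq> ?A" "keys f \<subseteq> ?A" "keys g \<subseteq> ?A" "finite ?A" using keys_add[of f g] by auto
  then show "lin_ext \<phi> (f + g) = lin_ext \<phi> f + lin_ext \<phi> g"
    by (simp add: lin_ext_superset[of ?A] lookup_add pm.scale_left_distrib sum.distrib del: finite_Un)
next
  fix c and f :: "'x \<Rightarrow>\<^sub>0 'k"
  have "keys (pscale c f) \<subseteq> keys f" by (auto simp: in_keys_iff)
  then show "lin_ext \<phi> (pscale c f) = pscale c (lin_ext \<phi> f)"
    using lin_ext_superset[of "keys f" "pscale c f" \<phi>]
    by (simp add: lin_ext_def[of \<phi> f] pm.scale_sum_right)
qed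

lemma lin_ext_delta [simp]: "lin_ext \<phi> (delta x) = \<phi> x"
  by (simp add: lin_ext_def)

lemma linear_compose:
  assumes "Vector_Spaces.linear r s L" "Vector_Spaces.linear s t K"
  shows "Vector_Spaces.linear r t (\<lambda>f. K (L f))"
  using assms unfolding Vector_Spaces.linear_iff by auto

lemma sum_keys_if:
  fixes t :: "'x \<Rightarrow>\<^sub>0 'k::field"
  shows "(\<Sum>x\<in>keys t. lookup t x * (if x = a then c else 0)) = lookup t a * c"
proof -
  have "(\<Sum>x\<in>keys t. lookup t x * (if x = a then c else 0)) = (\<Sum>x\<in>keys t. if x = a then lookup t x * c else 0)"
    by (intro sum.cong HOL.refl) auto
  then show ?thesis by (simp add: in_keys_iff)
qed

lemma lookup_tensor: "lookup (tensor f g) (x, y) = lookup f x * lookup g y"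
proof -
  have "lookup (tensor f g) (x, y) =
    (\<Sum>a\<in>keys f. \<Sum>b\<in>keys g. if a = x then if b = y then lookup f a * lookup g b else 0 else 0)"
    unfolding tensor_def lookup_sum lookup_single when_def by (intro sum.cong HOL.refl) auto
  also have "\<dots> = (\<Sum>a\<in>keys f. if a = x then (\<Sum>b\<in>keys g. if b = y then lookup f a * lookup g b else 0) else 0)"
    by (intro sum.cong HOL.refl) auto
  also have "\<dots> = lookup f x * lookup g y"
    by (simp add: in_keys_iff)
  finally show ?thesis .
qed

lemma tensor_delta: "tensor (delta x) (delta y) = delta (x, y)"
proof (rule poly_mapping_eqI)
  fix p show "lookup (tensor (delta x) (delta y)) p = lookup (delta (x, y)) p"
    by (cases p) (simp add: lookup_tensor lookup_delta)
qed

lemma lookup_tensor_map: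
  "lookup (tensor_map \<phi> \<psi> t) (u, v) =
    (\<Sum>p\<in>keys t. lookup t p * (lookup (\<phi> (delta (fst p))) u * lookup (\<psi> (delta (snd p))) v))"
  by (simp add: tensor_map_def lookup_lin_ext case_prod_beta lookup_tensor)

text \<open>Only \<open>delta a\<close> contributes to the coefficient at \<open>u\<close> and only
  \<open>delta b\<close> to the one at \<open>v\<close>, so the tensor map merely relabels
  coefficients. This covers maps that transpose an operation on classes: \<open>sum_comul\<close>,
  with \<open>a\<close> or \<open>b\<close> a class sum, and the pullback along
  \<open>class_dual\<close>.\<close>

lemma lookup_tensor_map_delta:
  assumes "\<And>x. lookup (\<phi> (delta x)) u = (if x = a then 1 else 0)"
    "\<And>y. lookup (\<psi> (delta y)) v = (if y = b then 1 else 0)"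
  shows "lookup (tensor_map \<phi> \<psi> t) (u, v) = lookup t (a, b)"
proof -
  have "lookup (tensor_map \<phi> \<psi> t) (u, v) = (\<Sum>p\<in>keys t. lookup t p * (if p = (a, b) then 1 else 0))"
    unfolding lookup_tensor_map assms by (intro sum.cong HOL.refl) (auto simp: prod_eq_iff)
  then show ?thesis by (simp only: sum_keys_if mult_1_right)
qed

section \<open>The coordinate pairing of finitely supported functions\<close>

text \<open>The formula of \<open>eval_pairing\<close> on an arbitrary index type, so that tensors,
  indexed by pairs of classes, are paired by the same function.\<close>

definition dot :: "('x \<Rightarrow>\<^sub>0 'k::field) \<Rightarrow> ('x \<Rightarrow>\<^sub>0 'k) \<Rightarrow> 'k" where
  "dot f v = (\<Sum>x\<in>keys v. lookup f x * lookup v x)"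

lemma dot_superset:
  assumes "finite A" "keys v \<subseteq> A"
  shows "dot f v = (\<Sum>x\<in>A. lookup f x * lookup v x)"
  unfolding dot_def using assms by (intro sum.mono_neutral_left) (auto simp: in_keys_iff)

lemma linear_dot_left: "Vector_Spaces.linear pscale (*) (\<lambda>f. dot f v)"
  by (rule linear_functionalI) (simp_all add: dot_def lookup_add algebra_simps sum.distrib sum_distrib_left)

lemma linear_dot:
  fixes f :: "'x \<Rightarrow>\<^sub>0 'k::field"
  shows "Vector_Spaces.linear pscale (*) (dot f)"
proof (rule linear_functionalI)
  fix u v :: "'x \<Rightarrow>\<^sub>0 'k"
  let ?A = "keys u \<union> keys v"
  have "keys (u + v) \<subseteq> ?A" "keys u \<subseteq> ?A" "keys v \<subseteq> ?A" "finite ?A" using keys_add[of u v] by auto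
  then show "dot f (u + v) = dot f u + dot f v"
    by (simp add: dot_superset[of ?A] lookup_add algebra_simps sum.distrib del: finite_Un)
next
  fix c and u :: "'x \<Rightarrow>\<^sub>0 'k"
  have "keys (pscale c u) \<subseteq> keys u" by (auto simp: in_keys_iff)
  then show "dot f (pscale c u) = c * dot f u"
    using dot_superset[of "keys u" "pscale c u" f]
    by (simp add: dot_def[of f u] sum_distrib_left mult.left_commute)
qed

lemma dot_delta [simp]: "dot f (delta x) = lookup f x"
  by (simp add: dot_def)

lemma dot_sum_delta: "dot f (\<Sum>x\<in>A. delta (p x)) = (\<Sum>x\<in>A. lookup f (p x))"
  using linear_sum[OF linear_dot, of f "\<lambda>_. 1" "\<lambda>x. delta (p x)" A] by simp

lemma dot_lin_ext: "dot f (lin_ext \<phi> t) = (\<Sum>x\<in>keys t. lookup t x * dot f (\<phi> x))"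
  unfolding lin_ext_def linear_sum[OF linear_dot] ..

text \<open>A product of two Kronecker deltas is the Kronecker delta on pairs, so dual bases stay
  dual after tensoring.\<close>

lemma pairing_tensor_dot:
  assumes "\<And>x y. B (delta x) (delta y) = (if y = x then 1 else 0)"
  shows "pairing_tensor B s t = dot s t"
proof -
  have "pairing_tensor B s t = (\<Sum>p\<in>keys s. \<Sum>q\<in>keys t. lookup s p * lookup t q * (if q = p then 1 else 0))"
    unfolding pairing_tensor_def assms case_prod_beta by (intro sum.cong HOL.refl) (auto simp: prod_eq_iff)
  also have "\<dots> = (\<Sum>q\<in>keys t. lookup t q * (\<Sum>p\<in>keys s. lookup s p * (if p = q then 1 else 0)))"
    by (subst sum.swap) (auto simp: sum_distrib_left intro!: sum.cong)
  also have "\<dots> = dot s t"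
    unfolding sum_keys_if by (simp add: dot_def mult.commute)
  finally show ?thesis .
qed

section \<open>Gradings by a degree function on the basis\<close>

lemma span_delta:
  fixes P :: "'x \<Rightarrow> bool"
  shows "pm.span {delta x | x. P x} = {f :: 'x \<Rightarrow>\<^sub>0 'k::field. \<forall>x\<in>keys f. P x}"
proof
  have "pm.subspace {f :: 'x \<Rightarrow>\<^sub>0 'k. \<forall>x\<in>keys f. P x}"
    unfolding pm.subspace_def by (auto simp: in_keys_iff lookup_add)
  then show "pm.span {delta x | x. P x} \<subseteq> {f :: 'x \<Rightarrow>\<^sub>0 'k. \<forall>x\<in>keys f. P x}"
    by (intro pm.span_minimal) auto
  show "{f :: 'x \<Rightarrow>\<^sub>0 'k. \<forall>x\<in>keys f. P x} \<subseteq> pm.span {delta x | x. P x}"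
  proof
    fix f :: "'x \<Rightarrow>\<^sub>0 'k" assume "f \<in> {f. \<forall>x\<in>keys f. P x}"
    then have "(\<Sum>x\<in>keys f. pscale (lookup f x) (delta x)) \<in> pm.span {delta x | x. P x}"
      by (intro pm.span_sum pm.span_scale pm.span_base) auto
    then show "f \<in> pm.span {delta x | x. P x}" by (simp only: sum_pscale_delta)
  qed
qed

lemma graded_space_span_delta:
  fixes d :: "'x \<Rightarrow> 'g"
  assumes d: "\<And>x. d x \<in> G"
  shows "graded_space G (\<lambda>\<gamma>. pm.span {delta x :: 'x \<Rightarrow>\<^sub>0 'k::field | x. d x = \<gamma>})"
  unfolding graded_space_def
proof (intro conjI ballI allI)
  fix v :: "'x \<Rightarrow>\<^sub>0 'k"
  let ?W = "\<lambda>\<gamma>. pm.span {delta x :: 'x \<Rightarrow>\<^sub>0 'k | x. d x = \<gamma>}"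
  \<comment> \<open>The homogeneous component is \<open>v\<close> cut down to a fibre of
    \<open>d\<close>. Only the finitely many degrees met by the support of \<open>v\<close> give a
    nonzero part, so the parts form a finitely supported family.\<close>
  define part where "part \<gamma> = Abs_poly_mapping (\<lambda>x. if d x = \<gamma> then lookup v x else 0)" for \<gamma>
  have part: "lookup (part \<gamma>) x = (if d x = \<gamma> then lookup v x else 0)" for \<gamma> x
  proof -
    have "finite {x. (if d x = \<gamma> then lookup v x else 0) \<noteq> 0}"
      by (rule finite_subset[OF _ finite_lookup[of v]]) auto
    then show ?thesis by (simp add: part_def)
  qed
  have fin: "finite {\<gamma>. part \<gamma> \<noteq> 0}"
  proof (rule finite_subset)
    show "{\<gamma>. part \<gamma> \<noteq> 0} \<subseteq> d ` keys v"
    proof clarify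
      fix \<gamma> assume "part \<gamma> \<noteq> 0"
      then obtain x where "lookup (part \<gamma>) x \<noteq> 0" by (metis poly_mapping_eqI lookup_zero)
      then show "\<gamma> \<in> d ` keys v" by (auto simp: part in_keys_iff split: if_splits)
    qed
  qed simp
  define c where "c = Abs_poly_mapping part"
  have c: "lookup c = part" using fin by (simp add: c_def)
  show "\<exists>!c. keys c \<subseteq> G \<and> (\<forall>\<gamma>\<in>G. lookup c \<gamma> \<in> ?W \<gamma>) \<and> v = (\<Sum>\<gamma>\<in>keys c. lookup c \<gamma>)"
  proof (intro ex1I conjI ballI)
    show "keys c \<subseteq> G"
    proof
      fix \<gamma> assume "\<gamma> \<in> keys c"
      then have "part \<gamma> \<noteq> 0" by (simp add: in_keys_iff c)
      then obtain x where "lookup (part \<gamma>) x \<noteq> 0" by (metis poly_mapping_eqI lookup_zero)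
      then show "\<gamma> \<in> G" using d by (auto simp: part split: if_splits)
    qed
    show "lookup c \<gamma> \<in> ?W \<gamma>" for \<gamma>
      unfolding span_delta c by (auto simp: in_keys_iff part split: if_splits)
    show "v = (\<Sum>\<gamma>\<in>keys c. lookup c \<gamma>)"
    proof (rule poly_mapping_eqI)
      fix x
      have "lookup v x = 0" if "d x \<notin> keys c"
        using that part[of "d x" x] by (simp add: in_keys_iff c)
      then show "lookup v x = lookup (\<Sum>\<gamma>\<in>keys c. lookup c \<gamma>) x"
        unfolding lookup_sum c part by simp
    qed
    fix e assume e: "keys e \<subseteq> G \<and> (\<forall>\<gamma>\<in>G. lookup e \<gamma> \<in> ?W \<gamma>) \<and> v = (\<Sum>\<gamma>\<in>keys e. lookup e \<gamma>)"
    \<comment> \<open>A component of degree \<open>\<gamma>\<close> is supported where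
      \<open>d\<close> equals \<open>\<gamma>\<close>, so at \<open>x\<close> only the component of
      degree \<open>d x\<close> contributes; this gives uniqueness.\<close>
    have z: "lookup (lookup e \<gamma>) x = 0" if "\<gamma> \<noteq> d x" for \<gamma> x
    proof (cases "\<gamma> \<in> keys e")
      case True
      then have "lookup e \<gamma> \<in> ?W \<gamma>" using e by blast
      then show ?thesis using that unfolding span_delta by (auto simp: in_keys_iff)
    qed (simp add: in_keys_iff)
    have "lookup v x = lookup (lookup e (d x)) x" for x
    proof -
      have "lookup v x = (\<Sum>\<gamma>\<in>keys e. lookup (lookup e \<gamma>) x)" using e by (simp add: lookup_sum)
      also have "\<dots> = (\<Sum>\<gamma>\<in>keys e. if \<gamma> = d x then lookup (lookup e \<gamma>) x else 0)"
        using z by (intro sum.cong HOL.refl) auto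
      finally show ?thesis by (simp add: in_keys_iff)
    qed
    then show "e = c"
      using z by (intro poly_mapping_eqI) (auto simp: c part)
  qed
qed (rule pm.subspace_span)


section \<open>The structure maps\<close>

lemma sum_minor_sum:
  "(\<Sum>i\<in>I. minor_sum X (\<lambda>A B. F i A B)) = minor_sum X (\<lambda>A B. \<Sum>i\<in>I. F i A B)"
  unfolding minor_sum_def by (rule sum.swap)

lemma minor_sum_add: "minor_sum X (\<lambda>A B. F A B + G A B) = minor_sum X F + minor_sum X G"
  by (simp add: minor_sum_def sum.distrib)

lemma minor_sum_mult_left: "(c :: 'k::field) * minor_sum X F = minor_sum X (\<lambda>A B. c * F A B)"
  by (simp add: minor_sum_def sum_distrib_left)

lemma minor_sum_mult_right: "minor_sum X F * (c :: 'k::field) = minor_sum X (\<lambda>A B. F A B * c)"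
  by (simp add: minor_sum_def sum_distrib_right)

lemma minor_sum_times:
  "minor_sum X F * (minor_sum Y G :: 'k::field) = minor_sum X (\<lambda>A B. minor_sum Y (\<lambda>C D. F A B * G C D))"
  by (subst minor_sum_mult_right) (intro minor_sum_cong minor_sum_mult_left)

lemma lookup_sum_comul: "lookup (sum_comul f) (X, Y) = lookup f (class_sum X Y)"
proof -
  \<comment> \<open>A nonzero value at \<open>(X, Y)\<close> means that \<open>X\<close> and
    \<open>Y\<close> split a class in the support of \<open>f\<close>.\<close>
  have "finite (\<Union>Z\<in>keys f. splits Z)" by (simp add: finite_splits)
  then have "finite {p. (case p of (X, Y) \<Rightarrow> lookup f (class_sum X Y)) \<noteq> 0}"
    by (rule finite_subset[rotated]) (auto simp: in_keys_iff splits_def)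
  then show ?thesis by (simp add: sum_comul_def)
qed

text \<open>A nonzero value at \<open>X\<close> needs a pair of minors in the supports of
  \<open>f\<close> and \<open>g\<close>, which leaves finitely many sizes for \<open>X\<close>. So
  the function under \<open>Abs_poly_mapping\<close> has finite support; both products are read off
  from this, the Hall product with its factors exchanged.\<close>

lemma lookup_minor_product:
  fixes f g :: "mat_iso \<Rightarrow>\<^sub>0 'k::field"
  shows "lookup (Abs_poly_mapping (\<lambda>X. minor_sum X (\<lambda>A B. lookup f A * lookup g B))) X =
    minor_sum X (\<lambda>A B. lookup f A * lookup g B)"
proof -
  have "finite (\<Union>A\<in>keys f. \<Union>B\<in>keys g. {X. class_size X = class_size A + class_size B})"
    by (simp add: finite_class_size)
  moreover have "{X. minor_sum X (\<lambda>A B. lookup f A * lookup g B) \<noteq> 0} \<subseteq>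
    (\<Union>A\<in>keys f. \<Union>B\<in>keys g. {X. class_size X = class_size A + class_size B})"
  proof
    fix X assume "X \<in> {X. minor_sum X (\<lambda>A B. lookup f A * lookup g B) \<noteq> 0}"
    then have "\<exists>A B. (A, B) \<in> minors X \<and> lookup f A * lookup g B \<noteq> 0"
      using minor_sum_cong[of X "\<lambda>A B. lookup f A * lookup g B" "\<lambda>_ _. 0"] by (auto simp: minor_sum_def)
    then show "X \<in> (\<Union>A\<in>keys f. \<Union>B\<in>keys g. {X. class_size X = class_size A + class_size B})"
      using minors_size by (force simp: in_keys_iff)
  qed
  ultimately show ?thesis by (simp add: finite_subset)
qed

lemma lookup_minor_dual_mul:
  "lookup (minor_dual_mul f g) X = minor_sum X (\<lambda>A B. lookup f A * lookup g B)"
  using lookup_minor_product[of f g X] by (simp add: minor_dual_mul_def minor_sum_def Let_def)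

section \<open>The Hall algebra as a bialgebra\<close>

lemma lookup_hall_mul:
  "lookup (hall_mul f g) X = minor_sum X (\<lambda>A B. lookup f B * lookup g A)"
proof -
  have "hall_mul f g = Abs_poly_mapping (\<lambda>X. minor_sum X (\<lambda>A B. lookup g A * lookup f B))"
    unfolding hall_mul_def Let_def sum_adm_subobjects[of "\<lambda>P Q. lookup f P * lookup g Q"]
    by (simp add: mult.commute)
  then show ?thesis using lookup_minor_product[of g f X] by (simp add: mult.commute)
qed

lemma hall_algebra_sel [simp]:
  "mul hall_algebra = hall_mul" "unity hall_algebra = delta class_zero"
  "comul hall_algebra = sum_comul" "counit hall_algebra = (\<lambda>f. lookup f class_zero)"
  by (simp_all add: hall_algebra_def)

lemma hall_mul_add_left: "hall_mul (f + f') g = hall_mul f g + hall_mul f' g"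
  by (rule poly_mapping_eqI) (simp add: lookup_hall_mul lookup_add minor_sum_add[symmetric] algebra_simps)

lemma hall_mul_add_right: "hall_mul f (g + g') = hall_mul f g + hall_mul f g'"
  by (rule poly_mapping_eqI) (simp add: lookup_hall_mul lookup_add minor_sum_add[symmetric] algebra_simps)

lemma hall_mul_scale_left: "hall_mul (pscale c f) g = pscale c (hall_mul f g)"
  by (rule poly_mapping_eqI) (simp add: lookup_hall_mul minor_sum_mult_left mult.assoc)

lemma hall_mul_scale_right: "hall_mul f (pscale c g) = pscale c (hall_mul f g)"
  by (rule poly_mapping_eqI) (simp add: lookup_hall_mul minor_sum_mult_left mult.left_commute)

lemma linear_hall_mul: "Vector_Spaces.linear pscale pscale (hall_mul f)"
  by (rule linear_pscaleI) (simp_all add: hall_mul_add_right hall_mul_scale_right)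

lemma linear_hall_mul_left: "Vector_Spaces.linear pscale pscale (\<lambda>f. hall_mul f g)"
  by (rule linear_pscaleI) (simp_all add: hall_mul_add_left hall_mul_scale_left)

lemma hall_mul_assoc: "hall_mul (hall_mul f g) h = hall_mul f (hall_mul g h)"
proof (rule poly_mapping_eqI)
  fix X
  show "lookup (hall_mul (hall_mul f g) h) X = lookup (hall_mul f (hall_mul g h)) X"
    \<comment> \<open>The outermost quotient goes to the leftmost factor: \<open>f\<close> sees the
      final quotient, \<open>g\<close> the middle minor and \<open>h\<close> the smallest
      subobject.\<close>
    using minor_sum_coassoc[of X "\<lambda>C D B. lookup f B * lookup g D * lookup h C"]
    by (simp add: lookup_hall_mul minor_sum_mult_left minor_sum_mult_right mult.assoc)
qed

lemma hall_mul_unit_left [simp]: "hall_mul (delta class_zero) f = f"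
proof (rule poly_mapping_eqI)
  fix X
  have "minor_sum X (\<lambda>A B. lookup (delta class_zero) B * lookup f A) =
    minor_sum X (\<lambda>A B. if B = class_zero then lookup f A else 0)"
    by (rule minor_sum_cong) (auto simp: lookup_delta)
  then show "lookup (hall_mul (delta class_zero) f) X = lookup f X"
    by (simp add: lookup_hall_mul minor_sum_zero_right)
qed

lemma hall_mul_unit_right [simp]: "hall_mul f (delta class_zero) = f"
proof (rule poly_mapping_eqI)
  fix X
  have "minor_sum X (\<lambda>A B. lookup f B * lookup (delta class_zero) A) =
    minor_sum X (\<lambda>A B. if A = class_zero then lookup f B else 0)"
    by (rule minor_sum_cong) (auto simp: lookup_delta)
  then show "lookup (hall_mul f (delta class_zero)) X = lookup f X"
    by (simp add: lookup_hall_mul minor_sum_zero_left)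
qed

lemma linear_sum_comul: "Vector_Spaces.linear pscale pscale sum_comul"
proof (rule linear_pscaleI)
  fix f g :: "mat_iso \<Rightarrow>\<^sub>0 'a" and c
  show "sum_comul (f + g) = sum_comul f + sum_comul g"
  proof (rule poly_mapping_eqI)
    fix p show "lookup (sum_comul (f + g)) p = lookup (sum_comul f + sum_comul g) p"
      by (cases p) (simp add: lookup_sum_comul lookup_add)
  qed
  show "sum_comul (pscale c f) = pscale c (sum_comul f)"
  proof (rule poly_mapping_eqI)
    fix p show "lookup (sum_comul (pscale c f)) p = lookup (pscale c (sum_comul f)) p"
      by (cases p) (simp add: lookup_sum_comul)
  qed
qed

lemma keys_sum_comul_delta: "keys (sum_comul (delta X)) = splits X"
proof (rule set_eqI)
  fix p show "p \<in> keys (sum_comul (delta X)) \<longleftrightarrow> p \<in> splits X"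
    by (cases p) (auto simp: in_keys_iff lookup_sum_comul lookup_delta splits_def)
qed

lemma lin_ext_sum_comul_delta:
  fixes \<phi> :: "mat_iso \<times> mat_iso \<Rightarrow> ('x \<Rightarrow>\<^sub>0 'k::field)"
  shows "lin_ext \<phi> (sum_comul (delta X)) = (\<Sum>p\<in>splits X. \<phi> p)"
  unfolding lin_ext_def keys_sum_comul_delta
proof (intro sum.cong HOL.refl)
  fix p assume "p \<in> splits X"
  then have "lookup (sum_comul (delta X)) p = (1 :: 'k)"
    by (cases p) (simp add: lookup_sum_comul lookup_delta splits_def)
  then show "pscale (lookup (sum_comul (delta X)) p) (\<phi> p) = \<phi> p" by simp
qed

lemma algebra_hall: "algebra_axioms hall_algebra"
  unfolding algebra_axioms_def
  by (simp add: linear_hall_mul linear_hall_mul_left hall_mul_assoc)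

lemma linear_counit: "Vector_Spaces.linear pscale (*) (\<lambda>f. lookup f x)"
  by (rule linear_functionalI) (simp_all add: lookup_add)

text \<open>The coproduct is the transpose of the monoid law \<open>class_sum\<close>, and the
  counit that of its neutral element; so the axioms are the monoid axioms read on
  coefficients.\<close>

lemma coalgebra_hall: "coalgebra_axioms (hall_algebra :: (mat_iso, 'k::field) hopf_data)"
  unfolding coalgebra_axioms_def hall_algebra_sel
proof (intro conjI allI linear_sum_comul linear_counit)
  fix f :: "mat_iso \<Rightarrow>\<^sub>0 'k" and x y z
  have "lookup (tensor_map sum_comul id (sum_comul f)) ((x, y), z) = lookup (sum_comul f) (class_sum x y, z)"
    by (rule lookup_tensor_map_delta) (simp_all add: lookup_sum_comul lookup_delta)
  also have "\<dots> = lookup (sum_comul f) (x, class_sum y z)"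
    by (simp add: lookup_sum_comul class_sum_assoc)
  also have "\<dots> = lookup (tensor_map id sum_comul (sum_comul f)) (x, (y, z))"
    by (rule lookup_tensor_map_delta[symmetric]) (simp_all add: lookup_sum_comul lookup_delta)
  finally show "lookup (tensor_map sum_comul id (sum_comul f)) ((x, y), z) =
    lookup (tensor_map id sum_comul (sum_comul f)) (x, (y, z))" .
next
  fix f :: "mat_iso \<Rightarrow>\<^sub>0 'k"
  show "lin_ext (\<lambda>(x, y). pscale (lookup (delta x) class_zero) (delta y)) (sum_comul f) = f"
  proof (rule poly_mapping_eqI)
    fix z
    have "lookup (lin_ext (\<lambda>(x, y). pscale (lookup (delta x) class_zero) (delta y)) (sum_comul f)) z =
      (\<Sum>p\<in>keys (sum_comul f). lookup (sum_comul f) p * (if p = (class_zero, z) then 1 else 0))"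
      unfolding lookup_lin_ext by (intro sum.cong HOL.refl) (auto simp: lookup_delta split: if_splits)
    then show "lookup (lin_ext (\<lambda>(x, y). pscale (lookup (delta x) class_zero) (delta y)) (sum_comul f)) z = lookup f z"
      by (simp only: sum_keys_if) (simp add: lookup_sum_comul)
  qed
  show "lin_ext (\<lambda>(x, y). pscale (lookup (delta y) class_zero) (delta x)) (sum_comul f) = f"
  proof (rule poly_mapping_eqI)
    fix z
    have "lookup (lin_ext (\<lambda>(x, y). pscale (lookup (delta y) class_zero) (delta x)) (sum_comul f)) z =
      (\<Sum>p\<in>keys (sum_comul f). lookup (sum_comul f) p * (if p = (z, class_zero) then 1 else 0))"
      unfolding lookup_lin_ext by (intro sum.cong HOL.refl) (auto simp: lookup_delta split: if_splits)
    then show "lookup (lin_ext (\<lambda>(x, y). pscale (lookup (delta y) class_zero) (delta x)) (sum_comul f)) z = lookup f z"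
      by (simp only: sum_keys_if) (simp add: lookup_sum_comul)
  qed
qed

text \<open>Expanding both factors in basis functions turns the product coefficients into minor sums
  of indicators, which select one coefficient of \<open>s\<close> and one of \<open>t\<close>.
  Quotients go to \<open>s\<close> and subobjects to \<open>t\<close>, the shape that
  \<open>minor_sum_class_sum\<close> produces in the bialgebra axiom.\<close>

lemma lookup_tensor_mul_hall:
  "lookup (tensor_mul hall_algebra s t) (X, Y) =
    minor_sum X (\<lambda>A B. minor_sum Y (\<lambda>C D. lookup s (B, D) * lookup t (A, C)))"
proof -
  have d: "lookup (hall_mul (delta x) (delta u)) X * lookup (hall_mul (delta y) (delta v)) Y =
      minor_sum X (\<lambda>A B. minor_sum Y (\<lambda>C D.
        (if (x, y) = (B, D) then 1 else 0) * (if (u, v) = (A, C) then 1 else 0)))" for x y u v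
    unfolding lookup_hall_mul minor_sum_times
    by (intro minor_sum_cong) (auto simp: lookup_delta)
  have "lookup (tensor_mul hall_algebra s t) (X, Y) =
    (\<Sum>p\<in>keys s. lookup s p * (\<Sum>q\<in>keys t. lookup t q *
      (lookup (hall_mul (delta (fst p)) (delta (fst q))) X * lookup (hall_mul (delta (snd p)) (delta (snd q))) Y)))"
    by (simp add: tensor_mul_def lookup_lin_ext case_prod_beta lookup_tensor)
  also have "\<dots> = minor_sum X (\<lambda>A B. minor_sum Y (\<lambda>C D.
      \<Sum>p\<in>keys s. lookup s p * (\<Sum>q\<in>keys t. lookup t q *
        ((if p = (B, D) then 1 else 0) * (if q = (A, C) then 1 else 0)))))"
    unfolding d prod.collapse minor_sum_mult_left sum_minor_sum ..
  also have "\<dots> = minor_sum X (\<lambda>A B. minor_sum Y (\<lambda>C D.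
      \<Sum>p\<in>keys s. lookup s p * (if p = (B, D) then \<Sum>q\<in>keys t. lookup t q * (if q = (A, C) then 1 else 0) else 0)))"
    by (intro minor_sum_cong sum.cong HOL.refl) auto
  also have "\<dots> = minor_sum X (\<lambda>A B. minor_sum Y (\<lambda>C D. lookup s (B, D) * lookup t (A, C)))"
    unfolding sum_keys_if by simp
  finally show ?thesis .
qed

lemma bialgebra_hall: "bialgebra (hall_algebra :: (mat_iso, 'k::field) hopf_data)"
  unfolding bialgebra_def
proof (intro conjI allI algebra_hall coalgebra_hall)
  fix f g :: "mat_iso \<Rightarrow>\<^sub>0 'k"
  show "comul hall_algebra (mul hall_algebra f g) =
    tensor_mul hall_algebra (comul hall_algebra f) (comul hall_algebra g)"
  proof (rule poly_mapping_eqI)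
    fix p
    show "lookup (comul hall_algebra (mul hall_algebra f g)) p =
      lookup (tensor_mul hall_algebra (comul hall_algebra f) (comul hall_algebra g)) p"
      by (cases p) (simp add: lookup_tensor_mul_hall lookup_sum_comul lookup_hall_mul minor_sum_class_sum)
  qed
  show "counit hall_algebra (mul hall_algebra f g) = counit hall_algebra f * counit hall_algebra g"
    by (simp add: lookup_hall_mul minor_sum_class_zero)
next
  show "comul hall_algebra (unity hall_algebra :: mat_iso \<Rightarrow>\<^sub>0 'k) = tensor (unity hall_algebra) (unity hall_algebra)"
  proof (rule poly_mapping_eqI)
    fix p
    show "lookup (comul hall_algebra (unity hall_algebra :: mat_iso \<Rightarrow>\<^sub>0 'k)) p =
      lookup (tensor (unity hall_algebra) (unity hall_algebra)) p"
      by (cases p) (auto simp: lookup_sum_comul lookup_tensor lookup_delta class_sum_zero_iff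
          eq_commute[of class_zero "class_sum _ _"])
  qed
qed simp

lemma cocommutative_hall: "cocommutative hall_algebra"
  unfolding cocommutative_def by (simp add: lookup_sum_comul class_sum_commute)

section \<open>The antipode\<close>

lemma splits_size:
  assumes "(A, B) \<in> splits X" "B \<noteq> class_zero"
  shows "class_size A < class_size X"
  using assms class_size_sum[of A B] class_size_0_iff[of B] by (auto simp: splits_def)

lemma splits_zero_right: "(A, class_zero) \<in> splits X \<longleftrightarrow> A = X"
  by (simp add: splits_def)

text \<open>The inverse equation on \<open>delta X\<close> is solved for its term at
  \<open>(X, class_zero)\<close>; every other pair has a nonzero second component, hence a smaller
  first one. The product \<open>m\<close> is a parameter because a right inverse arises from the
  flipped product.\<close>

function convolution_inverse ::
  "((mat_iso \<Rightarrow>\<^sub>0 'k::field) \<Rightarrow> (mat_iso \<Rightarrow>\<^sub>0 'k) \<Rightarrow> (mat_iso \<Rightarrow>\<^sub>0 'k)) \<Rightarrow> mat_iso \<Rightarrow> (mat_iso \<Rightarrow>\<^sub>0 'k)" where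
  "convolution_inverse m X = (if X = class_zero then delta class_zero
     else - (\<Sum>p\<in>splits X - {(X, class_zero)}. m (convolution_inverse m (fst p)) (delta (snd p))))"
  by auto
termination
proof (relation "measure (\<lambda>(m, X). class_size X)")
  fix m X p assume "p \<in> splits X - {(X, class_zero)}"
  then show "((m, fst p), (m, X)) \<in> measure (\<lambda>(m, X). class_size X)"
    using splits_size[of "fst p" "snd p" X] splits_zero_right[of "fst p" X] by (cases p) auto
qed simp

declare convolution_inverse.simps [simp del]

lemma splits_class_zero: "splits class_zero = {(class_zero, class_zero)}"
  by (auto simp: splits_def class_sum_zero_iff)

lemma convolution_inverse_left:
  assumes "\<And>f. m f (delta class_zero) = f"
  shows "(\<Sum>p\<in>splits X. m (convolution_inverse m (fst p)) (delta (snd p))) =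
    (if X = class_zero then delta class_zero else 0)"
proof (cases "X = class_zero")
  case True
  then show ?thesis by (simp add: splits_class_zero assms convolution_inverse.simps)
next
  case False
  have "(X, class_zero) \<in> splits X" by (simp add: splits_def)
  then have "(\<Sum>p\<in>splits X. m (convolution_inverse m (fst p)) (delta (snd p))) =
    m (convolution_inverse m X) (delta class_zero) +
    (\<Sum>p\<in>splits X - {(X, class_zero)}. m (convolution_inverse m (fst p)) (delta (snd p)))"
    by (subst sum.remove[OF finite_splits]) auto
  also have "\<dots> = 0"
    unfolding assms by (subst convolution_inverse.simps) (simp add: False)
  finally show ?thesis using False by simp
qed

lemma sum_splits_swap: "(\<Sum>p\<in>splits X. F (fst p) (snd p)) = (\<Sum>p\<in>splits X. F (snd p) (fst p))"
  by (rule sum.reindex_bij_witness[where i = prod.swap and j = prod.swap])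
    (auto simp: splits_def class_sum_commute)

text \<open>Both sides enumerate the ordered triples of classes with sum \<open>X\<close>. With
  associativity of the product this is associativity of convolution.\<close>

lemma sum_splits_assoc:
  "(\<Sum>p\<in>splits X. \<Sum>q\<in>splits (fst p). F (fst q) (snd q) (snd p)) =
    (\<Sum>p\<in>splits X. \<Sum>q\<in>splits (snd p). F (fst p) (fst q) (snd q))"
proof -
  have "(\<Sum>p\<in>splits X. \<Sum>q\<in>splits (fst p). F (fst q) (snd q) (snd p)) =
    (\<Sum>(p, q)\<in>(SIGMA p:splits X. splits (fst p)). F (fst q) (snd q) (snd p))"
    by (rule sum.Sigma) (auto simp: finite_splits)
  also have "\<dots> = (\<Sum>(p, q)\<in>(SIGMA p:splits X. splits (snd p)). F (fst p) (fst q) (snd q))"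
    by (rule sum.reindex_bij_witness[where
          j = "\<lambda>(p, q). ((fst q, class_sum (snd q) (snd p)), (snd q, snd p))" and
          i = "\<lambda>(p, q). ((class_sum (fst p) (fst q), snd q), (fst p, fst q))"])
      (auto simp: splits_def class_sum_assoc)
  also have "\<dots> = (\<Sum>p\<in>splits X. \<Sum>q\<in>splits (snd p). F (fst p) (fst q) (snd q))"
    by (rule sum.Sigma[symmetric]) (auto simp: finite_splits)
  finally show ?thesis .
qed

definition antipode_basis :: "mat_iso \<Rightarrow> (mat_iso \<Rightarrow>\<^sub>0 'k::field)" where
  "antipode_basis = convolution_inverse hall_mul"

lemma hall_mul_sum_left: "hall_mul (\<Sum>x\<in>A. F x) g = (\<Sum>x\<in>A. hall_mul (F x) g)"
  using linear_sum[OF linear_hall_mul_left[of g], of "\<lambda>_. 1" F A] by simp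

lemma hall_mul_sum_right: "hall_mul f (\<Sum>x\<in>A. F x) = (\<Sum>x\<in>A. hall_mul f (F x))"
  using linear_sum[OF linear_hall_mul[of f], of "\<lambda>_. 1" F A] by simp

lemma antipode_basis_left:
  "(\<Sum>p\<in>splits X. hall_mul (antipode_basis (fst p)) (delta (snd p))) =
    (if X = class_zero then delta class_zero else 0)"
  unfolding antipode_basis_def by (rule convolution_inverse_left) simp

text \<open>A left and a right convolution inverse of the identity exist by recursion on the size;
  they agree by associativity of the convolution.\<close>

lemma antipode_basis_right:
  "(\<Sum>p\<in>splits X. hall_mul (delta (fst p)) (antipode_basis (snd p))) =
    (if X = class_zero then delta class_zero else (0 :: mat_iso \<Rightarrow>\<^sub>0 'k::field))"
proof -
  define R :: "mat_iso \<Rightarrow> (mat_iso \<Rightarrow>\<^sub>0 'k)" where "R = convolution_inverse (\<lambda>f g. hall_mul g f)"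
  let ?L = "antipode_basis :: mat_iso \<Rightarrow> (mat_iso \<Rightarrow>\<^sub>0 'k)"
  let ?e = "\<lambda>X. if X = class_zero then delta class_zero else (0 :: mat_iso \<Rightarrow>\<^sub>0 'k)"
  have R: "(\<Sum>p\<in>splits X. hall_mul (delta (fst p)) (R (snd p))) = ?e X" for X
    using convolution_inverse_left[of "\<lambda>f g. hall_mul g f" X] sum_splits_swap[of "\<lambda>A B. hall_mul (delta A) (R B)" X]
    by (simp add: R_def)
  have z: "hall_mul 0 f = 0" "hall_mul f 0 = 0" for f :: "mat_iso \<Rightarrow>\<^sub>0 'k"
    using hall_mul_scale_left[of 0 0 f] hall_mul_scale_right[of f 0 0] by simp_all
  have "?L X = R X" for X
  proof -
    have "?L X = (\<Sum>p\<in>splits X. if p = (X, class_zero) then ?L X else 0)"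
      by (simp add: finite_splits) (simp add: splits_def)
    also have "\<dots> = (\<Sum>p\<in>splits X. hall_mul (?L (fst p)) (?e (snd p)))"
      by (intro sum.cong HOL.refl) (auto simp: splits_def z)
    also have "\<dots> = (\<Sum>p\<in>splits X. \<Sum>q\<in>splits (snd p). hall_mul (?L (fst p)) (hall_mul (delta (fst q)) (R (snd q))))"
      unfolding R[symmetric] hall_mul_sum_right ..
    also have "\<dots> = (\<Sum>p\<in>splits X. \<Sum>q\<in>splits (fst p). hall_mul (hall_mul (?L (fst q)) (delta (snd q))) (R (snd p)))"
      unfolding hall_mul_assoc by (rule sum_splits_assoc[symmetric])
    also have "\<dots> = (\<Sum>p\<in>splits X. hall_mul (?e (fst p)) (R (snd p)))"
      unfolding hall_mul_sum_left[symmetric] antipode_basis_left ..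
    also have "\<dots> = (\<Sum>p\<in>splits X. if p = (class_zero, X) then R X else 0)"
      by (intro sum.cong HOL.refl) (auto simp: splits_def z)
    also have "\<dots> = R X"
      by (simp add: finite_splits) (simp add: splits_def)
    finally show ?thesis .
  qed
  then have "?L = R" by (rule HOL.ext)
  then show ?thesis using R by simp
qed

lemma counit_delta: "pscale (lookup (delta X) class_zero) (delta class_zero) =
  (if X = class_zero then delta class_zero else 0)"
  by (simp add: lookup_delta)

lemma linear_counit_unit:
  "Vector_Spaces.linear pscale pscale (\<lambda>f :: mat_iso \<Rightarrow>\<^sub>0 'k::field. pscale (lookup f class_zero) (delta class_zero))"
  by (rule linear_pscaleI) (simp_all add: lookup_add pm.scale_left_distrib)

lemma is_antipode_lin_ext: "is_antipode (hall_algebra :: (mat_iso, 'k::field) hopf_data) (lin_ext antipode_basis)"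
  unfolding is_antipode_def hall_algebra_sel
proof (intro conjI allI linear_lin_ext)
  fix f :: "mat_iso \<Rightarrow>\<^sub>0 'k"
  show "lin_ext (\<lambda>(x, y). hall_mul (lin_ext antipode_basis (delta x)) (delta y)) (sum_comul f) =
    pscale (lookup f class_zero) (delta class_zero)"
  proof (rule linear_eqI[OF linear_compose[OF linear_sum_comul linear_lin_ext] linear_counit_unit])
    fix X show "lin_ext (\<lambda>(x, y). hall_mul (lin_ext antipode_basis (delta x)) (delta y)) (sum_comul (delta X)) =
      pscale (lookup (delta X) class_zero) (delta class_zero :: mat_iso \<Rightarrow>\<^sub>0 'k)"
      unfolding lin_ext_sum_comul_delta counit_delta case_prod_beta lin_ext_delta by (rule antipode_basis_left)
  qed
  show "lin_ext (\<lambda>(x, y). hall_mul (delta x) (lin_ext antipode_basis (delta y))) (sum_comul f) =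
    pscale (lookup f class_zero) (delta class_zero)"
  proof (rule linear_eqI[OF linear_compose[OF linear_sum_comul linear_lin_ext] linear_counit_unit])
    fix X show "lin_ext (\<lambda>(x, y). hall_mul (delta x) (lin_ext antipode_basis (delta y))) (sum_comul (delta X)) =
      pscale (lookup (delta X) class_zero) (delta class_zero :: mat_iso \<Rightarrow>\<^sub>0 'k)"
      unfolding lin_ext_sum_comul_delta counit_delta case_prod_beta lin_ext_delta by (rule antipode_basis_right)
  qed
qed

lemma hopf_algebra_hall: "hopf_algebra hall_algebra"
  unfolding hopf_algebra_def using bialgebra_hall is_antipode_lin_ext by blast


section \<open>The grading\<close>

lemma hall_grading_eq: "hall_grading \<gamma> = {f. \<forall>X\<in>keys f. K0_class X = \<gamma>}"
  unfolding hall_grading_def by (rule span_delta)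

lemma minor_grading_eq: "minor_grading n = {f. \<forall>X\<in>keys f. class_size X = n}"
  unfolding minor_grading_def by (rule span_delta)

lemma subspace_hall_grading: "pm.subspace (hall_grading \<gamma>)"
  unfolding hall_grading_def by (rule pm.subspace_span)

lemma delta_hall_grading: "delta X \<in> hall_grading (K0_class X)"
  by (simp add: hall_grading_eq)

lemma K0_plus_zero: "0 \<in> K0_plus"
  using K0_plus.K0_class[of class_zero] by (simp add: K0_class_zero)

lemma hall_mul_grading:
  assumes "f \<in> hall_grading \<alpha>" "g \<in> hall_grading \<beta>"
  shows "hall_mul f g \<in> hall_grading (\<alpha> + \<beta>)"
  unfolding hall_grading_eq
proof clarify
  fix X assume "X \<in> keys (hall_mul f g)"
  then have "minor_sum X (\<lambda>A B. lookup f B * lookup g A) \<noteq> 0" by (simp add: in_keys_iff lookup_hall_mul)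
  then obtain A B where AB: "(A, B) \<in> minors X" "lookup f B * lookup g A \<noteq> 0"
    using minor_sum_cong[of X "\<lambda>A B. lookup f B * lookup g A" "\<lambda>_ _. 0"] by (auto simp: minor_sum_def)
  then have "K0_class B = \<alpha>" "K0_class A = \<beta>"
    using assms by (auto simp: hall_grading_eq in_keys_iff)
  then show "K0_class X = \<alpha> + \<beta>"
    \<comment> \<open>The relation of \<open>K0\<close> gives subobject plus quotient, that is
      \<open>\<beta> + \<alpha>\<close>; the factors of the product stand in the other
      order.\<close>
    using K0_class_minors[OF AB(1)] K0_class_commute by metis
qed

lemma sum_comul_grading:
  fixes f :: "mat_iso \<Rightarrow>\<^sub>0 'k::field"
  assumes "f \<in> hall_grading \<gamma>"
  shows "sum_comul f \<in> pm.span {tensor u v | u v \<alpha> \<beta>. \<alpha> \<in> K0_plus \<and> \<beta> \<in> K0_plus \<and> \<alpha> + \<beta> = \<gamma> \<and>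
    u \<in> hall_grading \<alpha> \<and> v \<in> hall_grading \<beta>}" (is "_ \<in> pm.span ?T")
proof -
  have "delta p \<in> ?T" if "p \<in> keys (sum_comul f)" for p
  proof -
    obtain A B where p: "p = (A, B)" by (cases p)
    have "class_sum A B \<in> keys f" using that by (simp add: p in_keys_iff lookup_sum_comul)
    then have "K0_class A + K0_class B = \<gamma>" using assms by (simp add: hall_grading_eq K0_class_sum[symmetric])
    then show ?thesis
      unfolding p tensor_delta[symmetric]
      using delta_hall_grading[of A] delta_hall_grading[of B] K0_plus.K0_class by blast
  qed
  then have "(\<Sum>p\<in>keys (sum_comul f). pscale (lookup (sum_comul f) p) (delta p)) \<in> pm.span ?T"
    by (intro pm.span_sum pm.span_scale pm.span_base)
  then show ?thesis by (simp only: sum_pscale_delta)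
qed

text \<open>The grading axiom speaks of every antipode, so the argument may only use the antipode
  equation of \<open>S\<close>. Solved for the term at \<open>(X, class_zero)\<close>, it expresses
  \<open>S (delta X)\<close> through smaller classes, and degrees add up along
  \<open>splits X\<close>.\<close>

lemma antipode_delta_grading:
  fixes S :: "(mat_iso \<Rightarrow>\<^sub>0 'k::field) \<Rightarrow> (mat_iso \<Rightarrow>\<^sub>0 'k)"
  assumes S: "is_antipode hall_algebra S"
  shows "S (delta X) \<in> hall_grading (K0_class X)"
proof (induction "class_size X" arbitrary: X rule: less_induct)
  case less
  have eq: "(\<Sum>p\<in>splits X. hall_mul (S (delta (fst p))) (delta (snd p))) =
      (if X = class_zero then delta class_zero else 0)"
    using S unfolding is_antipode_def hall_algebra_sel
    by (metis (no_types, lifting) lin_ext_sum_comul_delta counit_delta case_prod_beta sum.cong)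
  have "(X, class_zero) \<in> splits X" by (simp add: splits_def)
  then have "S (delta X) = (if X = class_zero then delta class_zero else 0) -
      (\<Sum>p\<in>splits X - {(X, class_zero)}. hall_mul (S (delta (fst p))) (delta (snd p)))"
    unfolding eq[symmetric] by (subst sum.remove[OF finite_splits]) auto
  also have "\<dots> \<in> hall_grading (K0_class X)"
  proof (intro pm.subspace_diff[OF subspace_hall_grading] pm.subspace_sum[OF subspace_hall_grading])
    show "(if X = class_zero then delta class_zero else 0) \<in> hall_grading (K0_class X)"
      using delta_hall_grading pm.subspace_0[OF subspace_hall_grading] by auto
    fix p assume p: "p \<in> splits X - {(X, class_zero)}"
    obtain A B where AB: "p = (A, B)" by (cases p)
    have "class_size A < class_size X"
      using p splits_size[of A B X] splits_zero_right[of A X] by (auto simp: AB)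
    then have "hall_mul (S (delta A)) (delta B) \<in> hall_grading (K0_class A + K0_class B)"
      using less hall_mul_grading delta_hall_grading by blast
    moreover have "class_sum A B = X" using p by (simp add: AB splits_def)
    ultimately show "hall_mul (S (delta (fst p))) (delta (snd p)) \<in> hall_grading (K0_class X)"
      by (simp add: AB K0_class_sum[symmetric])
  qed
  finally show ?case .
qed

lemma antipode_grading:
  assumes S: "is_antipode hall_algebra S" and f: "f \<in> hall_grading \<gamma>"
  shows "S f \<in> hall_grading \<gamma>"
proof -
  have lin: "Vector_Spaces.linear pscale pscale S" using S by (simp add: is_antipode_def)
  have "S (delta X) \<in> hall_grading \<gamma>" if "X \<in> keys f" for X
    using antipode_delta_grading[OF S, of X] f that by (auto simp: hall_grading_eq)
  then show ?thesis
    unfolding linear_expand[OF lin, of f]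
    by (intro pm.subspace_sum[OF subspace_hall_grading] pm.subspace_scale[OF subspace_hall_grading])
qed

lemma graded_hopf_algebra_hall:
  "graded_hopf_algebra K0_plus hall_grading (hall_algebra :: (mat_iso, 'k::field) hopf_data)"
  unfolding graded_hopf_algebra_def
proof (intro conjI ballI allI impI)
  show "graded_space K0_plus (hall_grading :: K0 \<Rightarrow> (mat_iso \<Rightarrow>\<^sub>0 'k) set)"
    unfolding hall_grading_def by (rule graded_space_span_delta) (rule K0_plus.K0_class)
  show "unity hall_algebra \<in> (hall_grading 0 :: (mat_iso \<Rightarrow>\<^sub>0 'k) set)"
    using delta_hall_grading[of class_zero] by (simp add: K0_class_zero)
  show "counit hall_algebra f = 0" if "\<gamma> \<noteq> 0" "f \<in> hall_grading \<gamma>" for \<gamma> and f :: "mat_iso \<Rightarrow>\<^sub>0 'k"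
    using that by (cases "class_zero \<in> keys f") (auto simp: hall_grading_eq K0_class_zero not_in_keys_iff_lookup_eq_zero)
  show "comul hall_algebra f \<in> pm.span {tensor u v | u v \<alpha> \<beta>. \<alpha> \<in> K0_plus \<and> \<beta> \<in> K0_plus \<and> \<alpha> + \<beta> = \<gamma> \<and>
      u \<in> hall_grading \<alpha> \<and> v \<in> hall_grading \<beta>}"
    if "f \<in> hall_grading \<gamma>" for \<gamma> and f :: "mat_iso \<Rightarrow>\<^sub>0 'k"
    unfolding hall_algebra_sel using that by (rule sum_comul_grading)
qed (auto simp: hopf_algebra_hall K0_plus_zero K0_plus.plus hall_mul_grading antipode_grading)

lemma connected_hall: "connected_grading hall_grading (hall_algebra :: (mat_iso, 'k::field) hopf_data)"
proof -
  have "f \<in> hall_grading 0 \<longleftrightarrow> (\<exists>c. f = pscale c (delta class_zero))" for f :: "mat_iso \<Rightarrow>\<^sub>0 'k"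
  proof
    assume f: "f \<in> hall_grading 0"
    have "f = pscale (lookup f class_zero) (delta class_zero)"
    proof (rule poly_mapping_eqI)
      fix X show "lookup f X = lookup (pscale (lookup f class_zero) (delta class_zero)) X"
        using f by (cases "X \<in> keys f")
          (auto simp: hall_grading_eq K0_class_eq_0_iff not_in_keys_iff_lookup_eq_zero lookup_delta)
    qed
    then show "\<exists>c. f = pscale c (delta class_zero)" by blast
  qed (auto simp: hall_grading_eq K0_class_zero in_keys_iff lookup_delta split: if_splits)
  then show ?thesis unfolding connected_grading_def by auto
qed

section \<open>The dual of the matroid-minor Hopf algebra\<close>

lemma eval_pairing_dot: "eval_pairing f v = dot f v"
  by (simp add: eval_pairing_def dot_def)

lemma minor_dual_sel [simp]:
  "mul minor_dual = minor_dual_mul" "unity minor_dual = delta class_zero"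
  "comul minor_dual = sum_comul" "counit minor_dual = (\<lambda>f. lookup f class_zero)"
  by (simp_all add: minor_dual_def)

text \<open>A functional vanishing on almost all degrees is nonzero on finitely many basis elements,
  because each degree contains finitely many classes; its values there form the representing
  function. Conversely a finite support meets finitely many degrees.\<close>

lemma bij_eval_pairing:
  "bij_betw (eval_pairing :: (mat_iso \<Rightarrow>\<^sub>0 'k::field) \<Rightarrow> _) UNIV
     {\<phi>. Vector_Spaces.linear pscale (*) \<phi> \<and> finite {n. \<exists>v\<in>minor_grading n. \<phi> v \<noteq> 0}}"
proof (rule bij_betwI')
  fix f g :: "mat_iso \<Rightarrow>\<^sub>0 'k"
  show "eval_pairing f = eval_pairing g \<longleftrightarrow> f = g"
  proof
    assume eq: "eval_pairing f = eval_pairing g"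
    show "f = g"
    proof (rule poly_mapping_eqI)
      fix X show "lookup f X = lookup g X"
        using fun_cong[OF eq, of "delta X"] by (simp add: eval_pairing_dot)
    qed
  qed simp
next
  fix f :: "mat_iso \<Rightarrow>\<^sub>0 'k"
  have e: "eval_pairing f = dot f" by (rule ext) (rule eval_pairing_dot)
  have "{n. \<exists>v\<in>minor_grading n. dot f v \<noteq> 0} \<subseteq> class_size ` keys f"
  proof clarify
    fix n and v :: "mat_iso \<Rightarrow>\<^sub>0 'k" assume v: "v \<in> minor_grading n" and "dot f v \<noteq> 0"
    then obtain X where "X \<in> keys v" "lookup f X \<noteq> 0"
      unfolding dot_def by (metis (no_types, lifting) mult_zero_left sum.neutral)
    then have "X \<in> keys f" "class_size X = n" using v by (simp_all add: minor_grading_eq lookup_not_eq_zero_eq_in_keys)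
    then show "n \<in> class_size ` keys f" by blast
  qed
  then have "finite {n. \<exists>v\<in>minor_grading n. dot f v \<noteq> 0}" by (rule finite_subset) simp
  then show "eval_pairing f \<in> {\<phi>. Vector_Spaces.linear pscale (*) \<phi> \<and> finite {n. \<exists>v\<in>minor_grading n. \<phi> v \<noteq> 0}}"
    unfolding e by (simp add: linear_dot)
next
  fix \<phi> :: "(mat_iso \<Rightarrow>\<^sub>0 'k) \<Rightarrow> 'k"
  assume "\<phi> \<in> {\<phi>. Vector_Spaces.linear pscale (*) \<phi> \<and> finite {n. \<exists>v\<in>minor_grading n. \<phi> v \<noteq> 0}}"
  then have lin: "Vector_Spaces.linear pscale (*) \<phi>" and fin: "finite {n. \<exists>v\<in>minor_grading n. \<phi> v \<noteq> 0}"
    by simp_all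
  let ?N = "{n. \<exists>v\<in>minor_grading n. \<phi> v \<noteq> 0}"
  have "{X. \<phi> (delta X) \<noteq> 0} \<subseteq> (\<Union>n\<in>?N. {X. class_size X = n})"
  proof
    fix X assume "X \<in> {X. \<phi> (delta X) \<noteq> 0}"
    moreover have "delta X \<in> (minor_grading (class_size X) :: (mat_iso \<Rightarrow>\<^sub>0 'k) set)"
      by (simp add: minor_grading_eq)
    ultimately show "X \<in> (\<Union>n\<in>?N. {X. class_size X = n})" by blast
  qed
  moreover have "finite (\<Union>n\<in>?N. {X. class_size X = n})" using fin finite_class_size by (rule finite_UN_I)
  ultimately have "finite {X. \<phi> (delta X) \<noteq> 0}" by (rule finite_subset)
  then have l: "lookup (Abs_poly_mapping (\<lambda>X. \<phi> (delta X))) X = \<phi> (delta X)" for X by simp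
  have "\<phi> v = eval_pairing (Abs_poly_mapping (\<lambda>X. \<phi> (delta X))) v" for v
    unfolding eval_pairing_dot by (rule linear_eqI[OF lin linear_dot]) (simp add: l)
  then show "\<exists>f\<in>UNIV. \<phi> = eval_pairing f" by blast
qed

lemma graded_dual_minor:
  "graded_dual eval_pairing (minor_dual :: (mat_iso, 'k::field) hopf_data) minor_algebra minor_grading"
  unfolding graded_dual_def
proof (intro conjI allI)
  show "bij_betw (eval_pairing :: (mat_iso \<Rightarrow>\<^sub>0 'k) \<Rightarrow> _) UNIV
    {\<phi>. Vector_Spaces.linear pscale (*) \<phi> \<and> finite {n. \<exists>v\<in>minor_grading n. \<phi> v \<noteq> 0}}"
    by (rule bij_eval_pairing)
next
  have e: "eval_pairing = (dot :: (mat_iso \<Rightarrow>\<^sub>0 'k) \<Rightarrow> _)" by (intro HOL.ext) (rule eval_pairing_dot)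
  have pt: "pairing_tensor dot s t = dot s t" for s t :: "mat_iso \<times> mat_iso \<Rightarrow>\<^sub>0 'k"
    by (rule pairing_tensor_dot) (simp add: lookup_delta)
  fix f g v :: "mat_iso \<Rightarrow>\<^sub>0 'k"
  show "Vector_Spaces.linear pscale (*) (eval_pairing f)" unfolding e by (rule linear_dot)
  show "Vector_Spaces.linear pscale (*) (\<lambda>f. eval_pairing f v)" unfolding e by (rule linear_dot_left)
  show "eval_pairing (mul minor_dual f g) v = pairing_tensor eval_pairing (tensor f g) (comul minor_algebra v)"
    unfolding e pt minor_dual_sel
  proof (rule linear_eqI[OF linear_dot, where K = "\<lambda>v. dot (tensor f g) (comul minor_algebra v)" and f = v])
    show "Vector_Spaces.linear pscale (*) (\<lambda>v. dot (tensor f g) (comul minor_algebra v))"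
      unfolding minor_algebra_def by simp (rule linear_compose[OF linear_lin_ext linear_dot])
    fix X show "dot (minor_dual_mul f g) (delta X) = dot (tensor f g) (comul minor_algebra (delta X))"
      by (simp add: minor_algebra_def Let_def dot_sum_delta lookup_tensor lookup_minor_dual_mul minor_sum_def)
  qed
  show "eval_pairing (unity minor_dual) v = counit minor_algebra v"
  proof -
    \<comment> \<open>The counit of the minor algebra tests for an empty set of elements, the unit
      of the dual for the zero class.\<close>
    have "elems (rep_mat_iso X) = {} \<longleftrightarrow> X = class_zero" for X
      using iso_class_zero_iff[OF pmatroid_rep[of X]] by simp
    then show ?thesis
      by (auto simp: eval_pairing_def minor_algebra_def lookup_delta intro!: sum.cong)
  qed
  show "counit minor_dual f = eval_pairing f (unity minor_algebra)"
    by (simp add: e minor_algebra_def)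
next
  fix f u v :: "mat_iso \<Rightarrow>\<^sub>0 'k"
  have e: "eval_pairing = (dot :: (mat_iso \<Rightarrow>\<^sub>0 'k) \<Rightarrow> _)" by (intro HOL.ext) (rule eval_pairing_dot)
  have pt: "pairing_tensor dot s t = dot s t" for s t :: "mat_iso \<times> mat_iso \<Rightarrow>\<^sub>0 'k"
    by (rule pairing_tensor_dot) (simp add: lookup_delta)
  \<comment> \<open>The support of the tensor is enlarged to a product so that the sum becomes two
    iterated sums.\<close>
  have "keys (tensor u v) \<subseteq> keys u \<times> keys v"
  proof
    fix p assume "p \<in> keys (tensor u v)"
    then show "p \<in> keys u \<times> keys v" by (cases p) (auto simp: in_keys_iff lookup_tensor)
  qed
  then have "dot (sum_comul f) (tensor u v) =
    (\<Sum>p\<in>keys u \<times> keys v. lookup (sum_comul f) p * lookup (tensor u v) p)"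
    by (intro dot_superset) auto
  also have "\<dots> = (\<Sum>X\<in>keys u. lookup u X * (\<Sum>Y\<in>keys v. lookup v Y * lookup f (class_sum X Y)))"
    by (simp add: sum.cartesian_product' lookup_sum_comul lookup_tensor sum_distrib_left algebra_simps)
  also have "\<dots> = dot f (mul minor_algebra u v)"
    by (simp add: minor_algebra_def dot_lin_ext)
  finally show "pairing_tensor eval_pairing (comul minor_dual f) (tensor u v) = eval_pairing f (mul minor_algebra u v)"
    by (simp add: pt e)
qed

section \<open>The isomorphism given by matroid duality\<close>

lemma class_dual_zero: "class_dual class_zero = class_zero"
  unfolding class_dual_zero_iff ..

definition dual_pullback :: "(mat_iso \<Rightarrow>\<^sub>0 'k::field) \<Rightarrow> (mat_iso \<Rightarrow>\<^sub>0 'k)" where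
  "dual_pullback f = Abs_poly_mapping (\<lambda>X. lookup f (class_dual X))"

lemma lookup_dual_pullback [simp]: "lookup (dual_pullback f) X = lookup f (class_dual X)"
proof -
  \<comment> \<open>\<open>class_dual\<close> is an involution, so the support of the pullback lies
    in the image of the support of \<open>f\<close>.\<close>
  have "{X. lookup f (class_dual X) \<noteq> 0} \<subseteq> class_dual ` keys f"
  proof
    fix X assume "X \<in> {X. lookup f (class_dual X) \<noteq> 0}"
    then show "X \<in> class_dual ` keys f"
      by (intro image_eqI[of _ _ "class_dual X"]) (auto simp: in_keys_iff)
  qed
  then have "finite {X. lookup f (class_dual X) \<noteq> 0}" by (rule finite_subset) simp
  then show ?thesis by (simp add: dual_pullback_def)
qed

lemma hopf_iso_dual_pullback:
  "hopf_iso (hall_algebra :: (mat_iso, 'k::field) hopf_data) minor_dual dual_pullback"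
  unfolding hopf_iso_def hall_algebra_sel minor_dual_sel
proof (intro conjI allI)
  show "Vector_Spaces.linear pscale pscale (dual_pullback :: (mat_iso \<Rightarrow>\<^sub>0 'k) \<Rightarrow> _)"
    by (rule linear_pscaleI; rule poly_mapping_eqI) (simp_all add: lookup_add)
  \<comment> \<open>The pullback is its own inverse because \<open>class_dual\<close> is an
    involution.\<close>
  show "bij (dual_pullback :: (mat_iso \<Rightarrow>\<^sub>0 'k) \<Rightarrow> _)"
    by (rule o_bij[of dual_pullback]; rule HOL.ext; rule poly_mapping_eqI) simp_all
  show "dual_pullback (delta class_zero :: mat_iso \<Rightarrow>\<^sub>0 'k) = delta class_zero"
    by (rule poly_mapping_eqI) (simp add: lookup_delta eq_commute[of class_zero])
  fix f g :: "mat_iso \<Rightarrow>\<^sub>0 'k"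
  show "dual_pullback (hall_mul f g) = minor_dual_mul (dual_pullback f) (dual_pullback g)"
    by (rule poly_mapping_eqI) (simp add: lookup_hall_mul lookup_minor_dual_mul minor_sum_dual)
  show "sum_comul (dual_pullback f) = tensor_map dual_pullback dual_pullback (sum_comul f)"
  proof (rule poly_mapping_eqI)
    fix p
    obtain X Y :: mat_iso where p: "p = (X, Y)" by (cases p)
    have "lookup (tensor_map dual_pullback dual_pullback (sum_comul f)) (X, Y) =
      lookup (sum_comul f) (class_dual X, class_dual Y)"
      by (rule lookup_tensor_map_delta) (simp_all add: lookup_delta)
    then show "lookup (sum_comul (dual_pullback f)) p =
      lookup (tensor_map dual_pullback dual_pullback (sum_comul f)) p"
      by (simp add: p lookup_sum_comul class_dual_sum)
  qed
  show "lookup (dual_pullback f) class_zero = lookup f class_zero"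
    by (simp add: class_dual_zero)
qed

theorem theoremD:
  shows "graded_hopf_algebra K0_plus hall_grading
           (hall_algebra :: (mat_iso, 'k::field_char_0) hopf_data) \<and>
         connected_grading hall_grading (hall_algebra :: (mat_iso, 'k) hopf_data) \<and>
         cocommutative (hall_algebra :: (mat_iso, 'k) hopf_data) \<and>
         graded_dual eval_pairing (minor_dual :: (mat_iso, 'k) hopf_data)
           minor_algebra minor_grading \<and>
         hopf_isomorphic (hall_algebra :: (mat_iso, 'k) hopf_data) minor_dual"
  using graded_hopf_algebra_hall connected_hall cocommutative_hall graded_dual_minor hopf_iso_dual_pullback
  unfolding hopf_isomorphic_def by blast

end
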